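(* Let $k \geq 120$ be an even integer, and let $r$ be the dimension of the complex vector space $S_k$. Let $f_1, \dots, f_r$ be the normalized eigenbasis of $S_k$, and let $c_1, \dots, c_r$ be non-negative real numbers, not all zero. If $f = c_1 f_1 + \dots + c_r f_r$, then the period polynomial $r_f(z)$ satisfies the Riemann hypothesis.
   Context: $S_k$ is the complex vector space of cusp forms of weight $k$ for $\mathrm{SL}_2(\mathbb{Z})$, and $q = e^{2\pi i z}$. The normalized eigenbasis of $S_k$ is its basis of Hecke eigenforms normalized to have Fourier expansion $q + O(q^2)$. For $f \in S_k$ with Fourier expansion $f(z)=\sum_{n\ge1} a_n q^n$, the Eichler integral is $\mathcal{E}_f(z) := \int_z^{i\infty} f(\tau)(\tau - z)^{k-2}\, d\tau$ (for $\mathrm{Im}\, z>0$), and the period polynomial of $f$ is $$r_f(z) := \mathcal{E}_f(z) - z^{k-2}\mathcal{E}_f(-1/z) = -\frac{(k-2)!}{(2\pi i)^{k-1}} \sum_{n=0}^{k-2} \frac{(2\pi i z)^n}{n!} L(f, k-n-1),$$ a polynomial of degree at most $k-2$, where $L(f,s)$ is the analytic continuation of $\sum_{n \geq 1} a_n n^{-s}$. We say that $r_f(z)$ satisfies the Riemann hypothesis (equivalently, is unimodular) if all of its complex zeros lie on the unit circle $|z| = 1$. *)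

theory Defs
  imports "HOL-Complex_Analysis.Complex_Analysis" "HOL-Library.Function_Algebras"
begin

definition upper_half_plane :: "complex set" where
  "upper_half_plane = {z. Im z > 0}"

global_interpretation fun_vs: vector_space "\<lambda>(c::complex) (f::complex \<Rightarrow> complex) z. c * f z"
  defines fun_span = fun_vs.span
    and fun_dependent = fun_vs.dependent
    and fun_dim = fun_vs.dim
  by unfold_locales (auto simp: algebra_simps fun_eq_iff)

definition has_q_expansion :: "(complex \<Rightarrow> complex) \<Rightarrow> (nat \<Rightarrow> complex) \<Rightarrow> bool" where
  "has_q_expansion f a \<longleftrightarrow>
     (\<forall>z\<in>upper_half_plane. (\<lambda>n. a n * exp (2 * of_real pi * \<i> * z) ^ n) sums f z)"

text \<open>
  Cusp forms of weight \<open>k\<close> for the full modular group. Functions on the upper half plane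
  are represented by total functions that vanish outside it, so that equality and the
  pointwise vector space structure are those of functions on the upper half plane.
\<close>

definition cusp_forms :: "nat \<Rightarrow> (complex \<Rightarrow> complex) set" where
  "cusp_forms k = {f.
     f holomorphic_on upper_half_plane \<and>
     (\<forall>a b c d :: int. a * d - b * c = 1 \<longrightarrow> (\<forall>z\<in>upper_half_plane.
        f ((of_int a * z + of_int b) / (of_int c * z + of_int d)) =
          (of_int c * z + of_int d) ^ k * f z)) \<and>
     (\<exists>a. has_q_expansion f a \<and> a 0 = 0) \<and>
     (\<forall>z. z \<notin> upper_half_plane \<longrightarrow> f z = 0)}"

lemma subspace_cusp_forms: "fun_vs.subspace (cusp_forms k)"
proof (rule fun_vs.subspaceI)
  show "0 \<in> cusp_forms k"
    by (auto simp: cusp_forms_def has_q_expansion_def zero_fun_def intro!: exI[of _ "\<lambda>_. 0"])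
next
  fix f g assume f: "f \<in> cusp_forms k" and g: "g \<in> cusp_forms k"
  obtain a b where "has_q_expansion f a" "a 0 = 0" "has_q_expansion g b" "b 0 = 0"
    using f g by (auto simp: cusp_forms_def)
  hence "has_q_expansion (f + g) (\<lambda>n. a n + b n) \<and> a 0 + b 0 = 0"
    by (auto simp: has_q_expansion_def distrib_right intro!: sums_add)
  hence "\<exists>a. has_q_expansion (f + g) a \<and> a 0 = 0" by (intro exI[of _ "\<lambda>n. a n + b n"])
  thus "f + g \<in> cusp_forms k" using f g
    by (auto simp: cusp_forms_def distrib_left plus_fun_def intro!: holomorphic_on_add)
next
  fix c f assume f: "f \<in> cusp_forms k"
  obtain a where "has_q_expansion f a" "a 0 = 0"
    using f by (auto simp: cusp_forms_def)
  hence "has_q_expansion (\<lambda>z. c * f z) (\<lambda>n. c * a n) \<and> c * a 0 = 0"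
    by (auto simp: has_q_expansion_def mult.assoc intro!: sums_mult)
  hence "\<exists>a. has_q_expansion (\<lambda>z. c * f z) a \<and> a 0 = 0" by (intro exI[of _ "\<lambda>n. c * a n"])
  thus "(\<lambda>z. c * f z) \<in> cusp_forms k" using f
    by (auto simp: cusp_forms_def intro!: holomorphic_intros)
qed

text \<open>
  The Hecke operator \<open>T\<^sub>n f(z) = n\<^bsup>k-1\<^esup> \<Sum> d\<^bsup>-k\<^esup> f((az + b)/d)\<close>, summed over
  \<open>ad = n\<close>, \<open>0 \<le> b < d\<close>; here \<open>a = n div d\<close>.
\<close>

definition hecke_op :: "nat \<Rightarrow> nat \<Rightarrow> (complex \<Rightarrow> complex) \<Rightarrow> complex \<Rightarrow> complex" where
  "hecke_op k n f z = of_nat n ^ (k - 1) *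
     (\<Sum>d | d dvd n. \<Sum>b<d. f ((of_nat (n div d) * z + of_nat b) / of_nat d) / of_nat d ^ k)"

definition hecke_eigenform :: "nat \<Rightarrow> (complex \<Rightarrow> complex) \<Rightarrow> bool" where
  "hecke_eigenform k f \<longleftrightarrow> f \<in> cusp_forms k \<and> f \<noteq> 0 \<and>
     (\<forall>n\<ge>1. \<exists>\<mu>. \<forall>z. hecke_op k n f z = \<mu> * f z)"

definition normalized_hecke_eigenform :: "nat \<Rightarrow> (complex \<Rightarrow> complex) \<Rightarrow> bool" where
  "normalized_hecke_eigenform k f \<longleftrightarrow> hecke_eigenform k f \<and>
     (\<exists>a. has_q_expansion f a \<and> a 0 = 0 \<and> a 1 = 1)"

definition normalized_eigenbasis :: "nat \<Rightarrow> nat \<Rightarrow> (nat \<Rightarrow> complex \<Rightarrow> complex) \<Rightarrow> bool" where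
  "normalized_eigenbasis k r f \<longleftrightarrow>
     (\<forall>i\<in>{1..r}. normalized_hecke_eigenform k (f i)) \<and>
     inj_on f {1..r} \<and> \<not> fun_dependent (f ` {1..r}) \<and> fun_span (f ` {1..r}) = cusp_forms k"

text \<open>
  The integral from \<open>z\<close> to \<open>\<i>\<infinity>\<close> is taken along the vertical ray \<open>\<tau> = z + \<i>t\<close>, \<open>t \<ge> 0\<close>,
  with \<open>d\<tau> = \<i> dt\<close>.
\<close>

definition eichler_integral :: "nat \<Rightarrow> (complex \<Rightarrow> complex) \<Rightarrow> complex \<Rightarrow> complex" where
  "eichler_integral k f z =
     integral {0..} (\<lambda>t. let \<tau> = z + \<i> * complex_of_real t in f \<tau> * (\<tau> - z) ^ (k - 2) * \<i>)"

text \<open>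
  The defining expression makes sense only on the upper half plane, where for a cusp form
  \<open>f\<close> it agrees with a polynomial; this polynomial, as a function on the whole complex plane,
  is the period polynomial.
\<close>

definition period_polynomial :: "nat \<Rightarrow> (complex \<Rightarrow> complex) \<Rightarrow> complex poly" where
  "period_polynomial k f = (THE p. \<forall>z\<in>upper_half_plane.
     poly p z = eichler_integral k f z - z ^ (k - 2) * eichler_integral k f (- 1 / z))"

lemma poly_eq_on_upper_half_plane:
  fixes p q :: "complex poly"
  assumes "\<And>z. z \<in> upper_half_plane \<Longrightarrow> poly p z = poly q z"
  shows "p = q"
proof (rule ccontr)
  assume "p \<noteq> q"
  hence "finite {z. poly (p - q) z = 0}" by (intro poly_roots_finite) auto
  moreover have "(\<lambda>n::nat. Complex 0 (real n + 1)) ` UNIV \<subseteq> {z. poly (p - q) z = 0}"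
    using assms by (auto simp: upper_half_plane_def)
  ultimately have "finite ((\<lambda>n::nat. Complex 0 (real n + 1)) ` UNIV)"
    by (rule rev_finite_subset)
  moreover have "inj (\<lambda>n::nat. Complex 0 (real n + 1))" by (auto simp: inj_def)
  ultimately show False using finite_imageD infinite_UNIV_nat by blast
qed

definition satisfies_RH :: "complex poly \<Rightarrow> bool" where
  "satisfies_RH p \<longleftrightarrow> (\<forall>z. poly p z = 0 \<longrightarrow> cmod z = 1)"

end

theory Submission
  imports Defs "HOL-Computational_Algebra.Fundamental_Theorem_Algebra"
    "HOL-Analysis.Kronecker_Approximation_Theorem"
begin

text \<open>
  Put \<open>k = 2m\<close> and \<open>w = k - 2\<close>. For \<open>f\<close> with real Fourier coefficients, splitting the period
  integral at \<open>i\<close> gives, up to a constant, \<open>r\<^sub>f(iu) = W(u) + (-1)\<^sup>m W\<^sup>*(u)\<close> with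
  \<open>W(u) = \<integral>\<^sub>1\<^sup>\<infinity> f(it) (t - u)\<^sup>w dt\<close> and \<open>W\<^sup>*(u) = u\<^sup>w cnj (W (1 / cnj u))\<close>.
  If \<open>W\<close> has no zeros in the closed unit disc, then \<open>|W\<^sup>*| < |W|\<close> inside the disc and
  \<open>|W\<^sup>*| > |W|\<close> outside, so all zeros of the sum are unimodular. For \<open>k \<ge> 120\<close> the first
  Fourier coefficient dominates \<open>W\<close>: its contribution is a truncated exponential series, while
  the others are controlled by a bound for the coefficients.

  No deep bound for the coefficients is needed. For a normalized eigenform, \<open>a\<^sub>n\<close> is the
  eigenvalue of \<open>T\<^sub>n\<close>, and comparing suprema of \<open>|f(z)| (Im z)\<^sup>m\<close> on both sides of
  \<open>T\<^sub>n f = a\<^sub>n f\<close> yields \<open>|a\<^sub>n| \<le> \<sigma>(n) n\<^bsup>m-1\<^esup> \<le> n\<^bsup>m+1\<^esup>\<close>. That \<open>a\<^sub>n\<close> is real is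
  the self-adjointness of \<open>T\<^sub>n\<close> for the Petersson product, where the fundamental domain is
  replaced by a weight whose sum over each orbit of \<open>SL\<^sub>2(\<int>)\<close> is one: the product
  \<open>\<langle>T\<^sub>n f, f\<rangle>\<close> then unfolds to a sum over all integer matrices of determinant \<open>n\<close>, which
  is symmetric under passing to the adjugate.
\<close>

section \<open>Growth of cusp forms\<close>

text \<open>The estimate for \<open>W\<close> on the closed disc is a contest between powers. There
  \<open>|t - u| <= t + 1\<close>, so the \<open>n\<close>-th coefficient contributes at most about
  \<open>2^w w! / (2 pi n)^(w+1)\<close>, where \<open>w + 1 = 2m - 1\<close>; with
  \<open>|a_n| <= n^(m+1)\<close> its size relative to \<open>n = 1\<close> is of order
  \<open>4^m / n^(m-2)\<close>. For large \<open>m\<close> this is small only if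
  \<open>n >= 5\<close>, so \<open>n = 2, 3, 4\<close> get a separate bound that keeps an
  exponential factor. The first coefficient contributes a truncation of
  \<open>exp (2 pi (1 - u))\<close>; since \<open>Re (1 - u) >= 0\<close> on the disc, its modulus
  drops below 1 by at most the truncation error.

  A non-negative combination obeys the same estimate: every eigenform has first coefficient 1, so
  the bounds for the \<open>c i * f i\<close> add up to the first coefficient of the sum times
  \<open>n^(m+1)\<close>, without loss. Reality of the coefficients makes the part of the period
  integral below \<open>i\<close> the conjugate reflection of the part above it: \<open>f\<close> is
  real on the imaginary axis, hence so are the moments that form the coefficients of
  \<open>W\<close>.\<close>

lemma upper_half_plane_iff [simp]: "z \<in> upper_half_plane \<longleftrightarrow> Im z > 0"
  by (simp add: upper_half_plane_def)

lemma exp_2pi_i_imaginary: "exp (2 * of_real pi * \<i> * (\<i> * of_real t)) = of_real (exp (- (2 * pi * t)))"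
proof -
  have "2 * of_real pi * \<i> * (\<i> * of_real t) = complex_of_real (- (2 * pi * t))"
    by (simp add: algebra_simps)
  thus ?thesis by (simp only: exp_of_real)
qed

lemma cmod_exp_2pi_i: "cmod (exp (2 * of_real pi * \<i> * z)) = exp (- (2 * pi * Im z))"
  by simp

text \<open>Each radius in \<open>(0, 1)\<close> is the value of \<open>q\<close> at a point of the
  imaginary axis, so the expansion converges at a radius \<open>y\<close> beyond \<open>x\<close>,
  hence absolutely at \<open>x\<close>.\<close>

lemma q_expansion_abs_summable:
  assumes "has_q_expansion f a" "0 \<le> x" "x < 1"
  shows "summable (\<lambda>n. cmod (a n) * x ^ n)"
proof -
  define y where "y = (x + 1) / 2"
  have y: "x < y" "0 < y" "y < 1" using assms by (auto simp: y_def)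
  define t where "t = - ln y / (2 * pi)"
  have "t > 0" using y by (simp add: t_def divide_neg_pos)
  hence "(\<lambda>n. a n * exp (2 * of_real pi * \<i> * (\<i> * of_real t)) ^ n) sums f (\<i> * of_real t)"
    using assms(1) unfolding has_q_expansion_def by simp
  moreover have "exp (2 * of_real pi * \<i> * (\<i> * of_real t)) = of_real y"
    unfolding exp_2pi_i_imaginary using y by (simp add: t_def)
  ultimately have "summable (\<lambda>n. a n * of_real y ^ n)" by (auto simp: sums_iff)
  hence "summable (\<lambda>n. norm (a n * of_real x ^ n))"
    using y assms by (intro powser_insidea[of a "of_real y"]) auto
  thus ?thesis using assms by (simp add: norm_mult norm_power)
qed

lemma cusp_form_decay:
  assumes f: "has_q_expansion f a" and a0: "a 0 = 0" and \<delta>: "\<delta> > 0"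
  obtains K where "K \<ge> 0" "\<And>z. Im z \<ge> \<delta> \<Longrightarrow> cmod (f z) \<le> K * exp (- (2 * pi * Im z))"
proof -
  define r where "r = exp (- (2 * pi * \<delta>))"
  have r: "r > 0" "r < 1" using \<delta> by (auto simp: r_def)
  have "summable (\<lambda>n. cmod (a n) * r ^ n)" using f r by (intro q_expansion_abs_summable) auto
  hence "summable (\<lambda>n. cmod (a (Suc n)) * r ^ Suc n)" by (subst summable_Suc_iff)
  hence "summable (\<lambda>n. r * (cmod (a (Suc n)) * r ^ n))" by (simp add: mult_ac)
  hence summ: "summable (\<lambda>n. cmod (a (Suc n)) * r ^ n)" using r by (subst (asm) summable_cmult_iff) auto
  show ?thesis
  proof
    show "(\<Sum>n. cmod (a (Suc n)) * r ^ n) \<ge> 0" using r by (intro suminf_nonneg summ) auto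
    fix z assume z: "Im z \<ge> \<delta>"
    let ?q = "exp (2 * of_real pi * \<i> * z)"
    have qr: "cmod ?q \<le> r" unfolding cmod_exp_2pi_i r_def using z by simp
    have "(\<lambda>n. a n * ?q ^ n) sums f z" using f z \<delta> by (auto simp: has_q_expansion_def)
    hence "(\<lambda>n. a (Suc n) * ?q ^ Suc n) sums f z" using sums_Suc_iff[of "\<lambda>n. a n * ?q ^ n"] a0 by simp
    hence s: "f z = (\<Sum>n. a (Suc n) * ?q ^ Suc n)" by (simp add: sums_iff)
    have le: "cmod (a (Suc n) * ?q ^ Suc n) \<le> cmod ?q * (cmod (a (Suc n)) * r ^ n)" for n
    proof -
      have "cmod (a (Suc n) * ?q ^ Suc n) = cmod ?q * (cmod (a (Suc n)) * cmod ?q ^ n)"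
        by (simp add: norm_mult norm_power)
      also have "\<dots> \<le> cmod ?q * (cmod (a (Suc n)) * r ^ n)"
        by (intro mult_left_mono power_mono qr) auto
      finally show ?thesis .
    qed
    have "cmod (f z) \<le> (\<Sum>n. cmod ?q * (cmod (a (Suc n)) * r ^ n))"
      unfolding s by (intro norm_suminf_le le summable_mult summ)
    also have "\<dots> = (\<Sum>n. cmod (a (Suc n)) * r ^ n) * exp (- (2 * pi * Im z))"
      by (subst suminf_mult[OF summ]) (simp add: cmod_exp_2pi_i)
    finally show "cmod (f z) \<le> (\<Sum>n. cmod (a (Suc n)) * r ^ n) * exp (- (2 * pi * Im z))" .
  qed
qed

section \<open>Moving points upwards by unimodular matrices; the invariant height of a cusp
  form\<close>

lemma Im_moebius:
  "Im ((of_int a * z + of_int b) / (of_int c * z + of_int d)) =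
     of_int (a * d - b * c) * Im z / (cmod (of_int c * z + of_int d))\<^sup>2"
  by (simp add: Im_divide cmod_power2 algebra_simps diff_divide_distrib[symmetric] add_divide_distrib[symmetric])

lemma of_int_mult_add_nonzero:
  assumes "Im z > 0" "c \<noteq> 0 \<or> d \<noteq> 0"
  shows "of_int c * z + of_int d \<noteq> 0"
proof
  assume eq: "of_int c * z + of_int d = 0"
  hence "Im (of_int c * z + of_int d) = 0" by (simp only: zero_complex.sel)
  hence "c = 0" using assms by simp
  thus False using assms eq by simp
qed

text \<open>Dirichlet approximation supplies the bottom row \<open>(k, -h)\<close>. With
  \<open>k <= N\<close> and \<open>N\<close> about \<open>1 / sqrt y\<close>, both
  \<open>(k x - h)^2 <= y\<close> and \<open>(k y)^2 <= 4 y\<close>, so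
  \<open>|k z - h|^2 <= 5 y\<close>: this is the origin of 1/5. Coprimality of \<open>h\<close> and
  \<open>k\<close> lets Bezout coefficients complete the matrix.\<close>

lemma exists_SL2_Im_ge:
  assumes y: "Im z > 0"
  obtains a b c d :: int where "a * d - b * c = 1"
    "Im ((of_int a * z + of_int b) / (of_int c * z + of_int d)) \<ge> 1 / 5"
proof (cases "Im z \<ge> 1 / 5")
  case True
  thus ?thesis using that[of 1 1 0 0] by simp
next
  case False
  define y where "y = Im z"
  have y0: "0 < y" "y < 1" using y False by (auto simp: y_def)
  define N where "N = nat \<lceil>1 / sqrt y\<rceil>"
  have N1: "real N \<ge> 1 / sqrt y" unfolding N_def by linarith
  have N2: "real N \<le> 1 / sqrt y + 1" unfolding N_def using y0 by (simp add: ceiling_correct)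
  have "1 / sqrt y > 0" using y0 by simp
  hence N0: "N > 0" using N1 by (cases "N = 0") auto
  obtain h k :: int where hk: "coprime h k" "0 < k" "k \<le> int N" "\<bar>of_int k * Re z - of_int h\<bar> < 1 / real N"
    using Dirichlet_approx_coprime[OF N0, of "Re z"] by metis
  obtain u v where uv: "u * h + v * k = 1" using bezout_int[of h k] hk(1) by (auto simp: coprime_iff_gcd_eq_1)
  have det: "- u * - h - (- v) * k = 1" using uv by simp
  have le1: "(of_int k * Re z - of_int h)\<^sup>2 \<le> y"
  proof -
    have "(of_int k * Re z - of_int h)\<^sup>2 \<le> (1 / real N)\<^sup>2" using hk(4) by (intro power2_le_iff_abs_le[THEN iffD2]) auto
    also have "1 / real N \<le> sqrt y" using N1 N0 y0 by (simp add: field_simps)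
    hence "(1 / real N)\<^sup>2 \<le> (sqrt y)\<^sup>2" by (intro power_mono) auto
    also have "\<dots> = y" using y0 by simp
    finally show ?thesis .
  qed
  have le2: "(of_int k * y)\<^sup>2 \<le> 4 * y"
  proof -
    have "real_of_int k \<le> real N" using hk(3) by linarith
    hence "of_int k * y \<le> (1 / sqrt y + 1) * y" using N2 y0 by (intro mult_right_mono) auto
    also have "\<dots> = sqrt y + y" using y0 by (simp add: field_simps real_div_sqrt)
    finally have "of_int k * y \<le> sqrt y + y" .
    moreover have "y \<le> sqrt y" using y0 by (intro real_le_rsqrt) (simp add: power2_eq_square mult_le_one)
    ultimately have "of_int k * y \<le> 2 * sqrt y" by simp
    hence "(of_int k * y)\<^sup>2 \<le> (2 * sqrt y)\<^sup>2" using hk(2) y0 by (intro power_mono) auto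
    thus ?thesis using y0 by (simp add: power_mult_distrib)
  qed
  have nz: "of_int k * z + of_int (- h) \<noteq> 0" using y hk(2) by (intro of_int_mult_add_nonzero) auto
  have "(cmod (of_int k * z + of_int (- h)))\<^sup>2 = (of_int k * Re z - of_int h)\<^sup>2 + (of_int k * y)\<^sup>2"
    by (simp add: cmod_power2 y_def)
  also have "\<dots> \<le> 5 * y" using le1 le2 by simp
  finally have "Im ((of_int (- u) * z + of_int (- v)) / (of_int k * z + of_int (- h))) \<ge> 1 / 5"
    unfolding Im_moebius det using nz y0 by (simp add: y_def[symmetric] field_simps)
  thus ?thesis using that det by blast
qed

lemma cusp_form_invariant_norm:
  assumes "f \<in> cusp_forms (2 * m)" "a * d - b * c = (1::int)" "Im z > 0"
  shows "cmod (f ((of_int a * z + of_int b) / (of_int c * z + of_int d))) *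
           Im ((of_int a * z + of_int b) / (of_int c * z + of_int d)) ^ m = cmod (f z) * Im z ^ m"
proof -
  have nz: "of_int c * z + of_int d \<noteq> 0"
    using assms by (intro of_int_mult_add_nonzero) auto
  have "f ((of_int a * z + of_int b) / (of_int c * z + of_int d)) = (of_int c * z + of_int d) ^ (2 * m) * f z"
    using assms by (auto simp: cusp_forms_def)
  thus ?thesis unfolding Im_moebius assms(2) using nz
    by (simp add: norm_mult norm_power power_divide power_mult)
qed

lemma cusp_form_q_expansion:
  assumes "f \<in> cusp_forms k"
  obtains a where "has_q_expansion f a" "a 0 = 0"
  using assms by (auto simp: cusp_forms_def)

lemma power_le_fact_mult_exp:
  fixes x :: real
  assumes "x \<ge> 0"
  shows "x ^ m \<le> fact m * exp x"
proof -
  have "x ^ m / fact m \<le> (\<Sum>i. inverse (fact i) *\<^sub>R x ^ i)"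
    using sum_le_suminf[OF summable_exp_generic[of x], of "{m}"] assms by (simp add: divide_inverse mult.commute)
  thus ?thesis by (simp add: exp_def field_simps)
qed

text \<open>The invariant \<open>|f| (Im z)^m\<close> may be evaluated at an orbit point with
  \<open>Im z >= 1/5\<close>, where exponential decay beats the power.\<close>

lemma cusp_form_bounded:
  assumes f: "f \<in> cusp_forms (2 * m)"
  obtains M where "\<And>z. Im z > 0 \<Longrightarrow> cmod (f z) * Im z ^ m \<le> M"
proof -
  obtain a where a: "has_q_expansion f a" "a 0 = 0" using cusp_form_q_expansion[OF f] .
  obtain K where K: "K \<ge> 0" "\<And>z. Im z \<ge> 1 / 5 \<Longrightarrow> cmod (f z) \<le> K * exp (- (2 * pi * Im z))"
    using cusp_form_decay[OF a, of "1 / 5"] by auto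
  have *: "cmod (f z) * Im z ^ m \<le> K * fact m" if z: "Im z \<ge> 1 / 5" for z
  proof -
    have "Im z \<le> 2 * pi * Im z" using z pi_ge_two by (simp add: mult_left_le_imp_le)
    hence "cmod (f z) * Im z ^ m \<le> K * exp (- (Im z)) * (fact m * exp (Im z))"
      using z K by (intro mult_mono order.trans[OF K(2)] power_le_fact_mult_exp) (auto intro!: mult_left_mono)
    also have "\<dots> = K * fact m * (exp (- Im z) * exp (Im z))" by simp
    also have "exp (- Im z) * exp (Im z) = 1" by (simp add: mult_exp_exp)
    finally show ?thesis by simp
  qed
  show ?thesis
  proof
    fix z assume z: "Im z > 0"
    obtain a b c d where 1: "a * d - b * c = (1::int)"
      "Im ((of_int a * z + of_int b) / (of_int c * z + of_int d)) \<ge> 1 / 5"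
      using exists_SL2_Im_ge[OF z] by metis
    show "cmod (f z) * Im z ^ m \<le> K * fact m"
      using *[OF 1(2)] cusp_form_invariant_norm[OF f 1(1) z] by simp
  qed
qed

lemma hecke_eigenvalue_bound:
  assumes f: "f \<in> cusp_forms (2 * m)" and m: "m > 0" and f0: "f \<noteq> 0" and n: "n \<ge> 1"
    and \<mu>: "\<And>z. hecke_op (2 * m) n f z = \<mu> * f z"
  shows "cmod \<mu> \<le> real n ^ (m + 1)"
proof -
  let ?g = "\<lambda>z. cmod (f z) * Im z ^ m"
  obtain M where M: "\<And>z. Im z > 0 \<Longrightarrow> ?g z \<le> M" using cusp_form_bounded[OF f] by blast
  define S where "S = (SUP z\<in>upper_half_plane. ?g z)"
  have bdd: "bdd_above (?g ` upper_half_plane)" using M by (intro bdd_aboveI2[of _ _ M]) auto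
  have gS: "?g z \<le> S" if "Im z > 0" for z unfolding S_def using that by (intro cSUP_upper bdd) auto
  obtain z0 where z0: "f z0 \<noteq> 0" using f0 by (auto simp: fun_eq_iff zero_fun_def)
  hence "Im z0 > 0" using f by (force simp: cusp_forms_def)
  hence S0: "S > 0" using gS[of z0] z0 by (intro less_le_trans[of 0 "?g z0" S]) auto
  have key: "cmod \<mu> * ?g z \<le> real n ^ (m + 1) * S" if z: "Im z > 0" for z
  proof -
    \<comment> \<open>The height ratio and the factor \<open>d^(-2m)\<close> combine to
      \<open>n^(-m)\<close> for every divisor \<open>d\<close>, so all terms of the Hecke sum share
      one bound.\<close>
    have t: "cmod (f ((of_nat (n div d) * z + of_nat b) / of_nat d) / of_nat d ^ (2 * m)) * Im z ^ m \<le> S / real n ^ m"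
      if d: "d dvd n" for d b
    proof -
      have d0: "d > 0" "n div d > 0" using d n by (auto intro!: Nat.gr0I simp: div_greater_zero_iff dvd_imp_le)
      define w where "w = (of_nat (n div d) * z + of_nat b) / of_nat d"
      have Imw: "Im w = real (n div d) * Im z / real d" by (simp add: w_def Im_divide_of_nat)
      have nd: "real n = real (n div d) * real d" using d by (simp flip: of_nat_mult)
      have "cmod (f w) * Im w ^ m \<le> S" using z d0 by (intro gS) (simp add: Imw)
      hence "cmod (f w) * Im z ^ m \<le> S * (real d / real (n div d)) ^ m"
        using d0 by (simp add: Imw power_mult_distrib power_divide field_simps)
      hence "cmod (f w) * Im z ^ m / real d ^ (2 * m) \<le> S * (real d / real (n div d)) ^ m / real d ^ (2 * m)"
        by (intro divide_right_mono) auto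
      also have "\<dots> = S / real n ^ m" unfolding nd using d0
        by (simp add: power_mult_distrib power_divide power_mult power2_eq_square field_simps)
      finally show ?thesis by (simp add: w_def norm_divide norm_power)
    qed
    let ?T = "\<Sum>d | d dvd n. \<Sum>b<d. f ((of_nat (n div d) * z + of_nat b) / of_nat d) / of_nat d ^ (2 * m)"
    have "cmod ?T * Im z ^ m
       \<le> (\<Sum>d | d dvd n. \<Sum>b<d. cmod (f ((of_nat (n div d) * z + of_nat b) / of_nat d) / of_nat d ^ (2 * m))) * Im z ^ m"
      using z by (intro mult_right_mono sum_norm_le order.refl) auto
    also have "\<dots> \<le> (\<Sum>d | d dvd n. \<Sum>b<d. S / real n ^ m)"
      unfolding sum_distrib_right by (intro sum_mono t) auto
    also have "\<dots> = (\<Sum>d | d dvd n. real d) * (S / real n ^ m)" by (simp add: sum_distrib_right sum_divide_distrib)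
    also have "\<dots> \<le> (real n ^ 2) * (S / real n ^ m)"
    proof (rule mult_right_mono)
      have "(\<Sum>d | d dvd n. real d) \<le> (\<Sum>d | d dvd n. real n)" using n by (intro sum_mono) (auto dest: dvd_imp_le)
      also have "\<dots> \<le> (\<Sum>d\<in>{1..n}. real n)"
        using n by (intro sum_mono2) (auto dest: dvd_imp_le intro!: Suc_leI Nat.gr0I)
      finally show "(\<Sum>d | d dvd n. real d) \<le> real n ^ 2" by (simp add: power2_eq_square)
    qed (use S0 in auto)
    finally have T: "cmod ?T * Im z ^ m \<le> (real n ^ 2) * (S / real n ^ m)" .
    have "cmod \<mu> * ?g z = cmod (hecke_op (2 * m) n f z) * Im z ^ m" by (simp add: \<mu> norm_mult)
    also have "\<dots> = real n ^ (2 * m - 1) * (cmod ?T * Im z ^ m)"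
      by (simp add: hecke_op_def norm_mult norm_power)
    also have "\<dots> \<le> real n ^ (2 * m - 1) * ((real n ^ 2) * (S / real n ^ m))"
      by (intro mult_left_mono T) auto
    also have "\<dots> = real n ^ (m + 1) * S"
    proof -
      have "(2 * m - 1) + 2 = (m + 1) + m" using m by simp
      hence "real n ^ (2 * m - 1) * real n ^ 2 = real n ^ (m + 1) * real n ^ m" by (metis power_add)
      thus ?thesis using n by (simp add: field_simps)
    qed
    finally show ?thesis .
  qed
  show ?thesis
  proof (cases "cmod \<mu> = 0")
    case False
    \<comment> \<open>The supremum need not be attained, so the pointwise estimate passes to it
      after division by \<open>cmod \<mu>\<close>.\<close>
    have "(SUP z\<in>upper_half_plane. ?g z) \<le> real n ^ (m + 1) * S / cmod \<mu>"
    proof (rule cSUP_least)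
      show "upper_half_plane \<noteq> {}" using \<open>Im z0 > 0\<close> by (metis empty_iff upper_half_plane_iff)
    next
      fix z assume "z \<in> upper_half_plane"
      thus "?g z \<le> real n ^ (m + 1) * S / cmod \<mu>"
        using key[of z] False by (simp add: pos_le_divide_eq mult_ac)
    qed
    hence "cmod \<mu> * S \<le> real n ^ (m + 1) * S" using False by (simp add: S_def pos_le_divide_eq mult_ac)
    thus ?thesis using S0 by simp
  qed simp
qed

section \<open>Hecke eigenvalues as Fourier coefficients\<close>

lemma sum_root_of_unity_powers:
  assumes "d > 0"
  shows "(\<Sum>b<d. exp (2 * of_real pi * \<i> * of_nat j / of_nat d) ^ b) = (if d dvd j then of_nat d else 0 :: complex)"
proof (cases "d dvd j")
  case True
  hence "exp (2 * of_real pi * \<i> * of_nat j / of_nat d) = (1 :: complex)"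
    using assms complex_root_unity_eq_1[of d j] by simp
  thus ?thesis using True by simp
next
  case False
  define x where "x = (exp (2 * of_real pi * \<i> * of_nat j / of_nat d) :: complex)"
  have "x \<noteq> 1" unfolding x_def using False assms complex_root_unity_eq_1[of d j] by simp
  moreover have "x ^ d = exp (of_nat d * (2 * of_real pi * \<i> * of_nat j / of_nat d))"
    unfolding x_def by (rule exp_of_nat_mult[symmetric])
  hence "x ^ d = exp (2 * of_nat j * of_real pi * \<i>)" using assms by (simp add: mult_ac)
  hence "x ^ d = 1" using exp_integer_2pi[of "of_nat j"] by simp
  ultimately show ?thesis using False unfolding x_def[symmetric] by (simp add: geometric_sum)
qed

text \<open>Summing over the shifts \<open>b\<close> is orthogonality of the \<open>d\<close>-th
  roots of unity: only exponents \<open>n = d * j\<close> survive, and for these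
  \<open>E ^ n\<close> is a power of \<open>q\<close> again.\<close>

lemma hecke_inner_sum_expansion:
  assumes f: "has_q_expansion f a" and d: "d > 0" and \<alpha>: "\<alpha> > 0" and z: "Im z > 0"
  shows "(\<lambda>j. of_nat d * (a (d * j) * (exp (2 * of_real pi * \<i> * z) ^ \<alpha>) ^ j)) sums
           (\<Sum>b<d. f ((of_nat \<alpha> * z + of_nat b) / of_nat d))"
proof -
  let ?e = "\<lambda>w. exp (2 * of_real pi * \<i> * w) :: complex"
  define E where "E = ?e (of_nat \<alpha> * z / of_nat d)"
  have "(\<lambda>n. \<Sum>b<d. a n * ?e ((of_nat \<alpha> * z + of_nat b) / of_nat d) ^ n) sums
           (\<Sum>b<d. f ((of_nat \<alpha> * z + of_nat b) / of_nat d))"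
  proof (rule sums_sum)
    fix b
    have "Im ((of_nat \<alpha> * z + of_nat b) / of_nat d) > 0" using d \<alpha> z by (simp add: Im_divide_of_nat)
    thus "(\<lambda>n. a n * ?e ((of_nat \<alpha> * z + of_nat b) / of_nat d) ^ n) sums f ((of_nat \<alpha> * z + of_nat b) / of_nat d)"
      using f[unfolded has_q_expansion_def, THEN bspec, of "(of_nat \<alpha> * z + of_nat b) / of_nat d"]
      by (simp only: upper_half_plane_iff)
  qed
  also have "(\<lambda>n. \<Sum>b<d. a n * ?e ((of_nat \<alpha> * z + of_nat b) / of_nat d) ^ n) =
      (\<lambda>n. if d dvd n then of_nat d * (a n * E ^ n) else 0)"
  proof
    fix n
    have "?e ((of_nat \<alpha> * z + of_nat b) / of_nat d) ^ n = E ^ n * exp (2 * of_real pi * \<i> * of_nat n / of_nat d) ^ b" for b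
      by (simp add: E_def exp_of_nat_mult[symmetric] mult_exp_exp add_divide_distrib algebra_simps)
    hence "(\<Sum>b<d. a n * ?e ((of_nat \<alpha> * z + of_nat b) / of_nat d) ^ n) =
        a n * E ^ n * (\<Sum>b<d. exp (2 * of_real pi * \<i> * of_nat n / of_nat d) ^ b)"
      by (simp add: sum_distrib_left mult_ac)
    thus "(\<Sum>b<d. a n * ?e ((of_nat \<alpha> * z + of_nat b) / of_nat d) ^ n) =
        (if d dvd n then of_nat d * (a n * E ^ n) else 0)"
      unfolding sum_root_of_unity_powers[OF d] by simp
  qed
  finally have S: "(\<lambda>n. if d dvd n then of_nat d * (a n * E ^ n) else 0) sums
           (\<Sum>b<d. f ((of_nat \<alpha> * z + of_nat b) / of_nat d))" .
  have Ed: "E ^ (d * j) = (?e z ^ \<alpha>) ^ j" for j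
  proof -
    have "E ^ d = ?e z ^ \<alpha>"
      unfolding E_def exp_of_nat_mult[symmetric] using d by (simp add: field_simps)
    thus ?thesis by (simp add: power_mult)
  qed
  have "(\<lambda>j. (\<lambda>n. if d dvd n then of_nat d * (a n * E ^ n) else 0) (d * j)) sums
           (\<Sum>b<d. f ((of_nat \<alpha> * z + of_nat b) / of_nat d))"
    using S by (subst sums_mono_reindex) (use d in \<open>auto simp: strict_mono_def elim!: dvdE\<close>)
  thus ?thesis by (simp add: Ed)
qed

lemma exp_2pi_i_imaginary_ln:
  assumes "x > 0"
  shows "exp (2 * of_real pi * \<i> * (\<i> * of_real (- ln x / (2 * pi)))) = complex_of_real x"
  unfolding exp_2pi_i_imaginary using assms by simp

text \<open>The coefficient of \<open>q\<close> in \<open>T_n f = \<mu> f\<close> is read off along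
  the imaginary axis: with \<open>q = x\<close> real, both sides are divided by \<open>x\<close>,
  and \<open>x\<close> tends to 0 from the right. Only the divisor \<open>d = n\<close> keeps a
  constant term in the limit.\<close>

lemma hecke_eigenvalue_eq_coeff:
  assumes f: "has_q_expansion f a" and a0: "a 0 = 0" and n: "n \<ge> 1" and k: "k \<ge> 1"
    and \<mu>: "\<And>z. hecke_op k n f z = \<mu> * f z"
  shows "a n = \<mu> * a 1"
proof -
  have dpos: "d > 0" "n div d > 0" if "d dvd n" for d
  proof -
    show "d > 0" using that n by (intro Nat.gr0I notI) simp
    thus "n div d > 0" using that n by (simp add: div_greater_zero_iff dvd_imp_le)
  qed
  \<comment> \<open>Index shift: as \<open>a 0 = 0\<close>, one power of the variable is taken out
    of the subseries over multiples of \<open>d\<close>, leaving a series with value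
    \<open>a d\<close> at 0.\<close>
  define B where "B = (\<lambda>d x. \<Sum>j. a (d * Suc j) * x ^ j)"
  define Z where "Z = (\<lambda>x. \<i> * complex_of_real (- ln x / (2 * pi)))"
  have Z: "Im (Z x) > 0" "exp (2 * of_real pi * \<i> * Z x) = of_real x" if "0 < x" "x < 1" for x
    using that exp_2pi_i_imaginary_ln[of x] unfolding Z_def by (auto simp: divide_neg_pos)
  have summ0: "summable (\<lambda>j. a (d * Suc j) * complex_of_real x ^ j)" if d: "d > 0" and x: "0 < x" "x < 1" for d x
  proof -
    have "summable (\<lambda>j. of_nat d * (a (d * j) * (complex_of_real x ^ 1) ^ j))"
      using hecke_inner_sum_expansion[OF f d zero_less_one Z(1)[OF x]] unfolding Z(2)[OF x] by (auto simp: sums_iff)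
    hence "summable (\<lambda>j. a (d * j) * complex_of_real x ^ j)"
      using d by (subst (asm) summable_cmult_iff) auto
    hence "summable (\<lambda>j. a (d * Suc j) * complex_of_real x ^ Suc j)"
      by (subst summable_Suc_iff)
    hence "summable (\<lambda>j. of_real x * (a (d * Suc j) * complex_of_real x ^ j))"
      by (simp add: mult_ac)
    thus ?thesis using x by (subst (asm) summable_cmult_iff) auto
  qed
  have cont: "isCont (B d) 0" if d: "d > 0" for d
    unfolding B_def using summ0[OF d, of "1/2"] by (intro isCont_powser[of _ "of_real (1/2)"]) auto
  have B0: "B d 0 = a d" for d
    unfolding B_def using powser_zero[of "\<lambda>j. a (d * Suc j)"] by simp
  have inner: "(\<Sum>b<d. f ((of_nat (n div d) * Z x + of_nat b) / of_nat d)) =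
      of_nat d * (of_real x ^ (n div d) * B d (of_real x ^ (n div d)))"
    if x: "0 < x" "x < 1" and d: "d dvd n" for d x
  proof -
    note d0 = dpos[OF d]
    define y where "y = x ^ (n div d)"
    have y: "0 < y" "y < 1" using x d0 by (auto simp: y_def power_less_one_iff)
    have "(\<lambda>j. of_nat d * (a (d * j) * complex_of_real y ^ j)) sums
        (\<Sum>b<d. f ((of_nat (n div d) * Z x + of_nat b) / of_nat d))"
      using hecke_inner_sum_expansion[OF f d0 Z(1)[OF x]] unfolding Z(2)[OF x] by (simp add: y_def)
    hence "(\<lambda>j. of_nat d * (a (d * Suc j) * complex_of_real y ^ Suc j)) sums
        (\<Sum>b<d. f ((of_nat (n div d) * Z x + of_nat b) / of_nat d))"
      by (subst sums_Suc_iff) (simp add: a0)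
    moreover have "(\<lambda>j. of_nat d * of_real y * (a (d * Suc j) * complex_of_real y ^ j)) sums (of_nat d * of_real y * B d (of_real y))"
      unfolding B_def by (intro sums_mult summable_sums summ0 d0 y)
    hence "(\<lambda>j. of_nat d * (a (d * Suc j) * complex_of_real y ^ Suc j)) sums (of_nat d * of_real y * B d (of_real y))"
      by (simp add: mult_ac)
    ultimately have "(\<Sum>b<d. f ((of_nat (n div d) * Z x + of_nat b) / of_nat d)) = of_nat d * of_real y * B d (of_real y)"
      by (rule sums_unique2)
    thus ?thesis by (simp add: y_def mult.assoc)
  qed
  \<comment> \<open>The value of \<open>hecke_op\<close> at \<open>Z x\<close> divided by
    \<open>x\<close>, in a form that has a limit at 0.\<close>
  define L where "L = (\<lambda>x::real. of_nat n ^ (k - 1) *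
     (\<Sum>d | d dvd n. of_nat d * (of_real x ^ (n div d - 1) * B d (of_real x ^ (n div d))) / of_nat d ^ k))"
  have L_eq: "L x = \<mu> * B 1 (of_real x)" if x: "0 < x" "x < 1" for x
  proof -
    have "hecke_op k n f (Z x) = of_nat n ^ (k - 1) * (\<Sum>d | d dvd n. (\<Sum>b<d. f ((of_nat (n div d) * Z x + of_nat b) / of_nat d)) / of_nat d ^ k)"
      by (simp add: hecke_op_def sum_divide_distrib)
    also have "\<dots> = of_nat n ^ (k - 1) * (\<Sum>d | d dvd n. of_nat d * (of_real x ^ (n div d) * B d (of_real x ^ (n div d))) / of_nat d ^ k)"
      using inner[OF x] by (intro arg_cong[of _ _ "\<lambda>y. _ * y"] sum.cong refl) auto
    also have "\<dots> = of_nat n ^ (k - 1) * (\<Sum>d | d dvd n. of_real x * (of_nat d * (of_real x ^ (n div d - 1) * B d (of_real x ^ (n div d))) / of_nat d ^ k))"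
    proof (intro arg_cong[of _ _ "\<lambda>y. _ * y"] sum.cong refl)
      fix d assume "d \<in> {d. d dvd n}"
      hence "n div d > 0" by (simp add: dpos)
      hence "complex_of_real x ^ (n div d) = of_real x * of_real x ^ (n div d - 1)" by (cases "n div d") auto
      thus "of_nat d * (of_real x ^ (n div d) * B d (of_real x ^ (n div d))) / of_nat d ^ k =
        of_real x * (of_nat d * (of_real x ^ (n div d - 1) * B d (of_real x ^ (n div d))) / of_nat d ^ k)" by simp
    qed
    also have "\<dots> = of_real x * L x"
      unfolding L_def sum_distrib_left[symmetric] by (rule mult.left_commute)
    finally have 1: "\<mu> * f (Z x) = of_real x * L x" using \<mu> by simp
    have "(\<lambda>j. of_nat 1 * (a (1 * j) * (complex_of_real x ^ 1) ^ j)) sums f (Z x)"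
      using hecke_inner_sum_expansion[OF f zero_less_one zero_less_one Z(1)[OF x]] unfolding Z(2)[OF x] by simp
    hence "(\<lambda>j. a (Suc j) * complex_of_real x ^ Suc j) sums f (Z x)"
      by (subst sums_Suc_iff) (simp add: a0)
    moreover have "(\<lambda>j. of_real x * (a (1 * Suc j) * complex_of_real x ^ j)) sums (of_real x * B 1 (of_real x))"
      unfolding B_def by (intro sums_mult summable_sums summ0 zero_less_one x)
    hence "(\<lambda>j. a (Suc j) * complex_of_real x ^ Suc j) sums (of_real x * B 1 (of_real x))"
      by (simp add: mult_ac)
    ultimately have "f (Z x) = of_real x * B 1 (of_real x)"
      by (rule sums_unique2)
    thus ?thesis using 1 x by simp
  qed
  have tx: "((\<lambda>x::real. complex_of_real x) \<longlongrightarrow> 0) (at_right 0)"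
    by (rule tendsto_eq_intros filterlim_ident refl | simp)+
  have tB: "((\<lambda>x::real. B d (complex_of_real x ^ e)) \<longlongrightarrow> a d) (at_right 0)" if "d > 0" "e > 0" for d e
  proof -
    have "((\<lambda>x::real. complex_of_real x ^ e) \<longlongrightarrow> 0) (at_right 0)"
      using tendsto_power[OF tx, of e] that by (simp add: zero_power)
    from isCont_tendsto_compose[OF cont[OF that(1)] this] show ?thesis by (simp add: B0)
  qed
  have "(L \<longlongrightarrow> of_nat n ^ (k - 1) * (\<Sum>d | d dvd n. of_nat d * (0 ^ (n div d - 1) * a d) / of_nat d ^ k)) (at_right 0)"
    unfolding L_def
  proof (intro tendsto_intros tB tx)
    fix d assume "d \<in> {d. d dvd n}"
    hence "d dvd n" by simp
    from dpos[OF this] show "d > 0" "n div d > 0" "of_nat d ^ k \<noteq> (0::complex)" by auto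
  qed
  also have "(\<Sum>d | d dvd n. of_nat d * (0 ^ (n div d - 1) * a d) / of_nat d ^ k) =
     (\<Sum>d\<in>{n}. of_nat d * (0 ^ (n div d - 1) * a d) / of_nat d ^ k)"
  proof (rule sum.mono_neutral_right)
    show "\<forall>d\<in>{d. d dvd n} - {n}. of_nat d * (0 ^ (n div d - 1) * a d) / of_nat d ^ k = 0"
    proof
      fix d assume d: "d \<in> {d. d dvd n} - {n}"
      then obtain e where e: "n = d * e" by auto
      have "e \<noteq> 0" using e n by (intro notI) simp
      moreover have "e \<noteq> 1" using e d by (intro notI) simp
      moreover have "d > 0" using e n by (intro Nat.gr0I notI) simp
      ultimately show "of_nat d * (0 ^ (n div d - 1) * a d) / of_nat d ^ k = 0" using e by simp
    qed
  qed (use n in auto)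
  also have "of_nat n ^ (k - 1) * (\<Sum>d\<in>{n}. of_nat d * (0 ^ (n div d - 1) * a d) / of_nat d ^ k) = a n"
  proof -
    have "(of_nat n :: complex) ^ k = of_nat n * of_nat n ^ (k - 1)" using k by (cases k) auto
    thus ?thesis using n by simp
  qed
  finally have lim1: "(L \<longlongrightarrow> a n) (at_right 0)" .
  have "((\<lambda>x. \<mu> * B 1 (complex_of_real x ^ 1)) \<longlongrightarrow> \<mu> * a 1) (at_right 0)"
    by (intro tendsto_intros tB) auto
  moreover have "\<forall>\<^sub>F x in at_right 0. \<mu> * B 1 (complex_of_real x ^ 1) = L x"
    using eventually_at_right_real[OF zero_less_one] by eventually_elim (simp add: L_eq)
  ultimately have "(L \<longlongrightarrow> \<mu> * a 1) (at_right 0)" by (rule Lim_transform_eventually)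
  thus ?thesis using tendsto_unique[OF trivial_limit_at_right_real lim1] by simp
qed

section \<open>Integer matrices acting on the upper half plane\<close>

type_synonym mat2 = "int \<times> int \<times> int \<times> int"

fun mdet :: "mat2 \<Rightarrow> int" where "mdet (a, b, c, d) = a * d - b * c"
fun mob :: "mat2 \<Rightarrow> complex \<Rightarrow> complex" where
  "mob (a, b, c, d) z = (of_int a * z + of_int b) / (of_int c * z + of_int d)"
text \<open>The automorphy factor; \<open>aut_mmul\<close> is its cocycle rule.\<close>

fun aut :: "mat2 \<Rightarrow> complex \<Rightarrow> complex" where "aut (a, b, c, d) z = of_int c * z + of_int d"
fun mmul :: "mat2 \<Rightarrow> mat2 \<Rightarrow> mat2" where
  "mmul (a, b, c, d) (a', b', c', d') = (a * a' + b * c', a * b' + b * d', c * a' + d * c', c * b' + d * d')"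
text \<open>Determinant times inverse: integral for every determinant, and acting on the half plane
  as the inverse.\<close>

fun madj :: "mat2 \<Rightarrow> mat2" where "madj (a, b, c, d) = (d, - b, - c, a)"

lemma mdet_mmul [simp]: "mdet (mmul \<gamma> \<delta>) = mdet \<gamma> * mdet \<delta>"
  by (cases \<gamma>; cases \<delta>) (simp add: algebra_simps)

lemma mdet_madj [simp]: "mdet (madj \<delta>) = mdet \<delta>"
  by (cases \<delta>) (simp add: algebra_simps)

lemma madj_madj [simp]: "madj (madj \<delta>) = \<delta>"
  by (cases \<delta>) simp

lemma mmul_assoc: "mmul (mmul \<alpha> \<beta>) \<gamma> = mmul \<alpha> (mmul \<beta> \<gamma>)"
  by (cases \<alpha>; cases \<beta>; cases \<gamma>) (simp add: algebra_simps)

lemma mmul_one [simp]: "mmul (1, 0, 0, 1) \<delta> = \<delta>"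
  by (cases \<delta>) simp

lemma mmul_one_right [simp]: "mmul \<delta> (1, 0, 0, 1) = \<delta>"
  by (cases \<delta>) simp

lemma mmul_madj: "mmul \<delta> (madj \<delta>) = (mdet \<delta>, 0, 0, mdet \<delta>)" "mmul (madj \<delta>) \<delta> = (mdet \<delta>, 0, 0, mdet \<delta>)"
  by (cases \<delta>; simp add: algebra_simps)+

lemma aut_nonzero:
  assumes "mdet \<delta> \<noteq> 0" "Im z > 0"
  shows "aut \<delta> z \<noteq> 0"
proof -
  obtain a b c d where g: "\<delta> = (a, b, c, d)" by (cases \<delta>)
  have "c \<noteq> 0 \<or> d \<noteq> 0" using assms(1) by (auto simp: g)
  thus ?thesis using of_int_mult_add_nonzero[OF assms(2)] by (simp add: g)
qed

lemma Im_mob: "Im (mob \<delta> z) = of_int (mdet \<delta>) * Im z / (cmod (aut \<delta> z))\<^sup>2"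
  by (cases \<delta>) (simp only: mob.simps aut.simps mdet.simps Im_moebius)

lemma Im_mob_pos: "mdet \<delta> > 0 \<Longrightarrow> Im z > 0 \<Longrightarrow> Im (mob \<delta> z) > 0"
  using aut_nonzero[of \<delta> z] by (simp add: Im_mob)

lemma mob_times_aut:
  assumes "mdet (a', b', c', d') > 0" "Im z > 0"
  shows "(of_int a * mob (a', b', c', d') z + of_int b) * aut (a', b', c', d') z =
      of_int (a * a' + b * c') * z + of_int (a * b' + b * d')"
proof -
  have 1: "aut (a', b', c', d') z \<noteq> 0" using assms by (intro aut_nonzero) auto
  have "mob (a', b', c', d') z = (of_int a' * z + of_int b') / aut (a', b', c', d') z" by simp
  hence 2: "mob (a', b', c', d') z * aut (a', b', c', d') z = of_int a' * z + of_int b'"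
    using 1 by (simp del: mob.simps aut.simps)
  have "(of_int a * mob (a', b', c', d') z + of_int b) * aut (a', b', c', d') z =
      of_int a * (mob (a', b', c', d') z * aut (a', b', c', d') z) + of_int b * aut (a', b', c', d') z"
    by (simp only: distrib_right mult.assoc)
  also have "\<dots> = of_int a * (of_int a' * z + of_int b') + of_int b * (of_int c' * z + of_int d')"
    unfolding 2 by (simp only: aut.simps)
  finally show ?thesis by (simp add: algebra_simps)
qed

lemma aut_mmul:
  assumes "mdet \<delta> > 0" "Im z > 0"
  shows "aut (mmul \<gamma> \<delta>) z = aut \<gamma> (mob \<delta> z) * aut \<delta> z"
proof -
  obtain a b c d where g: "\<gamma> = (a, b, c, d)" by (cases \<gamma>)
  obtain a' b' c' d' where h: "\<delta> = (a', b', c', d')" by (cases \<delta>)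
  show ?thesis
    using mob_times_aut[OF assms[unfolded h], of c d] by (simp only: g h mmul.simps aut.simps)
qed

lemma mob_mmul:
  assumes "mdet \<gamma> > 0" "mdet \<delta> > 0" "Im z > 0"
  shows "mob (mmul \<gamma> \<delta>) z = mob \<gamma> (mob \<delta> z)"
proof -
  have 1: "aut \<delta> z \<noteq> 0" using assms by (intro aut_nonzero) auto
  obtain a b c d where g: "\<gamma> = (a, b, c, d)" by (cases \<gamma>)
  obtain a' b' c' d' where h: "\<delta> = (a', b', c', d')" by (cases \<delta>)
  have "mob \<gamma> (mob \<delta> z) = ((of_int a * mob \<delta> z + of_int b) * aut \<delta> z) / ((of_int c * mob \<delta> z + of_int d) * aut \<delta> z)"
    using 1 by (simp add: g)
  also have "\<dots> = (of_int (a * a' + b * c') * z + of_int (a * b' + b * d')) / (of_int (c * a' + d * c') * z + of_int (c * b' + d * d'))"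
    unfolding h by (simp only: mob_times_aut[OF assms(2,3)[unfolded h]])
  also have "\<dots> = mob (mmul \<gamma> \<delta>) z"
    by (simp only: g h mmul.simps mob.simps)
  finally show ?thesis ..
qed

lemma mob_madj:
  assumes "mdet \<delta> > 0" "Im z > 0"
  shows "mob (madj \<delta>) (mob \<delta> z) = z" "mob \<delta> (mob (madj \<delta>) z) = z"
  using assms by (simp_all add: mob_mmul[symmetric] mmul_madj)

lemma aut_madj:
  assumes "mdet \<delta> > 0" "Im z > 0"
  shows "aut (madj \<delta>) (mob \<delta> z) = of_int (mdet \<delta>) / aut \<delta> z"
proof -
  have "aut (mmul (madj \<delta>) \<delta>) z = aut (madj \<delta>) (mob \<delta> z) * aut \<delta> z"
    using assms by (rule aut_mmul)
  thus ?thesis using aut_nonzero[of \<delta> z] assms by (simp add: mmul_madj field_simps)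
qed

lemma measurable_mob [measurable]: "mob \<delta> \<in> borel_measurable borel"
proof -
  obtain a b c d where g: "\<delta> = (a, b, c, d)" by (cases \<delta>)
  have "mob \<delta> = (\<lambda>z. (of_int a * z + of_int b) / (of_int c * z + of_int d))"
    by (auto simp: g fun_eq_iff)
  thus ?thesis by simp
qed

lemma has_field_derivative_mob:
  assumes "mdet \<delta> > 0" "Im z > 0"
  shows "(mob \<delta> has_field_derivative of_int (mdet \<delta>) / (aut \<delta> z)\<^sup>2) (at z)"
proof -
  obtain a b c d where g: "\<delta> = (a, b, c, d)" by (cases \<delta>)
  have nz: "of_int c * z + of_int d \<noteq> 0" using aut_nonzero[of \<delta> z] assms by (simp add: g)
  have "((\<lambda>z. (of_int a * z + of_int b) / (of_int c * z + of_int d)) has_field_derivative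
      of_int (mdet \<delta>) / (aut \<delta> z)\<^sup>2) (at z)"
    using nz by (auto intro!: derivative_eq_intros simp: g power2_eq_square algebra_simps)
  moreover have "mob \<delta> = (\<lambda>z. (of_int a * z + of_int b) / (of_int c * z + of_int d))"
    by (auto simp: g fun_eq_iff)
  ultimately show ?thesis by simp
qed

section \<open>Coset representatives for integer matrices of determinant n\<close>

definition SL2Z :: "mat2 set" where "SL2Z = {\<gamma>. mdet \<gamma> = 1}"
definition det_mats :: "nat \<Rightarrow> mat2 set" where "det_mats n = {\<delta>. mdet \<delta> = int n}"
text \<open>The matrices indexing the double sum in \<open>hecke_op\<close>. They represent the
  orbits of \<open>SL2Z\<close> acting on \<open>det_mats n\<close> by left multiplication, as
  existence and uniqueness below show.\<close>

definition hecke_reps :: "nat \<Rightarrow> mat2 set" where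
  "hecke_reps n = (\<lambda>(d, b). (int (n div d), int b, 0, int d)) ` (SIGMA d:{d. d dvd n}. {..<d})"

lemma finite_hecke_reps: "n > 0 \<Longrightarrow> finite (hecke_reps n)"
  unfolding hecke_reps_def by (intro finite_imageI finite_SigmaI) auto

lemma hecke_reps_subset: "hecke_reps n \<subseteq> det_mats n"
  by (auto simp: hecke_reps_def det_mats_def simp flip: of_nat_mult)

lemma sum_hecke_reps:
  fixes h :: "mat2 \<Rightarrow> 'a :: comm_monoid_add"
  assumes "n > 0"
  shows "(\<Sum>\<rho>\<in>hecke_reps n. h \<rho>) = (\<Sum>d | d dvd n. \<Sum>b<d. h (int (n div d), int b, 0, int d))"
proof -
  have "(\<Sum>\<rho>\<in>hecke_reps n. h \<rho>) = (\<Sum>x\<in>(SIGMA d:{d. d dvd n}. {..<d}). h ((\<lambda>(d, b). (int (n div d), int b, 0, int d)) x))"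
    unfolding hecke_reps_def by (subst sum.reindex) (auto simp: inj_on_def)
  also have "\<dots> = (\<Sum>d | d dvd n. \<Sum>b<d. h (int (n div d), int b, 0, int d))"
    using assms by (subst sum.Sigma) (auto simp: case_prod_beta)
  finally show ?thesis .
qed

text \<open>Hermite normal form: the gcd \<open>g\<close> of the first column is produced by a
  unimodular row operation, which also clears the lower left entry.\<close>

lemma hecke_rep_exists:
  assumes n: "n > 0" and \<delta>: "\<delta> \<in> det_mats n"
  obtains \<gamma> \<rho> where "\<gamma> \<in> SL2Z" "\<rho> \<in> hecke_reps n" "\<delta> = mmul \<gamma> \<rho>"
proof -
  obtain p q r s where d: "\<delta> = (p, q, r, s)" by (cases \<delta>)
  have det: "p * s - q * r = int n" using \<delta> by (simp add: det_mats_def d)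
  define g where "g = gcd p r"
  have g0: "g > 0" using det n by (auto simp: g_def gcd_pos_int intro!: ccontr[of "p \<noteq> 0 \<or> r \<noteq> 0"])
  obtain u v where uv: "u * p + v * r = g" using bezout_int[of p r] by (auto simp: g_def)
  obtain p' r' where pr: "p = g * p'" "r = g * r'" by (metis g_def dvdE gcd_dvd1 gcd_dvd2)
  have uv': "u * p' + v * r' = 1"
  proof -
    have "g * (u * p' + v * r') = g * 1" using uv pr by (simp add: algebra_simps)
    thus ?thesis using g0 by simp
  qed
  define e where "e = p' * s - r' * q"
  have ge: "g * e = int n" using det by (simp add: e_def pr algebra_simps)
  hence e0: "e > 0" using g0 n by (metis of_nat_0_less_iff zero_less_mult_pos)
  \<comment> \<open>Multiplying \<open>\<delta>\<close> from the left by
    \<open>(u, v, -r', p')\<close> gives \<open>(g, t, 0, e)\<close>. \<open>\<gamma>\<close> is the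
    inverse of that matrix times the shift by \<open>t div e\<close>, which reduces \<open>t\<close>
    to \<open>t mod e\<close>.\<close>
  define t where "t = u * q + v * s"
  define \<gamma> where "\<gamma> = (p', - v + p' * (t div e), r', u + r' * (t div e))"
  define \<rho> where "\<rho> = (g, t mod e, 0 :: int, e)"
  show ?thesis
  proof
    show "\<gamma> \<in> SL2Z" using uv' by (simp add: SL2Z_def \<gamma>_def algebra_simps)
    have "nat e dvd n" using ge by (metis dvd_triv_right e0 int_dvd_int_iff int_nat_eq less_imp_le)
    moreover have "n div nat e = nat g"
    proof -
      have "int (nat g * nat e) = int n" using ge g0 e0 by simp
      hence "n = nat g * nat e" by linarith
      thus ?thesis using e0 by simp
    qed
    ultimately show "\<rho> \<in> hecke_reps n"
      unfolding hecke_reps_def \<rho>_def using e0 g0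
      by (intro image_eqI[of _ _ "(nat e, nat (t mod e))"]) auto
    have t: "t mod e = t - e * (t div e)" by (simp add: minus_mult_div_eq_mod)
    have q: "p' * t - v * e = q"
    proof -
      have "p' * t - v * e = (u * p' + v * r') * q" by (simp add: t_def e_def algebra_simps)
      thus ?thesis using uv' by simp
    qed
    have s: "r' * t + u * e = s"
    proof -
      have "r' * t + u * e = (u * p' + v * r') * s" by (simp add: t_def e_def algebra_simps)
      thus ?thesis using uv' by simp
    qed
    show "\<delta> = mmul \<gamma> \<rho>"
      unfolding d \<gamma>_def \<rho>_def mmul.simps t using pr q s by (simp add: algebra_simps)
  qed
qed

text \<open>The quotient \<open>\<sigma>\<close> of the two unimodular factors carries one
  triangular matrix to another, so it is upper triangular. Positivity of the upper left entries
  makes its diagonal 1, and \<open>b < d\<close>, \<open>b' < d'\<close> then leave no room for a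
  shift.\<close>

lemma hecke_rep_unique:
  assumes n: "n > 0" and "\<gamma> \<in> SL2Z" "\<gamma>' \<in> SL2Z" "\<rho> \<in> hecke_reps n" "\<rho>' \<in> hecke_reps n"
    and eq: "mmul \<gamma> \<rho> = mmul \<gamma>' \<rho>'"
  shows "\<gamma> = \<gamma>'" "\<rho> = \<rho>'"
proof -
  define \<sigma> where "\<sigma> = mmul (madj \<gamma>') \<gamma>"
  have inv: "mmul (madj \<gamma>') \<gamma>' = (1, 0, 0, 1)" "mmul \<gamma>' (madj \<gamma>') = (1, 0, 0, 1)"
    using assms by (simp_all add: mmul_madj SL2Z_def)
  have "mmul \<sigma> \<rho> = mmul (madj \<gamma>') (mmul \<gamma>' \<rho>')" unfolding \<sigma>_def mmul_assoc eq ..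
  hence 1: "mmul \<sigma> \<rho> = \<rho>'" by (simp add: mmul_assoc[symmetric] inv)
  have det\<sigma>: "mdet \<sigma> = 1" using assms by (simp add: \<sigma>_def SL2Z_def)
  obtain d b where r: "\<rho> = (int (n div d), int b, 0, int d)" "d dvd n" "b < d"
    using assms(4) by (auto simp: hecke_reps_def)
  obtain d' b' where r': "\<rho>' = (int (n div d'), int b', 0, int d')" "d' dvd n" "b' < d'"
    using assms(5) by (auto simp: hecke_reps_def)
  obtain x y z w where s: "\<sigma> = (x, y, z, w)" by (cases \<sigma>)
  have pos: "n div d > 0" "n div d' > 0" using r r' n
    by (simp_all add: div_greater_zero_iff dvd_imp_le)
  have z: "z = 0" using 1 pos by (auto simp: r r' s)
  hence xw: "x * w = 1" using det\<sigma> by (simp add: s)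
  have "x * int (n div d) = int (n div d')" using 1 z by (simp add: r r' s)
  hence "x > 0" using pos by (metis of_nat_0_less_iff of_nat_0_le_iff zero_less_mult_pos2)
  hence x: "x = 1" "w = 1" using xw by (auto simp: zmult_eq_1_iff)
  have d: "d = d'" using 1 x z by (simp add: r r' s)
  have b: "int b + y * int d = int b'" using 1 x z by (auto simp: r r' s)
  have "int b mod int d = int b' mod int d" by (metis b mod_mult_self1)
  hence "b = b'" using r(3) r'(3) d by simp
  hence "y = 0" using b r(3) by simp
  thus "\<rho> = \<rho>'" using r r' d \<open>b = b'\<close> by simp
  have "\<sigma> = (1, 0, 0, 1)" using s x z \<open>y = 0\<close> by simp
  hence "mmul \<gamma>' (mmul (madj \<gamma>') \<gamma>) = \<gamma>'" by (simp add: \<sigma>_def)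
  thus "\<gamma> = \<gamma>'" by (simp add: mmul_assoc[symmetric] inv)
qed

section \<open>A strip that meets every orbit, but only finitely often\<close>

definition strip :: "complex set" where "strip = {z. 1 / 5 \<le> Im z \<and> \<bar>Re z\<bar> \<le> 1}"

lemma finite_int_pairs_bounded:
  assumes z: "Im z > 0"
  shows "finite {(a :: int, b :: int). cmod (of_int a * z + of_int b) \<le> B}"
proof -
  define K where "K = \<lceil>\<bar>B\<bar> / Im z\<rceil>"
  define L where "L = \<lceil>\<bar>B\<bar> + \<bar>B\<bar> / Im z * cmod z\<rceil>"
  have "{(a :: int, b :: int). cmod (of_int a * z + of_int b) \<le> B} \<subseteq> {-K..K} \<times> {-L..L}"
  proof safe
    fix a b :: int assume *: "cmod (of_int a * z + of_int b) \<le> B"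
    have "\<bar>of_int a\<bar> * Im z = \<bar>Im (of_int a * z + of_int b)\<bar>" using z by (simp add: abs_mult)
    also have "\<dots> \<le> \<bar>B\<bar>" using abs_Im_le_cmod[of "of_int a * z + of_int b"] * by linarith
    finally have a: "\<bar>of_int a\<bar> \<le> \<bar>B\<bar> / Im z" using z by (simp add: field_simps)
    thus "a \<in> {-K..K}" unfolding K_def by (auto simp: abs_le_iff) linarith+
    have "\<bar>of_int b\<bar> = cmod ((of_int a * z + of_int b) - of_int a * z)" by simp
    also have "\<dots> \<le> cmod (of_int a * z + of_int b) + cmod (of_int a * z)" by (rule norm_triangle_ineq4)
    also have "\<dots> \<le> \<bar>B\<bar> + \<bar>B\<bar> / Im z * cmod z" using * mult_right_mono[OF a, of "cmod z"] by (intro add_mono) (auto simp: norm_mult)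
    finally show "b \<in> {-L..L}" unfolding L_def by (auto simp: abs_le_iff) linarith+
  qed
  thus ?thesis by (rule finite_subset) auto
qed

text \<open>Both rows are lattice vectors of bounded length. For the bottom row,
  \<open>Im >= 1/5\<close> gives \<open>j^2 <= 5 y\<close>. The top row has length
  \<open>|mob \<gamma> z| * j <= j + y / j\<close>, where the lower bound
  \<open>j >= min 1 y\<close> prevents the second summand from growing.\<close>

lemma finite_SL2Z_strip:
  assumes z: "Im z > 0"
  shows "finite {\<gamma>\<in>SL2Z. mob \<gamma> z \<in> strip}"
proof -
  define y where "y = Im z"
  define P where "P = (\<lambda>B. {(a :: int, b :: int). cmod (of_int a * z + of_int b) \<le> B})"
  let ?B = "sqrt (5 * y) + y / min 1 y"
  have "{\<gamma>\<in>SL2Z. mob \<gamma> z \<in> strip} \<subseteq> (\<lambda>((a, b), (c, d)). (a, b, c, d)) ` (P ?B \<times> P (sqrt (5 * y)))"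
  proof
    fix \<gamma> assume *: "\<gamma> \<in> {\<gamma>\<in>SL2Z. mob \<gamma> z \<in> strip}"
    obtain a b c d where g: "\<gamma> = (a, b, c, d)" by (cases \<gamma>)
    have det: "mdet \<gamma> = 1" using * by (simp add: SL2Z_def)
    define j where "j = cmod (aut \<gamma> z)"
    have j0: "j > 0" using aut_nonzero[of \<gamma> z] z det by (simp add: j_def)
    have Im: "Im (mob \<gamma> z) = y / j\<^sup>2" by (simp add: Im_mob det y_def j_def)
    hence "1 / 5 \<le> y / j\<^sup>2" using * by (simp add: strip_def)
    hence "j\<^sup>2 \<le> 5 * y" using j0 by (simp add: field_simps)
    hence j1: "j \<le> sqrt (5 * y)" by (rule real_le_rsqrt)
    have j2: "j \<ge> min 1 y"
    proof (cases "c = 0")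
      case True
      hence "a * d = 1" using det g by simp
      hence "\<bar>d\<bar> = 1" by (auto simp: zmult_eq_1_iff)
      hence "j = 1" using True by (simp add: j_def g)
      thus ?thesis by simp
    next
      case False
      hence "1 * y \<le> \<bar>of_int c\<bar> * y" using z by (intro mult_right_mono) (auto simp: y_def)
      also have "\<dots> = \<bar>Im (aut \<gamma> z)\<bar>" using z by (simp add: g y_def abs_mult)
      also have "\<dots> \<le> j" unfolding j_def by (rule abs_Im_le_cmod)
      finally show ?thesis by simp
    qed
    have "cmod (of_int a * z + of_int b) = cmod (mob \<gamma> z) * j"
      using j0 by (simp add: j_def g norm_divide)
    also have "\<dots> \<le> (1 + y / j\<^sup>2) * j"
    proof (rule mult_right_mono)
      have "cmod (mob \<gamma> z) \<le> \<bar>Re (mob \<gamma> z)\<bar> + \<bar>Im (mob \<gamma> z)\<bar>" by (rule cmod_le)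
      also have "\<dots> \<le> 1 + y / j\<^sup>2" using * z unfolding Im by (simp add: strip_def y_def)
      finally show "cmod (mob \<gamma> z) \<le> 1 + y / j\<^sup>2" .
    qed (use j0 in auto)
    also have "\<dots> = j + y / j" using j0 by (simp add: field_simps power2_eq_square)
    also have "\<dots> \<le> ?B" using j1 j2 z j0 by (intro add_mono divide_left_mono mult_pos_pos) (auto simp: y_def)
    finally have "(a, b) \<in> P ?B" by (simp add: P_def)
    moreover have "(c, d) \<in> P (sqrt (5 * y))" using j1 by (simp add: P_def j_def g)
    ultimately show "\<gamma> \<in> (\<lambda>((a, b), (c, d)). (a, b, c, d)) ` (P ?B \<times> P (sqrt (5 * y)))"
      unfolding g by (intro image_eqI[of _ _ "((a, b), (c, d))"]) auto
  qed
  moreover have "finite (P B)" for B unfolding P_def using z by (rule finite_int_pairs_bounded)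
  ultimately show ?thesis by (meson finite_SigmaI finite_imageI finite_subset)
qed

text \<open>The half-width 1/2 is smaller than that of \<open>strip\<close>: the orbit point keeps
  its distance from the vertical sides, which later makes room for a ball inside the strip.\<close>

lemma SL2Z_strip_nonempty:
  assumes z: "Im z > 0"
  obtains \<gamma> where "\<gamma> \<in> SL2Z" "mob \<gamma> z \<in> strip" "\<bar>Re (mob \<gamma> z)\<bar> \<le> 1 / 2"
proof -
  obtain a b c d where 1: "a * d - b * c = (1::int)"
    "Im ((of_int a * z + of_int b) / (of_int c * z + of_int d)) \<ge> 1 / 5"
    using exists_SL2_Im_ge[OF z] by metis
  define \<gamma> where "\<gamma> = (a, b, c, d)"
  define N where "N = round (Re (mob \<gamma> z))"
  define \<tau> where "\<tau> = (1 :: int, - N, 0 :: int, 1 :: int)"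
  have det: "mdet \<gamma> = 1" "mdet \<tau> = 1" using 1 by (simp_all add: \<gamma>_def \<tau>_def)
  have m: "mob (mmul \<tau> \<gamma>) z = mob \<gamma> z - of_int N"
    using z det by (subst mob_mmul) (auto simp: \<tau>_def)
  have "\<bar>Re (mob \<gamma> z) - of_int N\<bar> \<le> 1 / 2"
    using of_int_round_abs_le[of "Re (mob \<gamma> z)"] by (simp add: N_def abs_minus_commute)
  moreover have "Im (mob \<gamma> z) \<ge> 1 / 5" using 1 by (simp add: \<gamma>_def)
  ultimately show ?thesis using det by (intro that[of "mmul \<tau> \<gamma>"]) (auto simp: m strip_def SL2Z_def)
qed

section \<open>Invariance of the hyperbolic measure\<close>

text \<open>Coordinates for passing to \<open>real^2\<close>, the setting of the change of variables
  theorem \<open>has_absolute_integral_change_of_variables\<close>.\<close>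

definition v2c :: "real^2 \<Rightarrow> complex" where "v2c v = Complex (vec_nth v 1) (vec_nth v 2)"
definition c2v :: "complex \<Rightarrow> real^2" where "c2v z = vector [Re z, Im z]"

lemma v2c_c2v [simp]: "v2c (c2v z) = z" by (simp add: v2c_def c2v_def)
lemma c2v_v2c [simp]: "c2v (v2c v) = v" by (simp add: v2c_def c2v_def vec_eq_iff forall_2)
lemma Im_v2c [simp]: "Im (v2c v) = vec_nth v 2" by (simp add: v2c_def)

lemma bounded_linear_v2c: "bounded_linear v2c"
  unfolding linear_conv_bounded_linear[symmetric]
  by (rule linearI) (auto simp: v2c_def complex_eq_iff)

lemma bounded_linear_c2v: "bounded_linear c2v"
  unfolding linear_conv_bounded_linear[symmetric]
  by (rule linearI) (auto simp: c2v_def vec_eq_iff forall_2)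

lemma measurable_v2c [measurable]: "v2c \<in> borel_measurable borel"
  by (intro borel_measurable_continuous_onI linear_continuous_on bounded_linear_v2c)

lemma measurable_c2v [measurable]: "c2v \<in> borel_measurable borel"
  by (intro borel_measurable_continuous_onI linear_continuous_on bounded_linear_c2v)

lemma lborel_complex_vec: "(lborel :: complex measure) = distr lborel borel v2c"
proof (rule lborel_eqI)
  fix l u :: complex
  assume "\<And>b. b \<in> Basis \<Longrightarrow> l \<bullet> b \<le> u \<bullet> b"
  from this[of 1] this[of \<i>] have le: "Re l \<le> Re u" "Im l \<le> Im u" by (simp_all add: Basis_complex_def)
  have B: "(Basis :: (real^2) set) = {axis 1 1, axis 2 1}"
    by (auto simp: Basis_vec_def UNIV_2)
  have ne: "axis 1 1 \<noteq> (axis 2 1 :: real^2)" by (simp add: axis_eq_axis)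
  have "emeasure (distr lborel borel v2c) (box l u) = emeasure lborel (v2c -` box l u)"
    by (subst emeasure_distr) auto
  also have "v2c -` box l u = box (c2v l) (c2v u)"
    by (auto simp: mem_box B v2c_def c2v_def inner_axis Basis_complex_def)
  also have "emeasure lborel \<dots> = ennreal (prod ((\<bullet>) (c2v u - c2v l)) Basis)"
    using le by (intro emeasure_lborel_box) (auto simp: B inner_axis c2v_def Basis_complex_def)
  also have "prod ((\<bullet>) (c2v u - c2v l)) Basis = prod ((\<bullet>) (u - l)) Basis"
    by (simp add: B ne inner_axis c2v_def Basis_complex_def)
  finally show "emeasure (distr lborel borel v2c) (box l u) = ennreal (prod ((\<bullet>) (u - l)) Basis)" .
qed simp

lemma measurable_Complex [measurable]: "(\<lambda>(x, y). Complex x y) \<in> borel_measurable (borel \<Otimes>\<^sub>M borel)"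
proof -
  have "(\<lambda>(x, y). Complex x y) = (\<lambda>p. of_real (fst p) + \<i> * of_real (snd p))"
    by (auto simp: fun_eq_iff complex_eq_iff)
  thus ?thesis by simp
qed

lemma lborel_complex_pair: "(lborel :: complex measure) = distr (lborel \<Otimes>\<^sub>M lborel) borel (\<lambda>(x, y). Complex x y)"
proof (rule lborel_eqI)
  fix l u :: complex
  assume "\<And>b. b \<in> Basis \<Longrightarrow> l \<bullet> b \<le> u \<bullet> b"
  from this[of 1] this[of \<i>] have le: "Re l \<le> Re u" "Im l \<le> Im u" by (simp_all add: Basis_complex_def)
  have "emeasure (distr (lborel \<Otimes>\<^sub>M lborel) borel (\<lambda>(x, y). Complex x y)) (box l u) =
     emeasure (lborel \<Otimes>\<^sub>M lborel) ((\<lambda>(x, y). Complex x y) -` box l u)"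
    by (subst emeasure_distr) (auto simp: space_pair_measure)
  also have "(\<lambda>(x, y). Complex x y) -` box l u = {Re l<..<Re u} \<times> {Im l<..<Im u}"
    by (auto simp: mem_box Basis_complex_def)
  also have "emeasure (lborel \<Otimes>\<^sub>M lborel) \<dots> = ennreal (prod ((\<bullet>) (u - l)) Basis)"
    using le by (subst lborel.emeasure_pair_measure_Times) (auto simp: Basis_complex_def ennreal_mult)
  finally show "emeasure (distr (lborel \<Otimes>\<^sub>M lborel) borel (\<lambda>(x, y). Complex x y)) (box l u) = ennreal (prod ((\<bullet>) (u - l)) Basis)" .
qed simp

lemma sets_strip [measurable]: "strip \<in> sets borel"
proof -
  have "closed strip" unfolding strip_def Collect_conj_eq
    by (intro closed_Int closed_Collect_le continuous_intros)
  thus ?thesis by simp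
qed

text \<open>The strip has hyperbolic area 10: its width is 2, and the integral of
  \<open>1 / y^2\<close> from 1/5 upwards is 5.\<close>

lemma integrable_strip: "integrable lborel (\<lambda>z. indicator strip z * (1 / (Im z)\<^sup>2) :: real)"
proof (rule integrableI_nonneg)
  have "(\<integral>\<^sup>+z. ennreal (indicator strip z * (1 / (Im z)\<^sup>2)) \<partial>lborel) =
     (\<integral>\<^sup>+p. (case p of (x, y) \<Rightarrow> ennreal (indicator strip (Complex x y) * (1 / y\<^sup>2))) \<partial>(lborel \<Otimes>\<^sub>M lborel))"
    by (subst lborel_complex_pair, subst nn_integral_distr) (auto intro!: nn_integral_cong simp: split_beta)
  also have "\<dots> = (\<integral>\<^sup>+x. \<integral>\<^sup>+y. ennreal (indicator strip (Complex x y) * (1 / y\<^sup>2)) \<partial>lborel \<partial>lborel)"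
    by (subst lborel.nn_integral_fst[symmetric]) (auto simp: case_prod_beta)
  also have "\<dots> = (\<integral>\<^sup>+x. ennreal 5 * indicator {-1..1} x \<partial>(lborel :: real measure))"
  proof (intro nn_integral_cong)
    fix x :: real
    have "(\<integral>\<^sup>+y. ennreal (indicator strip (Complex x y) * (1 / y\<^sup>2)) \<partial>lborel) =
       (\<integral>\<^sup>+y. indicator {-1..1} x * (ennreal (1 / y\<^sup>2) * indicator {1/5..} y) \<partial>lborel)"
      by (intro nn_integral_cong) (auto simp: strip_def abs_le_iff split: split_indicator)
    also have "\<dots> = indicator {-1..1} x * (\<integral>\<^sup>+y. ennreal (1 / y\<^sup>2) * indicator {1/5..} y \<partial>lborel)"
      by (rule nn_integral_cmult) simp
    also have "(\<integral>\<^sup>+y. ennreal (1 / y\<^sup>2) * indicator {1/5..} y \<partial>lborel) = ennreal (0 - (- (1 / (1 / 5 :: real))))"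
    proof (rule nn_integral_FTC_atLeast)
      show "((\<lambda>y. - (1 / y)) has_real_derivative 1 / y\<^sup>2) (at y)" if "1 / 5 \<le> y" for y :: real
        using that by (auto intro!: derivative_eq_intros simp: power2_eq_square)
      show "((\<lambda>y::real. - (1 / y)) \<longlongrightarrow> 0) at_top"
        using tendsto_minus[OF tendsto_inverse_0_at_top[OF filterlim_ident[of "at_top :: real filter"]]] by (simp add: inverse_eq_divide)
    qed auto
    finally show "(\<integral>\<^sup>+y. ennreal (indicator strip (Complex x y) * (1 / y\<^sup>2)) \<partial>lborel) = ennreal 5 * indicator {-1..1} x"
      by (simp add: mult.commute)
  qed
  also have "\<dots> < \<infinity>"
    by (subst nn_integral_cmult_indicator) (auto simp: ennreal_mult_less_top)
  finally show "(\<integral>\<^sup>+z. ennreal (indicator strip z * (1 / (Im z)\<^sup>2)) \<partial>lborel) < \<infinity>" .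
qed auto

text \<open>Links the Lebesgue integral over the complex numbers with the absolute integral over the
  half plane in \<open>real^2\<close>. As \<open>G\<close> vanishes outside the half plane, the
  restriction costs nothing.\<close>

lemma vec_integral_transfer:
  fixes G :: "complex \<Rightarrow> complex"
  assumes [measurable]: "G \<in> borel_measurable borel" and G0: "\<And>z. Im z \<le> 0 \<Longrightarrow> G z = 0"
  shows "(\<lambda>v. c2v (G (v2c v))) absolutely_integrable_on {v. vec_nth v 2 > 0} \<longleftrightarrow> integrable lborel G" (is ?A)
    and "integrable lborel G \<Longrightarrow> integral {v. vec_nth v 2 > 0} (\<lambda>v. c2v (G (v2c v))) = c2v (integral\<^sup>L lborel G)"
proof -
  let ?S = "{v :: real^2. vec_nth v 2 > 0}"
  have ind: "(\<lambda>v. indicator ?S v *\<^sub>R c2v (G (v2c v))) = (\<lambda>v. c2v (G (v2c v)))"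
  proof
    fix v :: "real^2"
    have "c2v 0 = 0" by (rule linear_0[OF bounded_linear.linear[OF bounded_linear_c2v]])
    thus "indicator ?S v *\<^sub>R c2v (G (v2c v)) = c2v (G (v2c v))"
      using G0[of "v2c v"] by (auto split: split_indicator)
  qed
  have 1: "integrable lborel G \<longleftrightarrow> integrable lborel (\<lambda>v. G (v2c v))"
    by (subst lborel_complex_vec, subst integrable_distr_eq) auto
  have 2: "integrable lborel (\<lambda>v. G (v2c v)) \<longleftrightarrow> integrable lborel (\<lambda>v. c2v (G (v2c v)))"
    using integrable_bounded_linear[OF bounded_linear_c2v, of lborel "\<lambda>v. G (v2c v)"]
      integrable_bounded_linear[OF bounded_linear_v2c, of lborel "\<lambda>v. c2v (G (v2c v))"] by auto
  show A: ?A
    unfolding set_integrable_def ind 1 2 by (rule integrable_completion) simp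
  assume I: "integrable lborel G"
  hence "integral ?S (\<lambda>v. c2v (G (v2c v))) = (LINT v:?S|lebesgue. c2v (G (v2c v)))"
    using A by (intro set_lebesgue_integral_eq_integral(2)[symmetric]) auto
  also have "\<dots> = (LINT v|lborel. c2v (G (v2c v)))"
    unfolding set_lebesgue_integral_def ind by (rule integral_completion) simp
  also have "\<dots> = c2v (LINT v|lborel. G (v2c v))"
    using I 1 by (intro integral_bounded_linear bounded_linear_c2v) auto
  also have "(LINT v|lborel. G (v2c v)) = integral\<^sup>L lborel G"
    using arg_cong[OF lborel_complex_vec, of "\<lambda>M. integral\<^sup>L M G"] by (simp add: integral_distr)
  finally show "integral ?S (\<lambda>v. c2v (G (v2c v))) = c2v (integral\<^sup>L lborel G)" .
qed

lemma det_complex_mult: "det (matrix (\<lambda>h. c2v (D * v2c h))) = (cmod D)\<^sup>2"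
  unfolding cmod_power2 by (simp add: det_2 matrix_def c2v_def v2c_def axis_def power2_eq_square)

text \<open>The Jacobian of \<open>mob \<delta>\<close> is \<open>(det / |aut|^2)^2\<close>, while
  \<open>Im\<close> is multiplied by \<open>det / |aut|^2\<close>. So \<open>dx dy / y^2\<close> is
  preserved for every positive determinant and not only by \<open>SL2Z\<close>; the adjugate
  argument substitutes matrices of determinant \<open>n\<close>.\<close>

lemma moebius_integral_invariant:
  fixes F :: "complex \<Rightarrow> complex"
  assumes det: "mdet \<delta> > 0" and [measurable]: "F \<in> borel_measurable borel"
    and int: "integrable lborel (\<lambda>z. indicator upper_half_plane z *\<^sub>R (F z / of_real ((Im z)\<^sup>2)))"
  shows "(LINT z|lborel. indicator upper_half_plane z *\<^sub>R (F (mob \<delta> z) / of_real ((Im z)\<^sup>2))) =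
         (LINT z|lborel. indicator upper_half_plane z *\<^sub>R (F z / of_real ((Im z)\<^sup>2)))"
proof -
  let ?S = "{v :: real^2. vec_nth v 2 > 0}"
  have op: "open ?S" by (intro open_Collect_less continuous_intros)
  have [measurable]: "upper_half_plane \<in> sets borel"
    unfolding upper_half_plane_def by (intro borel_open open_Collect_less continuous_intros)
  define G1 where "G1 = (\<lambda>z. indicator upper_half_plane z *\<^sub>R (F z / of_real ((Im z)\<^sup>2)))"
  define G2 where "G2 = (\<lambda>z. indicator upper_half_plane z *\<^sub>R (F (mob \<delta> z) / of_real ((Im z)\<^sup>2)))"
  have [measurable]: "G1 \<in> borel_measurable borel" "G2 \<in> borel_measurable borel"
    unfolding G1_def G2_def by measurable
  define g where "g = (\<lambda>v. c2v (mob \<delta> (v2c v)))"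
  define g' where "g' = (\<lambda>v h. c2v (of_int (mdet \<delta>) / (aut \<delta> (v2c v))\<^sup>2 * v2c h))"
  have "g ` ?S = ?S"
  proof (intro equalityI subsetI)
    fix v assume "v \<in> g ` ?S"
    then obtain w where w: "vec_nth w 2 > 0" "v = g w" by auto
    have "Im (v2c v) > 0" using Im_mob_pos[OF det, of "v2c w"] w by (simp add: g_def)
    thus "v \<in> ?S" by simp
  next
    fix v :: "real^2" assume v: "v \<in> ?S"
    show "v \<in> g ` ?S"
    proof
      show "v = g (c2v (mob (madj \<delta>) (v2c v)))" using v det by (simp add: g_def mob_madj)
      have "Im (mob (madj \<delta>) (v2c v)) > 0" using v det by (intro Im_mob_pos) auto
      thus "c2v (mob (madj \<delta>) (v2c v)) \<in> ?S" by (simp add: c2v_def)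
    qed
  qed
  moreover have "inj_on g ?S"
  proof
    fix v w :: "real^2" assume "v \<in> ?S" "w \<in> ?S" "g v = g w"
    hence "v2c (g v) = v2c (g w)" by simp
    hence "mob (madj \<delta>) (mob \<delta> (v2c v)) = mob (madj \<delta>) (mob \<delta> (v2c w))" by (simp add: g_def)
    hence "v2c v = v2c w" using \<open>v \<in> ?S\<close> \<open>w \<in> ?S\<close> det by (simp add: mob_madj)
    thus "v = w" by (metis c2v_v2c)
  qed
  moreover have "(g has_derivative g' v) (at v within ?S)" if v: "v \<in> ?S" for v
  proof -
    have "(mob \<delta> has_derivative (*) (of_int (mdet \<delta>) / (aut \<delta> (v2c v))\<^sup>2)) (at (v2c v))"
      using has_field_derivative_mob[OF det, of "v2c v"] v by (simp add: has_field_derivative_def)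
    moreover have "(v2c has_derivative v2c) (at v)"
      by (rule bounded_linear_imp_has_derivative[OF bounded_linear_v2c])
    ultimately have "((\<lambda>v. mob \<delta> (v2c v)) has_derivative (\<lambda>h. of_int (mdet \<delta>) / (aut \<delta> (v2c v))\<^sup>2 * v2c h)) (at v)"
      by (rule has_derivative_compose[rotated])
    hence "(g has_derivative g' v) (at v)"
      unfolding g_def g'_def by (rule bounded_linear.has_derivative[OF bounded_linear_c2v])
    thus ?thesis by (rule has_derivative_at_withinI)
  qed
  moreover have "?S \<in> sets lebesgue" using op by (simp add: lmeasurable_iff_integrable_on)
  ultimately have cov: "((\<lambda>v. \<bar>det (matrix (g' v))\<bar> *\<^sub>R c2v (G1 (v2c (g v)))) absolutely_integrable_on ?S \<and>
       integral ?S (\<lambda>v. \<bar>det (matrix (g' v))\<bar> *\<^sub>R c2v (G1 (v2c (g v)))) = b) \<longleftrightarrow>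
     ((\<lambda>v. c2v (G1 (v2c v))) absolutely_integrable_on ?S \<and> integral ?S (\<lambda>v. c2v (G1 (v2c v))) = b)" for b
    using has_absolute_integral_change_of_variables[of ?S g g' "\<lambda>v. c2v (G1 (v2c v))" b] by simp
  have eq: "\<bar>det (matrix (g' v))\<bar> *\<^sub>R c2v (G1 (v2c (g v))) = c2v (G2 (v2c v))" if v: "v \<in> ?S" for v
  proof -
    define z where "z = v2c v"
    have z: "Im z > 0" using v by (simp add: z_def)
    have nz: "aut \<delta> z \<noteq> 0" using z det by (intro aut_nonzero) auto
    have "det (matrix (g' v)) = (cmod (of_int (mdet \<delta>) / (aut \<delta> z)\<^sup>2))\<^sup>2"
      unfolding g'_def z_def by (rule det_complex_mult)
    also have "\<dots> = (of_int (mdet \<delta>))\<^sup>2 / (cmod (aut \<delta> z))^4"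
      using det by (simp add: norm_divide norm_power power_divide power_mult[symmetric])
    finally have d: "\<bar>det (matrix (g' v))\<bar> = (of_int (mdet \<delta>))\<^sup>2 / (cmod (aut \<delta> z))^4" by simp
    have "\<bar>det (matrix (g' v))\<bar> *\<^sub>R c2v (G1 (v2c (g v))) = c2v (\<bar>det (matrix (g' v))\<bar> *\<^sub>R G1 (mob \<delta> z))"
      by (simp add: g_def z_def linear_scale[OF bounded_linear.linear[OF bounded_linear_c2v]])
    also have "\<bar>det (matrix (g' v))\<bar> *\<^sub>R G1 (mob \<delta> z) = G2 z"
    proof -
      have "\<bar>det (matrix (g' v))\<bar> / (Im (mob \<delta> z))\<^sup>2 = 1 / (Im z)\<^sup>2"
        unfolding d Im_mob using nz det z by (simp add: power_divide power_mult_distrib power_mult[symmetric])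
      hence "complex_of_real \<bar>det (matrix (g' v))\<bar> / of_real ((Im (mob \<delta> z))\<^sup>2) = 1 / of_real ((Im z)\<^sup>2)"
        unfolding of_real_divide[symmetric] by simp
      hence "F (mob \<delta> z) * (complex_of_real \<bar>det (matrix (g' v))\<bar> / of_real ((Im (mob \<delta> z))\<^sup>2)) = F (mob \<delta> z) * (1 / of_real ((Im z)\<^sup>2))"
        by (simp only:)
      thus ?thesis using z Im_mob_pos[OF det z] by (simp add: G1_def G2_def scaleR_conv_of_real mult_ac)
    qed
    finally show ?thesis by (simp add: z_def)
  qed
  have G0: "Im z \<le> 0 \<Longrightarrow> G1 z = 0" "Im z \<le> 0 \<Longrightarrow> G2 z = 0" for z by (auto simp: G1_def G2_def)
  have I1: "integrable lborel G1" using int by (simp add: G1_def)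
  have "(\<lambda>v. c2v (G1 (v2c v))) absolutely_integrable_on ?S \<and> integral ?S (\<lambda>v. c2v (G1 (v2c v))) = c2v (integral\<^sup>L lborel G1)"
    using I1 vec_integral_transfer[of G1] G0 by simp
  hence "(\<lambda>v. \<bar>det (matrix (g' v))\<bar> *\<^sub>R c2v (G1 (v2c (g v)))) absolutely_integrable_on ?S \<and>
       integral ?S (\<lambda>v. \<bar>det (matrix (g' v))\<bar> *\<^sub>R c2v (G1 (v2c (g v)))) = c2v (integral\<^sup>L lborel G1)"
    by (simp only: cov)
  moreover have "(\<lambda>v. \<bar>det (matrix (g' v))\<bar> *\<^sub>R c2v (G1 (v2c (g v)))) absolutely_integrable_on ?S \<longleftrightarrow> (\<lambda>v. c2v (G2 (v2c v))) absolutely_integrable_on ?S"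
    by (rule set_integrable_cong) (use eq in auto)
  moreover have "integral ?S (\<lambda>v. \<bar>det (matrix (g' v))\<bar> *\<^sub>R c2v (G1 (v2c (g v)))) = integral ?S (\<lambda>v. c2v (G2 (v2c v)))"
    by (rule integral_cong) (rule eq)
  ultimately have "(\<lambda>v. c2v (G2 (v2c v))) absolutely_integrable_on ?S" "integral ?S (\<lambda>v. c2v (G2 (v2c v))) = c2v (integral\<^sup>L lborel G1)"
    by simp_all
  hence "c2v (integral\<^sup>L lborel G2) = c2v (integral\<^sup>L lborel G1)"
    using vec_integral_transfer[of G2] G0 by simp
  hence "integral\<^sup>L lborel G2 = integral\<^sup>L lborel G1" by (metis v2c_c2v)
  thus ?thesis by (simp add: G1_def G2_def)
qed

section \<open>Hecke eigenvalues are real\<close>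

text \<open>
  The value is meaningful only on the upper half plane: there the number of matrices counted is
  finite and positive, and \<open>strip_weight\<close> has sum 1 over each orbit.
\<close>

definition strip_count :: "complex \<Rightarrow> real" where
  "strip_count z = enn2real (\<integral>\<^sup>+\<gamma>. indicator strip (mob \<gamma> z) \<partial>count_space SL2Z)"

definition strip_weight :: "complex \<Rightarrow> real" where
  "strip_weight z = indicator strip z / strip_count z"

lemma measurable_pair_count_space:
  fixes A :: "'b :: countable set"
  assumes "\<And>a. a \<in> A \<Longrightarrow> (\<lambda>x. f (x, a)) \<in> measurable N K"
  shows "f \<in> measurable (N \<Otimes>\<^sub>M count_space A) K"
  by (subst measurable_pair_swap_iff)
     (rule measurable_pair_measure_countable1, use assms in auto)

text \<open>Writing the count as an integral over counting measure reduces its measurability to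
  joint measurability in \<open>z\<close> and \<open>\<gamma>\<close>, and countability of the
  matrices allows each \<open>\<gamma>\<close> to be treated alone.\<close>

lemma measurable_strip_count [measurable]: "strip_count \<in> borel_measurable borel"
proof -
  have "(\<lambda>(z, \<gamma>). indicator strip (mob \<gamma> z) :: ennreal) \<in> borel_measurable (borel \<Otimes>\<^sub>M count_space SL2Z)"
    by (rule measurable_pair_count_space) simp
  hence "(\<lambda>z. \<integral>\<^sup>+\<gamma>. indicator strip (mob \<gamma> z) \<partial>count_space SL2Z) \<in> borel_measurable borel"
    by (rule sigma_finite_measure.borel_measurable_nn_integral[OF sigma_finite_measure_count_space])
  thus ?thesis unfolding strip_count_def[abs_def] by measurable
qed

lemma measurable_strip_weight [measurable]: "strip_weight \<in> borel_measurable borel"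
  unfolding strip_weight_def[abs_def] by measurable

lemma strip_count_eq_card:
  assumes "Im z > 0"
  shows "strip_count z = real (card {\<gamma>\<in>SL2Z. mob \<gamma> z \<in> strip})"
proof -
  have "(\<integral>\<^sup>+\<gamma>. indicator strip (mob \<gamma> z) \<partial>count_space SL2Z) = (\<Sum>\<gamma>\<in>{\<gamma>\<in>SL2Z. mob \<gamma> z \<in> strip}. indicator strip (mob \<gamma> z) :: ennreal)"
    using finite_SL2Z_strip[OF assms] by (intro nn_integral_count_space') auto
  also have "\<dots> = of_nat (card {\<gamma>\<in>SL2Z. mob \<gamma> z \<in> strip})" by simp
  finally show ?thesis by (simp add: strip_count_def)
qed

lemma strip_count_ge_1:
  assumes "Im z > 0"
  shows "strip_count z \<ge> 1"
proof -
  obtain \<gamma> where "\<gamma> \<in> SL2Z" "mob \<gamma> z \<in> strip" using SL2Z_strip_nonempty[OF assms] by blast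
  hence "{\<gamma>\<in>SL2Z. mob \<gamma> z \<in> strip} \<noteq> {}" by blast
  hence "card {\<gamma>\<in>SL2Z. mob \<gamma> z \<in> strip} > 0" using finite_SL2Z_strip[OF assms]
    by (intro card_gt_0_iff[THEN iffD2] conjI)
  thus ?thesis unfolding strip_count_eq_card[OF assms] by simp
qed

lemma strip_Im_pos: "z \<in> strip \<Longrightarrow> Im z > 0"
  by (auto simp: strip_def)

lemma strip_weight_nonneg: "strip_weight z \<ge> 0"
  by (simp add: strip_weight_def strip_count_def)

lemma strip_weight_le: "strip_weight z \<le> indicator strip z"
  using strip_count_ge_1[OF strip_Im_pos, of z]
  by (auto simp: strip_weight_def divide_le_eq split: split_indicator)

text \<open>Right multiplication by \<open>\<gamma>\<close> permutes \<open>SL2Z\<close> and matches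
  the two sets that are counted.\<close>

lemma strip_count_mob:
  assumes z: "Im z > 0" and g: "\<gamma> \<in> SL2Z"
  shows "strip_count (mob \<gamma> z) = strip_count z"
proof -
  have det: "mdet \<gamma> = 1" using g by (simp add: SL2Z_def)
  have Im: "Im (mob \<gamma> z) > 0" using z det by (intro Im_mob_pos) auto
  have "bij_betw (\<lambda>\<sigma>. mmul \<sigma> \<gamma>) {\<sigma>\<in>SL2Z. mob \<sigma> (mob \<gamma> z) \<in> strip} {\<sigma>\<in>SL2Z. mob \<sigma> z \<in> strip}"
  proof (rule bij_betwI[where g = "\<lambda>\<sigma>. mmul \<sigma> (madj \<gamma>)"])
    show "(\<lambda>\<sigma>. mmul \<sigma> \<gamma>) \<in> {\<sigma>\<in>SL2Z. mob \<sigma> (mob \<gamma> z) \<in> strip} \<rightarrow> {\<sigma>\<in>SL2Z. mob \<sigma> z \<in> strip}"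
      using z det by (auto simp: SL2Z_def mob_mmul)
    show "(\<lambda>\<sigma>. mmul \<sigma> (madj \<gamma>)) \<in> {\<sigma>\<in>SL2Z. mob \<sigma> z \<in> strip} \<rightarrow> {\<sigma>\<in>SL2Z. mob \<sigma> (mob \<gamma> z) \<in> strip}"
      using z det Im by (auto simp: SL2Z_def mob_mmul mob_madj)
  qed (use det in \<open>auto simp: mmul_assoc mmul_madj\<close>)
  hence "card {\<sigma>\<in>SL2Z. mob \<sigma> (mob \<gamma> z) \<in> strip} = card {\<sigma>\<in>SL2Z. mob \<sigma> z \<in> strip}"
    by (rule bij_betw_same_card)
  thus ?thesis using z Im by (simp add: strip_count_eq_card)
qed

lemma det_mats_strip_eq:
  assumes n: "n > 0" and z: "Im z > 0"
  shows "{\<delta>\<in>det_mats n. mob \<delta> z \<in> strip} =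
    (\<lambda>(\<rho>, \<gamma>). mmul \<gamma> \<rho>) ` (SIGMA \<rho>:hecke_reps n. {\<gamma>\<in>SL2Z. mob \<gamma> (mob \<rho> z) \<in> strip})"
proof (intro equalityI subsetI)
  fix \<delta> assume \<delta>: "\<delta> \<in> {\<delta>\<in>det_mats n. mob \<delta> z \<in> strip}"
  then obtain \<gamma> \<rho> where 1: "\<gamma> \<in> SL2Z" "\<rho> \<in> hecke_reps n" "\<delta> = mmul \<gamma> \<rho>"
    using hecke_rep_exists[OF n] by blast
  hence "mdet \<gamma> > 0" "mdet \<rho> > 0" using hecke_reps_subset[of n] n by (auto simp: SL2Z_def det_mats_def)
  thus "\<delta> \<in> (\<lambda>(\<rho>, \<gamma>). mmul \<gamma> \<rho>) ` (SIGMA \<rho>:hecke_reps n. {\<gamma>\<in>SL2Z. mob \<gamma> (mob \<rho> z) \<in> strip})"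
    using 1 \<delta> z by (intro image_eqI[of _ _ "(\<rho>, \<gamma>)"]) (auto simp: mob_mmul)
next
  fix \<delta> assume "\<delta> \<in> (\<lambda>(\<rho>, \<gamma>). mmul \<gamma> \<rho>) ` (SIGMA \<rho>:hecke_reps n. {\<gamma>\<in>SL2Z. mob \<gamma> (mob \<rho> z) \<in> strip})"
  then obtain \<gamma> \<rho> where 1: "\<gamma> \<in> SL2Z" "\<rho> \<in> hecke_reps n" "\<delta> = mmul \<gamma> \<rho>" "mob \<gamma> (mob \<rho> z) \<in> strip"
    by auto
  hence "mdet \<gamma> = 1" "mdet \<rho> = int n" using hecke_reps_subset[of n] by (auto simp: SL2Z_def det_mats_def)
  thus "\<delta> \<in> {\<delta>\<in>det_mats n. mob \<delta> z \<in> strip}"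
    using 1 n z by (auto simp: det_mats_def mob_mmul)
qed

lemma finite_det_mats_strip:
  assumes n: "n > 0" and z: "Im z > 0"
  shows "finite {\<delta>\<in>det_mats n. mob \<delta> z \<in> strip}"
proof -
  have "Im (mob \<rho> z) > 0" if "\<rho> \<in> hecke_reps n" for \<rho>
    using that hecke_reps_subset[of n] n z by (intro Im_mob_pos) (auto simp: det_mats_def)
  thus ?thesis unfolding det_mats_strip_eq[OF n z]
    by (intro finite_imageI finite_SigmaI finite_hecke_reps n finite_SL2Z_strip)
qed

text \<open>Each coset \<open>SL2Z \<rho>\<close> meets the support in exactly
  \<open>strip_count (mob \<rho> z)\<close> matrices, all with the reciprocal of this number as
  weight, so it contributes \<open>G \<rho>\<close> once. The value type is general because both a
  complex kernel and its real norm are summed in this way.\<close>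

lemma
  fixes G :: "mat2 \<Rightarrow> 'a :: {banach, second_countable_topology}"
  assumes n: "n > 0" and z: "Im z > 0"
    and G: "\<And>\<gamma> \<rho>. \<gamma> \<in> SL2Z \<Longrightarrow> \<rho> \<in> hecke_reps n \<Longrightarrow> G (mmul \<gamma> \<rho>) = G \<rho>"
  shows integral_strip_weight_orbit:
      "(LINT \<delta>|count_space (det_mats n). strip_weight (mob \<delta> z) *\<^sub>R G \<delta>) = (\<Sum>\<rho>\<in>hecke_reps n. G \<rho>)"
    and integrable_strip_weight_orbit:
      "integrable (count_space (det_mats n)) (\<lambda>\<delta>. strip_weight (mob \<delta> z) *\<^sub>R G \<delta>)"
proof -
  let ?S = "{\<delta>\<in>det_mats n. mob \<delta> z \<in> strip}"
  have fin: "finite ?S" using n z by (rule finite_det_mats_strip)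
  have supp: "strip_weight (mob \<delta> z) *\<^sub>R G \<delta> = 0" if "\<delta> \<in> det_mats n" "\<delta> \<notin> ?S" for \<delta>
    using that by (auto simp: strip_weight_def)
  have sub: "{\<delta> \<in> det_mats n. strip_weight (mob \<delta> z) *\<^sub>R G \<delta> \<noteq> 0} \<subseteq> ?S"
    using supp by blast
  have fin': "finite {\<delta> \<in> det_mats n. strip_weight (mob \<delta> z) *\<^sub>R G \<delta> \<noteq> 0}"
    by (rule finite_subset[OF sub fin])
  show "integrable (count_space (det_mats n)) (\<lambda>\<delta>. strip_weight (mob \<delta> z) *\<^sub>R G \<delta>)"
  proof (rule integrableI_bounded)
    have "(\<integral>\<^sup>+\<delta>. ennreal (norm (strip_weight (mob \<delta> z) *\<^sub>R G \<delta>)) \<partial>count_space (det_mats n)) =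
       (\<Sum>\<delta>\<in>?S. ennreal (norm (strip_weight (mob \<delta> z) *\<^sub>R G \<delta>)))"
      using supp fin by (intro nn_integral_count_space') auto
    thus "(\<integral>\<^sup>+\<delta>. ennreal (norm (strip_weight (mob \<delta> z) *\<^sub>R G \<delta>)) \<partial>count_space (det_mats n)) < \<infinity>"
      by (simp add: less_top[symmetric])
  qed simp
  have inj: "inj_on (\<lambda>(\<rho>, \<gamma>). mmul \<gamma> \<rho>) (SIGMA \<rho>:hecke_reps n. {\<gamma>\<in>SL2Z. mob \<gamma> (mob \<rho> z) \<in> strip})"
    unfolding inj_on_def using hecke_rep_unique[OF n] by auto
  have pos: "mdet \<rho> > 0" "Im (mob \<rho> z) > 0" if "\<rho> \<in> hecke_reps n" for \<rho>
    using that hecke_reps_subset[of n] n z Im_mob_pos[of \<rho> z] by (auto simp: det_mats_def)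
  have "(LINT \<delta>|count_space (det_mats n). strip_weight (mob \<delta> z) *\<^sub>R G \<delta>) = (\<Sum>\<delta>\<in>?S. strip_weight (mob \<delta> z) *\<^sub>R G \<delta>)"
    unfolding lebesgue_integral_count_space_finite_support[OF fin']
    using sub fin by (intro sum.mono_neutral_left) auto
  also have "\<dots> = (\<Sum>(\<rho>, \<gamma>)\<in>(SIGMA \<rho>:hecke_reps n. {\<gamma>\<in>SL2Z. mob \<gamma> (mob \<rho> z) \<in> strip}).
       strip_weight (mob (mmul \<gamma> \<rho>) z) *\<^sub>R G (mmul \<gamma> \<rho>))"
    unfolding det_mats_strip_eq[OF n z] by (subst sum.reindex[OF inj]) (simp add: case_prod_beta)
  also have "\<dots> = (\<Sum>\<rho>\<in>hecke_reps n. \<Sum>\<gamma>\<in>{\<gamma>\<in>SL2Z. mob \<gamma> (mob \<rho> z) \<in> strip}.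
       strip_weight (mob (mmul \<gamma> \<rho>) z) *\<^sub>R G (mmul \<gamma> \<rho>))"
    using pos by (intro sum.Sigma[symmetric] finite_hecke_reps n ballI finite_SL2Z_strip) auto
  also have "\<dots> = (\<Sum>\<rho>\<in>hecke_reps n. G \<rho>)"
  proof (intro sum.cong refl)
    fix \<rho> assume \<rho>: "\<rho> \<in> hecke_reps n"
    let ?w = "mob \<rho> z"
    have "(\<Sum>\<gamma>\<in>{\<gamma>\<in>SL2Z. mob \<gamma> ?w \<in> strip}. strip_weight (mob (mmul \<gamma> \<rho>) z) *\<^sub>R G (mmul \<gamma> \<rho>)) =
       (\<Sum>\<gamma>\<in>{\<gamma>\<in>SL2Z. mob \<gamma> ?w \<in> strip}. (1 / strip_count ?w) *\<^sub>R G \<rho>)"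
    proof (intro sum.cong refl)
      fix \<gamma> assume *: "\<gamma> \<in> {\<gamma>\<in>SL2Z. mob \<gamma> ?w \<in> strip}"
      hence "mdet \<gamma> > 0" by (simp add: SL2Z_def)
      thus "strip_weight (mob (mmul \<gamma> \<rho>) z) *\<^sub>R G (mmul \<gamma> \<rho>) = (1 / strip_count ?w) *\<^sub>R G \<rho>"
        using * pos[OF \<rho>] z \<rho> by (simp add: mob_mmul G strip_weight_def strip_count_mob)
    qed
    also have "\<dots> = G \<rho>"
      using strip_count_ge_1[OF pos(2)[OF \<rho>]] strip_count_eq_card[OF pos(2)[OF \<rho>]]
      by (simp add: sum_constant_scaleR del: of_nat_eq_0_iff)
    finally show "(\<Sum>\<gamma>\<in>{\<gamma>\<in>SL2Z. mob \<gamma> ?w \<in> strip}. strip_weight (mob (mmul \<gamma> \<rho>) z) *\<^sub>R G (mmul \<gamma> \<rho>)) = G \<rho>" .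
  qed
  finally show "(LINT \<delta>|count_space (det_mats n). strip_weight (mob \<delta> z) *\<^sub>R G \<delta>) = (\<Sum>\<rho>\<in>hecke_reps n. G \<rho>)" .
qed

section \<open>The kernel of the Petersson product and its symmetry\<close>

lemma cusp_form_mob:
  assumes "f \<in> cusp_forms k" "\<gamma> \<in> SL2Z" "Im z > 0"
  shows "f (mob \<gamma> z) = aut \<gamma> z ^ k * f z"
  using assms by (cases \<gamma>) (auto simp: cusp_forms_def SL2Z_def)

lemma measurable_cusp_form:
  assumes "f \<in> cusp_forms k"
  shows "f \<in> borel_measurable borel"
proof -
  have op: "open upper_half_plane"
    unfolding upper_half_plane_def by (intro open_Collect_less continuous_intros)
  have "continuous_on upper_half_plane f"
    using assms by (auto simp: cusp_forms_def intro: holomorphic_on_imp_continuous_on)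
  hence "(\<lambda>z. indicator upper_half_plane z *\<^sub>R f z) \<in> borel_measurable borel"
    using op by (intro borel_measurable_continuous_on_indicator) auto
  also have "(\<lambda>z. indicator upper_half_plane z *\<^sub>R f z) = f"
    using assms by (auto simp: cusp_forms_def fun_eq_iff split: split_indicator)
  finally show ?thesis .
qed

lemma measurable_aut [measurable]: "aut \<delta> \<in> borel_measurable borel"
proof -
  obtain a b c d where g: "\<delta> = (a, b, c, d)" by (cases \<delta>)
  have "aut \<delta> = (\<lambda>z. of_int c * z + of_int d)" by (auto simp: g fun_eq_iff)
  thus ?thesis by simp
qed

text \<open>The term of \<open>hecke_op\<close> attached to \<open>\<delta>\<close>, paired with
  \<open>f\<close>; the factor \<open>n^(k-1)\<close> and the density \<open>1 / (Im z)^2\<close>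
  stay outside.\<close>

definition petersson_kernel :: "nat \<Rightarrow> (complex \<Rightarrow> complex) \<Rightarrow> mat2 \<Rightarrow> complex \<Rightarrow> complex" where
  "petersson_kernel k f \<delta> z = f (mob \<delta> z) / aut \<delta> z ^ k * cnj (f z) * of_real (Im z ^ k)"

lemma petersson_kernel_mmul:
  assumes f: "f \<in> cusp_forms k" and \<gamma>: "\<gamma> \<in> SL2Z" and \<delta>: "mdet \<delta> > 0" and z: "Im z > 0"
  shows "petersson_kernel k f (mmul \<gamma> \<delta>) z = petersson_kernel k f \<delta> z"
proof -
  have g: "mdet \<gamma> > 0" "mdet \<gamma> \<noteq> 0" using \<gamma> by (simp_all add: SL2Z_def)
  have w: "Im (mob \<delta> z) > 0" using \<delta> z by (rule Im_mob_pos)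
  show ?thesis
    using aut_nonzero[OF g(2) w] cusp_form_mob[OF f \<gamma> w]
    by (simp add: petersson_kernel_def mob_mmul[OF g(1) \<delta> z] aut_mmul[OF \<delta> z] power_mult_distrib)
qed

text \<open>The source of self-adjointness. The adjugate undoes \<open>\<delta>\<close>, its
  automorphy factor at the image point is \<open>det / aut\<close>, and \<open>Im\<close> picks up
  \<open>det / |aut|^2\<close>; all powers of the determinant cancel, and \<open>f\<close> and its
  conjugate exchange roles.\<close>

lemma petersson_kernel_madj:
  assumes \<delta>: "mdet \<delta> > 0" and z: "Im z > 0"
  shows "petersson_kernel k f (madj \<delta>) (mob \<delta> z) = cnj (petersson_kernel k f \<delta> z)"
proof -
  have nz: "aut \<delta> z \<noteq> 0" using \<delta> z by (intro aut_nonzero) auto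
  have "(of_int (mdet \<delta>) :: complex) \<noteq> 0" using \<delta> by simp
  moreover have "complex_of_real (cmod (aut \<delta> z)) ^ 2 = aut \<delta> z * cnj (aut \<delta> z)"
    by (metis complex_norm_square of_real_power)
  ultimately show ?thesis
    using nz unfolding petersson_kernel_def mob_madj(1)[OF assms] aut_madj[OF assms] Im_mob
    by (simp add: power_divide power_mult_distrib)
qed

text \<open>The product of the bounded heights at \<open>z\<close> and at
  \<open>mob \<delta> z\<close> is the modulus of the kernel times \<open>det^m\<close>, and the
  determinant is at least 1.\<close>

lemma cmod_petersson_kernel_le:
  assumes M: "\<And>z. Im z > 0 \<Longrightarrow> cmod (f z) * Im z ^ m \<le> M" and \<delta>: "mdet \<delta> > 0" and z: "Im z > 0"
  shows "cmod (petersson_kernel (2 * m) f \<delta> z) \<le> M\<^sup>2"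
proof -
  have nz: "aut \<delta> z \<noteq> 0" using \<delta> z by (intro aut_nonzero) auto
  have w: "Im (mob \<delta> z) > 0" using \<delta> z by (rule Im_mob_pos)
  have d1: "real_of_int (mdet \<delta>) ^ m \<ge> 1" using \<delta> by (intro one_le_power) linarith
  have "(cmod (f (mob \<delta> z)) * Im (mob \<delta> z) ^ m) * (cmod (f z) * Im z ^ m) =
      real_of_int (mdet \<delta>) ^ m * cmod (petersson_kernel (2 * m) f \<delta> z)"
    unfolding Im_mob using z nz
    by (simp add: petersson_kernel_def norm_mult norm_divide norm_power power_divide power_mult_distrib
        power_mult power2_eq_square)
  moreover have "1 * cmod (petersson_kernel (2 * m) f \<delta> z) \<le> real_of_int (mdet \<delta>) ^ m * cmod (petersson_kernel (2 * m) f \<delta> z)"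
    using d1 by (rule mult_right_mono) simp
  moreover have "(cmod (f (mob \<delta> z)) * Im (mob \<delta> z) ^ m) * (cmod (f z) * Im z ^ m) \<le> M * M"
    using M[OF w] M[OF z] w z order.trans[of 0 "cmod (f z) * Im z ^ m" M] by (intro mult_mono) auto
  ultimately show ?thesis by (simp add: power2_eq_square)
qed

lemma sum_petersson_kernel:
  assumes n: "n > 0" and \<mu>: "\<And>z. hecke_op k n f z = \<mu> * f z"
  shows "(\<Sum>\<rho>\<in>hecke_reps n. petersson_kernel k f \<rho> z) =
    \<mu> / of_nat n ^ (k - 1) * of_real ((cmod (f z))\<^sup>2 * Im z ^ k)"
proof -
  have "(\<Sum>\<rho>\<in>hecke_reps n. petersson_kernel k f \<rho> z) =
     (\<Sum>d | d dvd n. \<Sum>b<d. f ((of_nat (n div d) * z + of_nat b) / of_nat d) / of_nat d ^ k) * cnj (f z) * of_real (Im z ^ k)"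
    unfolding sum_hecke_reps[OF n] petersson_kernel_def by (simp add: sum_distrib_right)
  also have "(\<Sum>d | d dvd n. \<Sum>b<d. f ((of_nat (n div d) * z + of_nat b) / of_nat d) / of_nat d ^ k) = \<mu> * f z / of_nat n ^ (k - 1)"
    using \<mu>[of z] n by (simp add: hecke_op_def field_simps)
  also have "\<mu> * f z / of_nat n ^ (k - 1) * cnj (f z) * of_real (Im z ^ k) = \<mu> / of_nat n ^ (k - 1) * ((f z * cnj (f z)) * of_real (Im z ^ k))"
    by simp
  also have "f z * cnj (f z) = of_real ((cmod (f z))\<^sup>2)" by (rule complex_norm_square[symmetric])
  finally show ?thesis by simp
qed

lemma hecke_eigenvalue_real:
  assumes f: "f \<in> cusp_forms (2 * m)" and f0: "f \<noteq> 0" and n: "n > 0"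
    and \<mu>: "\<And>z. hecke_op (2 * m) n f z = \<mu> * f z"
  shows "\<mu> \<in> \<real>"
proof -
  define k where "k = 2 * m"
  define U where "U = upper_half_plane"
  note f = f[folded k_def] and \<mu> = \<mu>[folded k_def]
  obtain M where M: "\<And>z. Im z > 0 \<Longrightarrow> cmod (f z) * Im z ^ m \<le> M"
    using cusp_form_bounded assms(1) by blast
  have [measurable]: "f \<in> borel_measurable borel" using f by (rule measurable_cusp_form)
  have [measurable]: "U \<in> sets borel"
    unfolding U_def upper_half_plane_def by (intro borel_open open_Collect_less continuous_intros)
  have [measurable]: "(\<lambda>z. complex_of_real (Im z ^ k)) \<in> borel_measurable borel" "cnj \<in> borel_measurable borel"
    by (intro borel_measurable_continuous_onI continuous_intros)+
  have [measurable]: "(\<lambda>z. cnj (f z)) \<in> borel_measurable borel"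
    by (rule measurable_compose[of f borel borel]) measurable
  have [measurable]: "petersson_kernel k f \<delta> \<in> borel_measurable borel" for \<delta>
    unfolding petersson_kernel_def[abs_def] by measurable
  \<comment> \<open>One weight localizes \<open>z\<close>, the other \<open>mob \<delta> z\<close>.
    The second makes the sum over all of \<open>det_mats n\<close> collapse to coset
    representatives, and the pair is symmetric under exchanging the two points.\<close>
  define F where "F = (\<lambda>\<delta> z. (strip_weight z * strip_weight (mob \<delta> z)) *\<^sub>R petersson_kernel k f \<delta> z)"
  define T where "T = (\<lambda>z \<delta>. indicator U z *\<^sub>R (F \<delta> z / of_real ((Im z)\<^sup>2)))"
  have [measurable]: "F \<delta> \<in> borel_measurable borel" for \<delta> unfolding F_def by measurable
  have [measurable]: "(\<lambda>z. T z \<delta>) \<in> borel_measurable borel" for \<delta> unfolding T_def by measurable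
  have kernel_inv: "petersson_kernel k f (mmul \<gamma> \<rho>) z = petersson_kernel k f \<rho> z"
    if "\<gamma> \<in> SL2Z" "\<rho> \<in> hecke_reps n" "Im z > 0" for \<gamma> \<rho> z
    using that n hecke_reps_subset[of n] by (intro petersson_kernel_mmul[OF f]) (auto simp: det_mats_def)
  have M0: "M \<ge> 0" using M[of \<i>] order.trans[of 0 "cmod (f \<i>) * Im \<i> ^ m" M] by simp
  have kernel_le: "cmod (petersson_kernel k f \<delta> z) \<le> M\<^sup>2" if "\<delta> \<in> det_mats n" "Im z > 0" for \<delta> z
    unfolding k_def using that n by (intro cmod_petersson_kernel_le[OF M]) (auto simp: det_mats_def)
  have wle: "strip_weight z \<le> 1" for z using strip_weight_le[of z] by (auto split: split_indicator_asm)
  have strip_int: "integrable lborel (\<lambda>z. C * (indicator strip z * (1 / (Im z)\<^sup>2)) :: real)" for C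
    by (intro integrable_mult_right integrable_strip)
  have T_split: "T z \<delta> = strip_weight (mob \<delta> z) *\<^sub>R (of_real (indicator U z * strip_weight z / (Im z)\<^sup>2) * petersson_kernel k f \<delta> z)" for z \<delta>
    by (simp add: T_def F_def scaleR_conv_of_real)
  have T_norm: "norm (T z \<delta>) = strip_weight (mob \<delta> z) *\<^sub>R (indicator U z * strip_weight z / (Im z)\<^sup>2 * cmod (petersson_kernel k f \<delta> z))" for z \<delta>
    unfolding T_split by (simp add: norm_mult norm_divide norm_power strip_weight_nonneg)
  have T0: "T z \<delta> = 0" if "Im z \<le> 0" for z \<delta> using that by (simp add: T_def U_def)
  have inner: "(LINT \<delta>|count_space (det_mats n). T z \<delta>) =
     of_real (indicator U z * strip_weight z / (Im z)\<^sup>2) * (\<Sum>\<rho>\<in>hecke_reps n. petersson_kernel k f \<rho> z)"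
    and inner_norm: "(LINT \<delta>|count_space (det_mats n). norm (T z \<delta>)) =
     indicator U z * strip_weight z / (Im z)\<^sup>2 * (\<Sum>\<rho>\<in>hecke_reps n. cmod (petersson_kernel k f \<rho> z))"
    and inner_int: "integrable (count_space (det_mats n)) (T z)" for z
  proof -
    show "(LINT \<delta>|count_space (det_mats n). T z \<delta>) =
     of_real (indicator U z * strip_weight z / (Im z)\<^sup>2) * (\<Sum>\<rho>\<in>hecke_reps n. petersson_kernel k f \<rho> z)"
    proof (cases "Im z > 0")
      case True
      show ?thesis unfolding T_split sum_distrib_left
        by (rule integral_strip_weight_orbit[OF n True]) (simp add: kernel_inv True)
    qed (simp add: T0 U_def)
    show "(LINT \<delta>|count_space (det_mats n). norm (T z \<delta>)) =
     indicator U z * strip_weight z / (Im z)\<^sup>2 * (\<Sum>\<rho>\<in>hecke_reps n. cmod (petersson_kernel k f \<rho> z))"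
    proof (cases "Im z > 0")
      case True
      show ?thesis unfolding T_norm sum_distrib_left
        by (rule integral_strip_weight_orbit[OF n True]) (simp add: kernel_inv True)
    qed (simp add: T0 U_def)
    show "integrable (count_space (det_mats n)) (T z)"
    proof (cases "Im z > 0")
      case True
      show ?thesis unfolding T_split[abs_def]
        by (rule integrable_strip_weight_orbit[OF n True]) (simp add: kernel_inv True)
    next
      case False
      hence "T z = (\<lambda>_. 0)" by (auto simp: fun_eq_iff T0)
      thus ?thesis by simp
    qed
  qed
  \<comment> \<open>A multiple of the hyperbolic density of the strip dominates the summed norms,
    which licenses Fubini.\<close>
  have inner_bound: "indicator U z * strip_weight z / (Im z)\<^sup>2 * (\<Sum>\<rho>\<in>hecke_reps n. cmod (petersson_kernel k f \<rho> z))
     \<le> of_nat (card (hecke_reps n)) * M\<^sup>2 * (indicator strip z * (1 / (Im z)\<^sup>2))" for z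
  proof (cases "Im z > 0")
    case True
    have "(\<Sum>\<rho>\<in>hecke_reps n. cmod (petersson_kernel k f \<rho> z)) \<le> of_nat (card (hecke_reps n)) * M\<^sup>2"
      using True hecke_reps_subset[of n] by (intro sum_bounded_above kernel_le) auto
    moreover have "strip_weight z / (Im z)\<^sup>2 \<le> indicator strip z / (Im z)\<^sup>2"
      by (intro divide_right_mono strip_weight_le) auto
    ultimately have "strip_weight z / (Im z)\<^sup>2 * (\<Sum>\<rho>\<in>hecke_reps n. cmod (petersson_kernel k f \<rho> z))
       \<le> indicator strip z / (Im z)\<^sup>2 * (of_nat (card (hecke_reps n)) * M\<^sup>2)"
      by (intro mult_mono) (auto intro!: sum_nonneg)
    thus ?thesis using True by (simp add: U_def mult_ac)
  qed (simp add: U_def)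
  have psf: "pair_sigma_finite lborel (count_space (det_mats n))"
    by (simp add: pair_sigma_finite_def sigma_finite_lborel sigma_finite_measure_count_space)
  have int_prod: "integrable (lborel \<Otimes>\<^sub>M count_space (det_mats n)) (\<lambda>(z, \<delta>). T z \<delta>)"
  proof (rule pair_sigma_finite.Fubini_integrable[OF psf])
    show "(\<lambda>(z, \<delta>). T z \<delta>) \<in> borel_measurable (lborel \<Otimes>\<^sub>M count_space (det_mats n))"
      by (rule measurable_pair_count_space) simp
    show "integrable lborel (\<lambda>z. LINT \<delta>|count_space (det_mats n). norm (case (z, \<delta>) of (z, \<delta>) \<Rightarrow> T z \<delta>))"
      unfolding prod.case inner_norm
    proof (rule Bochner_Integration.integrable_bound[OF strip_int])
      show "AE z in lborel. norm (indicator U z * strip_weight z / (Im z)\<^sup>2 * (\<Sum>\<rho>\<in>hecke_reps n. cmod (petersson_kernel k f \<rho> z)))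
         \<le> norm (of_nat (card (hecke_reps n)) * M\<^sup>2 * (indicator strip z * (1 / (Im z)\<^sup>2)))"
        using inner_bound by (intro AE_I2) (simp add: abs_mult strip_weight_nonneg sum_nonneg)
    qed measurable
  qed (use inner_int in auto)
  define J where "J = (\<lambda>\<delta>. LINT z|lborel. T z \<delta>)"
  have int_T: "integrable lborel (\<lambda>z. T z \<delta>)" if \<delta>: "\<delta> \<in> det_mats n" for \<delta>
  proof (rule Bochner_Integration.integrable_bound[OF strip_int[of "M\<^sup>2"]])
    show "AE z in lborel. norm (T z \<delta>) \<le> norm (M\<^sup>2 * (indicator strip z * (1 / (Im z)\<^sup>2)))"
    proof (intro AE_I2)
      fix z
      show "norm (T z \<delta>) \<le> norm (M\<^sup>2 * (indicator strip z * (1 / (Im z)\<^sup>2)))"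
      proof (cases "Im z > 0")
        case True
        have "norm (T z \<delta>) = strip_weight (mob \<delta> z) * (strip_weight z / (Im z)\<^sup>2 * cmod (petersson_kernel k f \<delta> z))"
          using True by (simp add: T_norm U_def)
        also have "\<dots> \<le> 1 * (indicator strip z / (Im z)\<^sup>2 * M\<^sup>2)"
          using True \<delta> by (intro mult_mono wle divide_right_mono strip_weight_le kernel_le)
            (auto intro!: mult_nonneg_nonneg divide_nonneg_nonneg strip_weight_nonneg)
        finally show ?thesis by (simp add: mult_ac)
      qed (simp add: T0)
    qed
  qed measurable
  \<comment> \<open>Substituting \<open>mob \<delta> z\<close> for \<open>z\<close> swaps the two
    weights and conjugates the kernel.\<close>
  have J_adj: "J (madj \<delta>) = cnj (J \<delta>)" if \<delta>: "\<delta> \<in> det_mats n" for \<delta>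
  proof -
    have det: "mdet \<delta> > 0" and adj: "madj \<delta> \<in> det_mats n" using \<delta> n by (auto simp: det_mats_def)
    have "J (madj \<delta>) = (LINT z|lborel. indicator U z *\<^sub>R (F (madj \<delta>) (mob \<delta> z) / of_real ((Im z)\<^sup>2)))"
      unfolding J_def T_def U_def
      by (rule moebius_integral_invariant[symmetric, OF det])
         (use int_T[OF adj] in \<open>simp_all add: T_def U_def\<close>)
    also have "\<dots> = (LINT z|lborel. cnj (T z \<delta>))"
    proof (intro Bochner_Integration.integral_cong refl)
      fix z
      show "indicator U z *\<^sub>R (F (madj \<delta>) (mob \<delta> z) / of_real ((Im z)\<^sup>2)) = cnj (T z \<delta>)"
      proof (cases "Im z > 0")
        case True
        show ?thesis unfolding T_def F_def mob_madj(1)[OF det True] petersson_kernel_madj[OF det True]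
          by (simp add: mult.commute)
      qed (simp add: U_def T0)
    qed
    also have "\<dots> = cnj (J \<delta>)" by (simp add: J_def)
    finally show ?thesis .
  qed
  define I where "I = (LINT \<delta>|count_space (det_mats n). J \<delta>)"
  have "cnj I = (LINT \<delta>|count_space (det_mats n). cnj (J \<delta>))"
    by (simp add: I_def)
  also have "\<dots> = (LINT \<delta>|count_space (det_mats n). J (madj \<delta>))"
    by (intro Bochner_Integration.integral_cong) (auto simp: J_adj)
  also have "\<dots> = I" unfolding I_def
  proof (rule integral_bij_count_space)
    show "bij_betw madj (det_mats n) (det_mats n)"
      by (rule bij_betwI[where g = madj]) (auto simp: det_mats_def)
  qed
  finally have I_real: "cnj I = I" .
  \<comment> \<open>Integrating over \<open>z\<close> before summing showed that \<open>I\<close> is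
    real. Summing over \<open>\<delta>\<close> first exhibits \<open>I\<close> as
    \<open>\<mu>\<close> times a positive multiple of the Petersson norm of \<open>f\<close>, with
    density \<open>h\<close>.\<close>
  define h where "h = (\<lambda>z. indicator U z * strip_weight z / (Im z)\<^sup>2 * ((cmod (f z))\<^sup>2 * Im z ^ k))"
  have I_eq: "I = \<mu> / of_nat n ^ (k - 1) * of_real (integral\<^sup>L lborel h)"
  proof -
    have "I = (LINT z|lborel. LINT \<delta>|count_space (det_mats n). T z \<delta>)"
      unfolding I_def J_def by (rule pair_sigma_finite.Fubini_integral[OF psf int_prod])
    also have "\<dots> = (LINT z|lborel. \<mu> / of_nat n ^ (k - 1) * of_real (h z))"
      unfolding inner sum_petersson_kernel[OF n \<mu>] h_def by (intro Bochner_Integration.integral_cong) (auto simp: mult_ac)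
    finally show ?thesis by simp
  qed
  have h_nonneg: "h z \<ge> 0" for z
    by (auto simp: h_def U_def strip_weight_nonneg split: split_indicator)
  have h_int: "integrable lborel h"
  proof (rule Bochner_Integration.integrable_bound[OF strip_int[of "M\<^sup>2"]])
    show "AE z in lborel. norm (h z) \<le> norm (M\<^sup>2 * (indicator strip z * (1 / (Im z)\<^sup>2)))"
    proof (intro AE_I2)
      fix z
      show "norm (h z) \<le> norm (M\<^sup>2 * (indicator strip z * (1 / (Im z)\<^sup>2)))"
      proof (cases "Im z > 0")
        case True
        have "h z = strip_weight z / (Im z)\<^sup>2 * (cmod (f z) * Im z ^ m)\<^sup>2"
          using True by (simp add: h_def U_def k_def power_mult_distrib power_mult[symmetric] mult.commute)
        also have "\<dots> \<le> indicator strip z / (Im z)\<^sup>2 * M\<^sup>2"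
          using True M[OF True] by (intro mult_mono divide_right_mono strip_weight_le power_mono)
            (auto intro!: divide_nonneg_nonneg strip_weight_nonneg)
        finally show ?thesis using h_nonneg[of z] by (simp add: mult_ac)
      qed (simp add: h_def U_def)
    qed
  qed (simp add: h_def)
  have h_pos: "integral\<^sup>L lborel h \<noteq> 0"
  proof
    assume "integral\<^sup>L lborel h = 0"
    hence AE: "AE z in lborel. h z = 0"
      using integral_nonneg_eq_0_iff_AE[OF h_int] h_nonneg by simp
    obtain z0 where z0: "f z0 \<noteq> 0" using f0 by (auto simp: fun_eq_iff zero_fun_def)
    hence Imz0: "Im z0 > 0" using f by (force simp: cusp_forms_def)
    obtain \<gamma> where \<gamma>: "\<gamma> \<in> SL2Z" "mob \<gamma> z0 \<in> strip" "\<bar>Re (mob \<gamma> z0)\<bar> \<le> 1 / 2"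
      using SL2Z_strip_nonempty[OF Imz0] by blast
    have det: "mdet \<gamma> \<noteq> 0" using \<gamma> by (simp add: SL2Z_def)
    define w where "w = mob \<gamma> z0"
    have w: "f w \<noteq> 0" "Im w \<ge> 1 / 5" "\<bar>Re w\<bar> \<le> 1 / 2"
      using \<gamma> z0 aut_nonzero[OF det Imz0] cusp_form_mob[OF f \<gamma>(1) Imz0] by (auto simp: w_def strip_def)
    have "open U" unfolding U_def upper_half_plane_def by (intro open_Collect_less continuous_intros)
    moreover have "w \<in> U" using w by (simp add: U_def)
    moreover have "continuous_on U f"
      using f by (auto simp: cusp_forms_def U_def intro: holomorphic_on_imp_continuous_on)
    ultimately have "isCont f w" by (simp add: continuous_on_eq_continuous_at)
    then obtain e where e: "e > 0" "\<And>z. dist w z < e \<Longrightarrow> f z \<noteq> 0"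
      using continuous_at_avoid[of w f 0] w(1) by auto
    define r where "r = min (e / 2) (1 / 4)"
    have r: "r > 0" "r \<le> e / 2" "r \<le> 1 / 4" using e by (auto simp: r_def)
    \<comment> \<open>\<open>w\<close> may lie on the lower edge of the strip, so the ball is
      centred above it, with \<open>w\<close> on its boundary. The bound \<open>r <= 1/4\<close>
      keeps it within the width of the strip, and \<open>2 r <= e\<close> keeps it where
      \<open>f\<close> is nonzero.\<close>
    define c where "c = w + \<i> * of_real r"
    have hz: "h z \<noteq> 0" if z: "z \<in> ball c r" for z
    proof -
      have dz: "dist c z < r" using z by simp
      have "dist w c = r" using r by (simp add: c_def dist_norm norm_mult)
      hence "dist w z < e" using dist_triangle[of w z c] dz r by simp
      hence fz: "f z \<noteq> 0" by (rule e(2))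
      have "\<bar>Re z - Re c\<bar> < r" "\<bar>Im z - Im c\<bar> < r"
        using dz abs_Re_le_cmod[of "c - z"] abs_Im_le_cmod[of "c - z"] by (auto simp: dist_norm)
      moreover have "Re c = Re w" "Im c = Im w + r" by (simp_all add: c_def)
      ultimately have "\<bar>Re z\<bar> \<le> 1" "Im z \<ge> 1 / 5" using w r by linarith+
      hence zs: "z \<in> strip" "Im z > 0" by (auto simp: strip_def)
      hence "strip_weight z > 0" using strip_count_ge_1[OF zs(2)] by (simp add: strip_weight_def)
      thus ?thesis using zs fz by (simp add: h_def U_def)
    qed
    have "AE z in lborel. z \<notin> ball c r"
      using AE by eventually_elim (use hz in blast)
    hence "emeasure lborel (ball c r) = 0"
      by (subst AE_iff_measurable[symmetric, of "ball c r" lborel "\<lambda>z. z \<notin> ball c r"]) auto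
    moreover have "emeasure lborel (ball c r) > 0"
      using r by (simp add: emeasure_ball ennreal_zero_less_mult_iff)
    ultimately show False by simp
  qed
  have "cnj \<mu> / of_nat n ^ (k - 1) * of_real (integral\<^sup>L lborel h) = \<mu> / of_nat n ^ (k - 1) * of_real (integral\<^sup>L lborel h)"
    using I_real unfolding I_eq by simp
  hence "cnj \<mu> = \<mu>" using h_pos n by simp
  thus ?thesis by (simp add: Reals_cnj_iff)
qed

section \<open>Reflected polynomials and the dominance of the first coefficient\<close>

lemma cmod_one_minus_cnj_mult_less:
  assumes "cmod u < 1" "1 < cmod r"
  shows "cmod (1 - cnj r * u) < cmod (u - r)"
proof -
  have "(cmod (u - r))\<^sup>2 - (cmod (1 - cnj r * u))\<^sup>2 = ((cmod r)\<^sup>2 - 1) * (1 - (cmod u)\<^sup>2)"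
    unfolding cmod_power2 by (simp add: power2_eq_square algebra_simps)
  also have "\<dots> > 0"
    using assms by (intro mult_pos_pos) (auto simp: abs_square_less_1 intro!: one_less_power)
  finally show ?thesis
    by (simp add: power2_less_imp_less)
qed

text \<open>Comparison root by root: reflecting \<open>u - r i\<close> gives
  \<open>1 - cnj (r i) * u\<close>, a Blaschke quotient of modulus below 1 as \<open>r i\<close>
  lies outside the disc. Strictness comes from some root if \<open>degree p = w\<close>, and
  otherwise from the surplus factor \<open>u ^ (w - degree p)\<close>. The case \<open>u = 0\<close>
  stands apart because the reflection is computed through \<open>1 / cnj u\<close>.\<close>

lemma reflected_poly_less:
  fixes p :: "complex poly"
  assumes deg: "degree p \<le> w" and "w > 0"
    and nz: "\<And>x. cmod x \<le> 1 \<Longrightarrow> poly p x \<noteq> 0" and u: "cmod u < 1"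
  shows "cmod (\<Sum>i\<le>w. cnj (coeff p i) * u ^ (w - i)) < cmod (poly p u)"
proof -
  obtain r where r: "smult (lead_coeff p) (\<Prod>i<degree p. [:-r i, 1:]) = p"
    using complex_poly_decompose' by blast
  have pp: "poly p x = lead_coeff p * (\<Prod>i<degree p. x - r i)" for x
    by (subst r[symmetric]) (simp add: poly_prod)
  have c0: "lead_coeff p \<noteq> 0"
    using nz[of 0] by auto
  have ri: "1 < cmod (r i)" if "i < degree p" for i
  proof (rule ccontr)
    assume "\<not> ?thesis"
    moreover have "poly p (r i) = 0"
      unfolding pp using that by auto
    ultimately show False using nz[of "r i"] by auto
  qed
  show ?thesis
  proof (cases "u = 0")
    case True
    have eq: "(\<Sum>i\<le>w. cnj (coeff p i) * u ^ (w - i)) = cnj (coeff p w)"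
    proof -
      have "(\<Sum>i\<le>w. cnj (coeff p i) * u ^ (w - i)) = (\<Sum>i\<in>{w}. cnj (coeff p i) * u ^ (w - i))"
        using True by (intro sum.mono_neutral_right) auto
      thus ?thesis by simp
    qed
    have p0: "cmod (poly p 0) = cmod (lead_coeff p) * (\<Prod>i<degree p. cmod (r i))"
      unfolding pp by (simp add: norm_mult prod_norm[symmetric])
    show ?thesis
    proof (cases "degree p = w")
      case True
      have "(\<Prod>i<degree p. (1::real)) < (\<Prod>i<degree p. cmod (r i))"
      proof (rule prod_mono_strict[of 0])
        show "0 \<in> {..<degree p}" using True \<open>w > 0\<close> by simp
        show "(1::real) < cmod (r 0)" using ri[of 0] True \<open>w > 0\<close> by simp
        show "0 < cmod (r i)" "0 \<le> (1::real) \<and> 1 \<le> cmod (r i)" if "i \<in> {..<degree p}" for i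
          using ri[of i] that by auto
      qed auto
      thus ?thesis
        using c0 True unfolding eq unfolding \<open>u = 0\<close> p0 by simp
    next
      case False
      hence "coeff p w = 0" using deg by (intro coeff_eq_0) auto
      thus ?thesis
        using eq \<open>u = 0\<close> nz[of 0] by auto
    qed
  next
    case u0: False
    have "(\<Sum>i\<le>w. cnj (coeff p i) * u ^ (w - i)) = (\<Sum>i\<le>degree p. cnj (coeff p i) * u ^ (w - i))"
      using deg by (intro sum.mono_neutral_right) (auto simp: coeff_eq_0)
    also have "\<dots> = (\<Sum>i\<le>degree p. u ^ w * cnj (coeff p i * (1 / cnj u) ^ i))"
      using u0 deg by (intro sum.cong) (auto simp: power_diff power_divide field_simps)
    also have "\<dots> = u ^ w * cnj (poly p (1 / cnj u))"
      by (simp add: poly_altdef sum_distrib_left)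
    also have "cmod \<dots> = cmod u ^ w * (cmod (lead_coeff p) * (\<Prod>i<degree p. cmod (1 / cnj u - r i)))"
      unfolding norm_mult norm_power complex_mod_cnj pp prod_norm[symmetric] ..
    also have "\<dots> = cmod (lead_coeff p) * cmod u ^ (w - degree p) * (\<Prod>i<degree p. cmod u * cmod (1 / cnj u - r i))"
      using deg by (simp add: prod.distrib power_add[symmetric])
    also have "(\<Prod>i<degree p. cmod u * cmod (1 / cnj u - r i)) = (\<Prod>i<degree p. cmod (1 - cnj (r i) * u))"
    proof (intro prod.cong refl)
      fix i
      have "cmod u * cmod (1 / cnj u - r i) = cmod (cnj u) * cmod (1 / cnj u - r i)" by simp
      also have "\<dots> = cmod (1 - r i * cnj u)"
        using u0 unfolding norm_mult[symmetric] by (simp add: right_diff_distrib mult.commute)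
      also have "\<dots> = cmod (cnj (1 - r i * cnj u))" by (rule complex_mod_cnj[symmetric])
      finally show "cmod u * cmod (1 / cnj u - r i) = cmod (1 - cnj (r i) * u)" by simp
    qed
    finally have L: "cmod (\<Sum>i\<le>w. cnj (coeff p i) * u ^ (w - i)) =
      cmod (lead_coeff p) * cmod u ^ (w - degree p) * (\<Prod>i<degree p. cmod (1 - cnj (r i) * u))" .
    have R: "cmod (poly p u) = cmod (lead_coeff p) * 1 * (\<Prod>i<degree p. cmod (u - r i))"
      unfolding pp by (simp add: norm_mult prod_norm)
    have le: "(\<Prod>i<degree p. cmod (1 - cnj (r i) * u)) \<le> (\<Prod>i<degree p. cmod (u - r i))"
      by (intro prod_mono) (auto intro!: less_imp_le cmod_one_minus_cnj_mult_less u ri)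
    have pos: "(\<Prod>i<degree p. cmod (u - r i)) > 0"
      using ri u by (intro prod_pos) fastforce
    show ?thesis
    proof (cases "degree p = w")
      case True
      have "(\<Prod>i<degree p. cmod (1 - cnj (r i) * u)) < (\<Prod>i<degree p. cmod (u - r i))"
      proof (rule prod_mono_strict[of 0])
        show "0 \<in> {..<degree p}" using True \<open>w > 0\<close> by simp
        show "0 < cmod (u - r i)" if "i \<in> {..<degree p}" for i
          using ri[of i] u that by auto
        show "cmod (1 - cnj (r 0) * u) < cmod (u - r 0)"
          using True \<open>w > 0\<close> by (intro cmod_one_minus_cnj_mult_less u ri) auto
      qed (auto intro!: less_imp_le cmod_one_minus_cnj_mult_less u ri)
      thus ?thesis unfolding L R using c0 True by simp
    next
      case False
      hence "cmod u ^ (w - degree p) < 1"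
        using u deg by (intro power_less_one_iff[THEN iffD2]) auto
      hence "cmod u ^ (w - degree p) * (\<Prod>i<degree p. cmod (1 - cnj (r i) * u)) < 1 * (\<Prod>i<degree p. cmod (u - r i))"
        using le pos by (intro le_less_trans[OF mult_left_mono[OF le] mult_strict_right_mono]) auto
      thus ?thesis unfolding L R using c0 by (simp add: mult.assoc)
    qed
  qed
qed

section \<open>Exponential integrals and their size on the unit disc\<close>

lemma has_bochner_integral_power_exp:
  fixes l :: real
  assumes l: "l > 0"
  shows "has_bochner_integral lborel (\<lambda>t. indicator {0..} t * (t ^ j * exp (- l * t))) (fact j / l ^ (j + 1))"
proof -
  have "((\<lambda>t::real. t powr (real (Suc j) - 1) / exp t) has_integral Gamma (real (Suc j))) {0..}"
    by (rule Gamma_integral_real) simp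
  \<comment> \<open>The point 0 is exempted because for \<open>j = 0\<close> the integrands differ
    there: \<open>0 powr 0 = 0\<close>, but \<open>0 ^ 0 = 1\<close>.\<close>
  hence "((\<lambda>t::real. t ^ j * exp (-t)) has_integral fact j) {0..}"
    by (subst (asm) has_integral_spike_finite_eq[of "{0}" _ "\<lambda>t. t ^ j * exp (-t)"])
       (auto simp: powr_realpow exp_minus divide_inverse Gamma_fact[symmetric] add.commute)
  hence "((\<lambda>t::real. if t \<in> {0..} then t ^ j * exp (-t) else 0) has_integral fact j) UNIV"
    by (subst has_integral_restrict_UNIV)
  also have "(\<lambda>t::real. if t \<in> {0..} then t ^ j * exp (-t) else 0) = (\<lambda>t. indicator {0..} t * (t ^ j * exp (-t)))"
    by (auto simp: fun_eq_iff)
  finally have "has_bochner_integral lborel (\<lambda>t::real. indicator {0..} t * (t ^ j * exp (-t))) (fact j)"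
    by (intro has_bochner_integral_nn_integral nn_integral_has_integral_lborel)
       (auto split: split_indicator)
  hence "has_bochner_integral lborel (\<lambda>t::real. indicator {0..} (l * t) * ((l * t) ^ j * exp (- (l * t)))) (fact j / l)"
    using l by (subst (asm) lborel_has_bochner_integral_real_affine_iff[of l _ _ 0]) (auto simp: divide_inverse mult_ac)
  hence "has_bochner_integral lborel (\<lambda>t::real. 1 / l ^ j * (indicator {0..} (l * t) * ((l * t) ^ j * exp (- (l * t))))) (1 / l ^ j * (fact j / l))"
    by (intro has_bochner_integral_mult_right) auto
  also have "(\<lambda>t::real. 1 / l ^ j * (indicator {0..} (l * t) * ((l * t) ^ j * exp (- (l * t))))) = (\<lambda>t. indicator {0..} t * (t ^ j * exp (- l * t)))"
    using l by (auto simp: fun_eq_iff power_mult_distrib zero_le_mult_iff split: split_indicator)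
  finally show ?thesis using l by (simp add: mult.commute)
qed

text \<open>After the shift by 1, \<open>(t + (1 - u))^w\<close> is expanded binomially and each
  power gives a Gamma integral; what results is the exponential series of \<open>l (1 - u)\<close>
  cut off at \<open>w\<close>. The complex case evaluates the terms of \<open>W\<close>, the real
  case \<open>u = -1\<close> majorizes them.\<close>

lemma has_bochner_integral_exp_shifted_power:
  fixes u :: "'a :: {real_normed_field, banach, second_countable_topology}" and l :: real
  assumes l: "l > 0"
  shows "has_bochner_integral lborel
           (\<lambda>t. indicator {1..} t *\<^sub>R (of_real (exp (- l * t)) * (of_real t - u) ^ w))
           (of_real (exp (- l) * fact w / l ^ (w + 1)) * (\<Sum>i\<le>w. (of_real l * (1 - u)) ^ i / fact i))"
proof -
  let ?g = "\<lambda>j t. indicator {0..} t * (t ^ j * exp (- l * t)) :: real"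
  let ?c = "\<lambda>j. of_real (exp (-l)) * of_nat (w choose j) * (1 - u) ^ (w - j) :: 'a"
  have "has_bochner_integral lborel (\<lambda>t. \<Sum>j\<le>w. ?c j * of_real (?g j t))
          (\<Sum>j\<le>w. ?c j * of_real (fact j / l ^ (j + 1)))"
    by (intro has_bochner_integral_sum has_bochner_integral_mult_right has_bochner_integral_of_real
          has_bochner_integral_power_exp l) 
  also have "(\<lambda>t. \<Sum>j\<le>w. ?c j * of_real (?g j t)) =
     (\<lambda>t. indicator {1..} (1 + 1 * t) *\<^sub>R (of_real (exp (- l * (1 + 1 * t))) * (of_real (1 + 1 * t) - u) ^ w))"
  proof
    fix t :: real
    have "(\<Sum>j\<le>w. ?c j * of_real (?g j t)) =
      indicator {1..} (1 + 1 * t) *\<^sub>R (of_real (exp (- l)) * of_real (exp (- l * t)) * (\<Sum>j\<le>w. of_nat (w choose j) * of_real t ^ j * (1 - u) ^ (w - j)))"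
      by (auto simp: sum_distrib_left sum_distrib_right scaleR_conv_of_real mult_ac split: split_indicator intro!: sum.cong)
    also have "(\<Sum>j\<le>w. of_nat (w choose j) * of_real t ^ j * (1 - u) ^ (w - j)) = (of_real t + (1 - u)) ^ w"
      by (rule binomial_ring[symmetric])
    also have "of_real (exp (- l)) * of_real (exp (- l * t)) = (of_real (exp (- l * (1 + 1 * t))) :: 'a)"
      by (simp add: of_real_mult[symmetric] mult_exp_exp algebra_simps del: of_real_mult)
    finally show "(\<Sum>j\<le>w. ?c j * of_real (?g j t)) = indicator {1..} (1 + 1 * t) *\<^sub>R (of_real (exp (- l * (1 + 1 * t))) * (of_real (1 + 1 * t) - u) ^ w)"
      by (simp add: algebra_simps)
  qed
  also have "(\<Sum>j\<le>w. ?c j * of_real (fact j / l ^ (j + 1))) =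
     of_real (exp (- l) * fact w / l ^ (w + 1)) * (\<Sum>i\<le>w. (of_real l * (1 - u)) ^ i / fact i)"
  proof -
    have "(\<Sum>j\<le>w. ?c j * of_real (fact j / l ^ (j + 1))) =
      (\<Sum>j\<le>w. of_real (exp (- l) * fact w / l ^ (w + 1)) * ((of_real l * (1 - u)) ^ (w - j) / fact (w - j)))"
    proof (intro sum.cong refl)
      fix j assume "j \<in> {..w}"
      hence j: "j \<le> w" by simp
      have 1: "l ^ (w + 1) = l ^ (j + 1) * l ^ (w - j)"
        using j by (simp add: power_add[symmetric])
      have 2: "of_nat (w choose j) = (fact w / (fact j * fact (w - j)) :: 'a)"
        using j by (rule binomial_fact)
      show "?c j * of_real (fact j / l ^ (j + 1)) = of_real (exp (- l) * fact w / l ^ (w + 1)) * ((of_real l * (1 - u)) ^ (w - j) / fact (w - j))"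
        unfolding 1 2 power_mult_distrib using l by (simp add: divide_simps)
    qed
    also have "\<dots> = of_real (exp (- l) * fact w / l ^ (w + 1)) * (\<Sum>j\<le>w. (of_real l * (1 - u)) ^ (w - j) / fact (w - j))"
      by (simp add: sum_distrib_left)
    also have "(\<Sum>j\<le>w. (of_real l * (1 - u)) ^ (w - j) / fact (w - j)) = (\<Sum>i\<le>w. (of_real l * (1 - u)) ^ i / fact i)"
      by (rule sum.reindex_bij_witness[of _ "\<lambda>i. w - i" "\<lambda>i. w - i"]) auto
    finally show ?thesis .
  qed
  finally show ?thesis
    by (subst lborel_has_bochner_integral_real_affine_iff[of 1 _ _ 1]) simp_all
qed

lemma sum_exp_series_le:
  fixes x :: real
  assumes "x \<ge> 0"
  shows "(\<Sum>i\<le>w. x ^ i / fact i) \<le> exp x"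
proof -
  have "(\<Sum>i\<le>w. x ^ i / fact i) \<le> (\<Sum>i. inverse (fact i) *\<^sub>R x ^ i)"
    unfolding lessThan_Suc_atMost[symmetric] using sum_le_suminf[OF summable_exp_generic[of x], of "{..<Suc w}"] assms
    by (auto simp: divide_inverse mult.commute)
  thus ?thesis by (simp add: exp_def)
qed

text \<open>
  The value of \<open>\<integral>\<^sub>1\<^sup>\<infinity> exp (-l t) (t + 1)\<^sup>w dt\<close>; for \<open>l = 2 \<pi> n\<close> it bounds the contribution of
  the \<open>n\<close>-th Fourier coefficient to \<open>W\<close> on the unit disc.
\<close>

definition term_bound :: "nat \<Rightarrow> real \<Rightarrow> real" where
  "term_bound w l = exp (- l) * fact w / l ^ (w + 1) * (\<Sum>i\<le>w. (l * 2) ^ i / fact i)"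

lemma term_bound_nonneg: "l > 0 \<Longrightarrow> term_bound w l \<ge> 0"
  unfolding term_bound_def by (intro mult_nonneg_nonneg divide_nonneg_nonneg sum_nonneg) auto

text \<open>Completes the truncated series to \<open>exp (2 l)\<close>; efficient while
  \<open>l\<close> is small against \<open>w\<close>, that is, for the first few
  \<open>n\<close>.\<close>

lemma term_bound_le_exp:
  assumes "l > 0"
  shows "term_bound w l \<le> exp l * fact w / l ^ (w + 1)"
proof -
  have "term_bound w l \<le> exp (- l) * fact w / l ^ (w + 1) * exp (l * 2)"
    unfolding term_bound_def using assms by (intro mult_left_mono sum_exp_series_le) auto
  also have "\<dots> = (exp (- l) * exp (l * 2)) * (fact w / l ^ (w + 1))" by simp
  also have "exp (- l) * exp (l * 2) = exp l" by (simp add: mult_exp_exp)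
  finally show ?thesis by simp
qed

text \<open>Taking \<open>2^i <= 2^w\<close> out of the series leaves \<open>exp l\<close>, which
  cancels: no exponential in \<open>l\<close> remains, as large \<open>n\<close> require.\<close>

lemma term_bound_le_power:
  assumes l: "l > 0"
  shows "term_bound w l \<le> 2 ^ w * fact w / l ^ (w + 1)"
proof -
  have "(\<Sum>i\<le>w. (l * 2) ^ i / fact i) \<le> (\<Sum>i\<le>w. 2 ^ w * (l ^ i / fact i))"
    using l by (intro sum_mono) (auto simp: power_mult_distrib field_simps intro!: mult_mono)
  also have "\<dots> \<le> 2 ^ w * exp l"
    unfolding sum_distrib_left[symmetric] using l by (intro mult_left_mono sum_exp_series_le) auto
  finally have "term_bound w l \<le> exp (- l) * fact w / l ^ (w + 1) * (2 ^ w * exp l)"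
    unfolding term_bound_def using l by (intro mult_left_mono) auto
  also have "\<dots> = (exp (- l) * exp l) * (2 ^ w * fact w / l ^ (w + 1))" by simp
  also have "exp (- l) * exp l = 1" by (simp add: mult_exp_exp)
  finally show ?thesis by simp
qed

section \<open>Numerical inequalities behind the weight bound\<close>

lemma exp_le_3_power: "exp (real n) \<le> 3 ^ n"
proof -
  have "exp (real n) = exp 1 ^ n" by (simp add: exp_of_nat_mult[symmetric])
  also have "\<dots> \<le> 3 ^ n" by (intro power_mono exp_le) auto
  finally show ?thesis .
qed

lemma exp_2pi_mult_le: "exp (2 * pi * real n) \<le> 3 ^ (8 * n)"
proof -
  have "exp (2 * pi * real n) \<le> exp (real (8 * n))"
    using pi_less_4 by (auto intro!: mult_right_mono)
  also have "\<dots> \<le> 3 ^ (8 * n)" by (rule exp_le_3_power)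
  finally show ?thesis .
qed

text \<open>Sharper than \<open>3^8\<close>, which would break the estimate for
  \<open>n >= 5\<close> below.\<close>

lemma exp_2pi_le: "exp (2 * pi) \<le> (272 / 100) ^ 8"
proof -
  have "exp (2 * pi) \<le> exp (8 * 1)" using pi_less_4 by simp
  also have "\<dots> = exp 1 ^ 8" by (subst exp_of_nat_mult[symmetric]) simp
  also have "\<dots> \<le> (272 / 100) ^ 8" by (intro power_mono less_imp_le e_less_272) auto
  finally show ?thesis .
qed

text \<open>With \<open>p = m - 2\<close>, these are the two bounds on \<open>term_bound\<close>
  relative to the \<open>n = 1\<close> term, cleared of denominators. The factor
  \<open>n (n - 1)\<close> is there to make the sum over \<open>n\<close> telescope to 1.\<close>

lemma coeff_growth_numeric:
  assumes n: "n \<ge> 2" and p: "p \<ge> 58"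
  shows "n < 5 \<Longrightarrow> exp (2 * pi * real (n + 1)) * (real n * (real n - 1)) \<le> 3 / 4 * real n ^ p"
    and "n \<ge> 5 \<Longrightarrow> exp (2 * pi) * 4 ^ (p + 1) * (real n * (real n - 1)) \<le> 3 / 4 * real n ^ p"
proof -
  assume "n < 5"
  hence n': "n = 2 \<or> n = 3 \<or> n = 4" using n by auto
  have "exp (2 * pi * real (n + 1)) * (real n * (real n - 1)) \<le> 3 ^ (8 * (n + 1)) * (real n * (real n - 1))"
    using n by (intro mult_right_mono exp_2pi_mult_le) auto
  also have "\<dots> \<le> 3 / 4 * real n ^ 58" using n' by auto
  also have "\<dots> \<le> 3 / 4 * real n ^ p" using n p by (intro mult_left_mono power_increasing) auto
  finally show "exp (2 * pi * real (n + 1)) * (real n * (real n - 1)) \<le> 3 / 4 * real n ^ p" .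
next
  assume n5: "n \<ge> 5"
  have "p = (p - 2) + 2" using p by simp
  hence "(real n / 4) ^ p = (real n / 4) ^ (p - 2) * (real n / 4) ^ 2"
    by (metis power_add)
  \<comment> \<open>Two powers of \<open>n / 4\<close> are held back to absorb
    \<open>n (n - 1)\<close>. The others give at least \<open>(5/4)^56\<close>, which exceeds the
    required \<open>(4/3) * 64 * 2.72^8\<close> by less than five percent: the bound 120 on the
    weight is used up here.\<close>
  also have "\<dots> \<ge> (5 / 4) ^ 56 * (real n / 4) ^ 2"
  proof (rule mult_right_mono)
    have "(5 / 4 :: real) ^ 56 \<le> (5 / 4) ^ (p - 2)" using p by (intro power_increasing) auto
    also have "\<dots> \<le> (real n / 4) ^ (p - 2)" using n5 by (intro power_mono) auto
    finally show "(5 / 4) ^ 56 \<le> (real n / 4) ^ (p - 2)" .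
  qed auto
  finally have A: "(5 / 4) ^ 56 * (real n / 4) ^ 2 \<le> (real n / 4) ^ p" .
  have "exp (2 * pi) * 4 * (real n * (real n - 1)) \<le> (272 / 100) ^ 8 * 4 * (real n * real n)"
    using n by (intro mult_mono exp_2pi_le) auto
  also have "\<dots> \<le> 3 / 4 * ((5 / 4) ^ 56 * (real n / 4) ^ 2)"
    by (simp add: power2_eq_square field_simps)
  also have "\<dots> \<le> 3 / 4 * (real n / 4) ^ p" using A by (intro mult_left_mono) auto
  finally have "exp (2 * pi) * 4 * (real n * (real n - 1)) \<le> 3 / 4 * real n ^ p / 4 ^ p"
    by (simp add: power_divide)
  thus "exp (2 * pi) * 4 ^ (p + 1) * (real n * (real n - 1)) \<le> 3 / 4 * real n ^ p"
    by (simp add: field_simps)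
qed

text \<open>Tailored to a Taylor remainder of \<open>exp\<close> at modulus at most 16:
  \<open>3^16\<close> stands for \<open>exp 16\<close>, and the factor 10 makes the remainder at
  most 1/10. The induction step gains \<open>Suc w >= 16\<close>.\<close>

lemma fact_ge_growth:
  assumes "(w::nat) \<ge> 118"
  shows "10 * 3 ^ 16 * 16 ^ (w + 1) \<le> (fact w :: real)"
  using assms
proof (induction w rule: nat_induct_at_least)
  case base
  have "10 * 3 ^ 16 * 16 ^ 119 \<le> (fact 118 :: nat)" by (simp add: fact_numeral)
  hence "real (10 * 3 ^ 16 * 16 ^ 119) \<le> real (fact 118)" by (subst of_nat_le_iff)
  thus ?case by simp
next
  case (Suc w)
  have "10 * 3 ^ 16 * 16 ^ (Suc w + 1) = 16 * (10 * 3 ^ 16 * 16 ^ (w + 1) :: real)" by simp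
  also have "\<dots> \<le> real (Suc w) * fact w" using Suc by (intro mult_mono) auto
  finally show ?case by simp
qed

text \<open>On the closed disc \<open>2 pi (1 - u)\<close> has non-negative real part, so its
  exponential has modulus at least 1; its own modulus is at most \<open>4 pi < 16\<close>, so
  cutting off at \<open>w\<close> costs at most 1/10.\<close>

lemma truncated_exp_lower_bound:
  assumes w: "w \<ge> 118" and u: "cmod u \<le> 1"
  shows "cmod (\<Sum>i\<le>w. (of_real (2 * pi) * (1 - u)) ^ i / fact i) \<ge> 9 / 10"
proof -
  define z where "z = of_real (2 * pi) * (1 - u)"
  have "cmod (1 - u) \<le> 2" using norm_triangle_ineq4[of 1 u] u by simp
  hence z: "cmod z \<le> 16"
    using pi_less_4 mult_mono[of pi 4 "cmod (1 - u)" 2] by (simp add: z_def norm_mult)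
  have Re: "Re z \<ge> 0"
    using complex_Re_le_cmod[of u] u by (simp add: z_def)
  have "cmod (exp z - (\<Sum>i\<le>w. z ^ i / fact i)) \<le> exp \<bar>Re z\<bar> * cmod z ^ Suc w / fact w"
    by (rule Taylor_exp)
  also have "\<dots> \<le> exp (real 16) * 16 ^ Suc w / fact w"
    using z abs_Re_le_cmod[of z] by (intro divide_right_mono mult_mono power_mono) auto
  also have "\<dots> \<le> 3 ^ 16 * 16 ^ Suc w / fact w"
    by (intro divide_right_mono mult_right_mono exp_le_3_power) auto
  also have "\<dots> \<le> 1 / 10" using fact_ge_growth[OF w] by (simp add: field_simps)
  finally have "cmod (exp z) - cmod (\<Sum>i\<le>w. z ^ i / fact i) \<le> 1 / 10"
    using norm_triangle_ineq2[of "exp z" "\<Sum>i\<le>w. z ^ i / fact i"] by linarith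
  moreover have "cmod (exp z) \<ge> 1" using Re by simp
  ultimately show ?thesis unfolding z_def by linarith
qed

lemma sums_inverse_consecutive: "(\<lambda>n. 1 / (real (n + 2) * (real (n + 2) - 1))) sums 1"
proof -
  have "(\<lambda>n. - (1 / real (n + 1))) \<longlonglongrightarrow> 0"
    using tendsto_minus[OF LIMSEQ_inverse_real_of_nat] by (simp add: divide_inverse add.commute)
  from telescope_sums[OF this]
  have "(\<lambda>n. - (1 / real (Suc n + 1)) - - (1 / real (n + 1))) sums 1" by simp
  moreover have "(\<lambda>n. - (1 / real (Suc n + 1)) - - (1 / real (n + 1))) =
      (\<lambda>n. 1 / (real (n + 2) * (real (n + 2) - 1)))"
    by (auto simp: fun_eq_iff field_simps)
  ultimately show ?thesis by metis
qed

text \<open>\<open>exp (-2 pi) w! / (2 pi)^(w+1)\<close> is the prefactor of the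
  \<open>n = 1\<close> term, so the terms are measured against the one that is to dominate. The
  total over \<open>n >= 2\<close> is 3/4, safely below 9/10.\<close>

lemma coeff_term_bound:
  assumes m: "m \<ge> 60" and n: "n \<ge> 2"
  shows "real n ^ (m + 1) * term_bound (2 * m - 2) (2 * pi * real n) \<le>
    exp (- 2 * pi) * (fact (2 * m - 2) / (2 * pi) ^ (2 * m - 1)) * (3 / 4) * (1 / (real n * (real n - 1)))"
proof -
  \<comment> \<open>Of the \<open>n^(2m-1)\<close> in the denominator, \<open>n^(m+1)\<close> is
    spent on the coefficient bound and \<open>n^p\<close> remains.\<close>
  define p where "p = m - 2"
  define K where "K = fact (2 * m - 2) / (2 * pi) ^ (2 * m - 1)"
  have p: "p \<ge> 58" "m = p + 2" using m by (auto simp: p_def)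
  have K: "K > 0" by (simp add: K_def)
  have exps: "2 * m - 2 + 1 = 2 * m - 1" "2 * m - 1 = (m + 1) + p" "2 * m - 2 = 2 * (p + 1)" using p by auto
  have pos: "2 * pi * real n > 0" "real n > 0" "real n * (real n - 1) > 0" using n by auto
  have le_div: "x / y \<le> 3 / 4 / z" if "x * z \<le> 3 / 4 * y" "z > 0" "y > 0" for x y z :: real
    using that by (simp add: field_simps)
  have np: "real n ^ (2 * m - 1) = real n ^ (m + 1) * real n ^ p"
    by (metis exps(2) power_add)
  have KK: "fact (2 * m - 2) / (2 * pi * real n) ^ (2 * m - 2 + 1) = K / (real n ^ (m + 1) * real n ^ p)"
    unfolding exps(1) power_mult_distrib[of "2 * pi"] K_def np by simp
  have "real n ^ (m + 1) * term_bound (2 * m - 2) (2 * pi * real n) \<le> exp (- 2 * pi) * K * (3 / 4 / (real n * (real n - 1)))"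
  proof (cases "n < 5")
    case True
    have "real n ^ (m + 1) * term_bound (2 * m - 2) (2 * pi * real n) \<le>
      real n ^ (m + 1) * (exp (2 * pi * real n) * (fact (2 * m - 2) / (2 * pi * real n) ^ (2 * m - 2 + 1)))"
      using pos by (intro mult_left_mono order.trans[OF term_bound_le_exp]) auto
    also have "\<dots> = exp (2 * pi * real n) / real n ^ p * K"
      unfolding KK using pos by (simp add: field_simps)
    also have "exp (2 * pi * real n) = exp (- 2 * pi) * exp (2 * pi * real (n + 1))"
      by (simp add: mult_exp_exp algebra_simps)
    also have "exp (- 2 * pi) * exp (2 * pi * real (n + 1)) / real n ^ p * K =
       exp (- 2 * pi) * K * (exp (2 * pi * real (n + 1)) / real n ^ p)" by simp
    also have "exp (2 * pi * real (n + 1)) / real n ^ p \<le> 3 / 4 / (real n * (real n - 1))"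
      using pos by (intro le_div coeff_growth_numeric(1)[OF n p(1) True]) auto
    finally show ?thesis using K by (simp add: mult_left_mono)
  next
    case False
    have "real n ^ (m + 1) * term_bound (2 * m - 2) (2 * pi * real n) \<le>
      real n ^ (m + 1) * (2 ^ (2 * m - 2) * (fact (2 * m - 2) / (2 * pi * real n) ^ (2 * m - 2 + 1)))"
      using pos by (intro mult_left_mono order.trans[OF term_bound_le_power]) auto
    also have "\<dots> = 2 ^ (2 * m - 2) / real n ^ p * K"
      unfolding KK using pos by (simp add: field_simps)
    also have "(2::real) ^ (2 * m - 2) = exp (- 2 * pi) * (exp (2 * pi) * 4 ^ (p + 1))"
      unfolding exps(3) power_mult by (simp add: mult.assoc[symmetric] mult_exp_exp)
    also have "exp (- 2 * pi) * (exp (2 * pi) * 4 ^ (p + 1)) / real n ^ p * K =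
       exp (- 2 * pi) * K * (exp (2 * pi) * 4 ^ (p + 1) / real n ^ p)" by simp
    also have "exp (2 * pi) * 4 ^ (p + 1) / real n ^ p \<le> 3 / 4 / (real n * (real n - 1))"
      using pos False by (intro le_div coeff_growth_numeric(2)[OF n p(1)]) auto
    finally show ?thesis using K by (simp add: mult_left_mono)
  qed
  thus ?thesis by (simp add: K_def)
qed

text \<open>In units of \<open>C * K\<close>, the first coefficient contributes at least 9/10 and
  all later ones together at most 3/4.\<close>

lemma half_period_integral_nonzero:
  fixes a :: "nat \<Rightarrow> complex" and \<phi> :: "real \<Rightarrow> complex"
  assumes m: "m \<ge> 60" and C: "C > 0" and a0: "a 0 = 0" and a1: "a 1 = of_real C"
    and bound: "\<And>n. cmod (a n) \<le> C * real n ^ (m + 1)"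
    and sums: "\<And>t. t \<ge> 1 \<Longrightarrow> (\<lambda>n. a n * of_real (exp (- (2 * pi * real n) * t))) sums \<phi> t"
    and summ: "\<And>t. t \<ge> 1 \<Longrightarrow> summable (\<lambda>n. cmod (a n) * exp (- (2 * pi * real n) * t))"
    and u: "cmod u \<le> 1"
  shows "(LINT t|lborel. indicator {1..} t *\<^sub>R (\<phi> t * (of_real t - u) ^ (2 * m - 2))) \<noteq> 0"
proof -
  define w where "w = 2 * m - 2"
  have w: "w \<ge> 118" "w + 1 = 2 * m - 1" using m by (auto simp: w_def)
  define K where "K = exp (- 2 * pi) * (fact w / (2 * pi) ^ (w + 1))"
  have K: "K > 0" by (simp add: K_def)
  define l where "l = (\<lambda>n. 2 * pi * real n)"
  define g where "g = (\<lambda>n t. a n * (indicator {1..} t *\<^sub>R (of_real (exp (- l n * t)) * (of_real t - u) ^ w)))"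
  \<comment> \<open>The integrand at \<open>u = -1\<close>: it majorizes all \<open>u\<close> in the
    disc at once, since \<open>|t - u| <= t + 1\<close>.\<close>
  define G where "G = (\<lambda>n t. indicator {1..} t *\<^sub>R (of_real (exp (- l n * t)) * (of_real t - (-1)) ^ w) :: real)"
  define J where "J = (\<lambda>n. complex_of_real (exp (- l n) * fact w / l n ^ (w + 1)) * (\<Sum>i\<le>w. (of_real (l n) * (1 - u)) ^ i / fact i))"
  have gJ: "has_bochner_integral lborel (g n) (a n * J n)" for n
  proof (cases "n = 0")
    case True
    thus ?thesis by (simp add: g_def a0 has_bochner_integral_iff)
  next
    case False
    thus ?thesis unfolding g_def J_def
      by (intro has_bochner_integral_mult_right has_bochner_integral_exp_shifted_power) (auto simp: l_def)
  qed
  have GI: "has_bochner_integral lborel (G n) (term_bound w (l n))" if "n > 0" for n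
    using has_bochner_integral_exp_shifted_power[of "l n" "-1 :: real" w] that
    by (simp add: l_def G_def term_bound_def)
  have g_le: "cmod (g n t) \<le> cmod (a n) * G n t" for n t
  proof -
    have "cmod (of_real t - u) \<le> t + 1" if "t \<ge> 1"
      using norm_triangle_ineq4[of "of_real t" u] u that by simp
    thus ?thesis
      by (auto simp: g_def G_def norm_mult norm_power split: split_indicator intro!: mult_left_mono power_mono)
  qed
  have int_le: "(LINT t|lborel. cmod (g n t)) \<le> cmod (a n) * term_bound w (l n)" if "n > 0" for n
  proof -
    have "(LINT t|lborel. cmod (g n t)) \<le> (LINT t|lborel. cmod (a n) * G n t)"
      using gJ[of n] GI[OF that] g_le
      by (intro integral_mono integrable_norm integrable_mult_right) (auto simp: has_bochner_integral_iff)
    also have "\<dots> = cmod (a n) * term_bound w (l n)"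
      using GI[OF that] by (simp add: has_bochner_integral_iff)
    finally show ?thesis .
  qed
  define B where "B = (\<lambda>n. C * (K * (3 / 4)) * (1 / (real (n + 2) * (real (n + 2) - 1))))"
  have B_sums: "B sums (C * (K * (3 / 4)))"
    unfolding B_def using sums_mult[OF sums_inverse_consecutive, of "C * (K * (3 / 4))"] by (simp only: mult_1_right)
  have int_B: "(LINT t|lborel. cmod (g (n + 2) t)) \<le> B n" for n
  proof -
    have "(LINT t|lborel. cmod (g (n + 2) t)) \<le> cmod (a (n + 2)) * term_bound w (l (n + 2))"
      by (rule int_le) simp
    also have "\<dots> \<le> C * real (n + 2) ^ (m + 1) * term_bound w (l (n + 2))"
      by (intro mult_right_mono bound term_bound_nonneg) (auto simp: l_def)
    also have "\<dots> = C * (real (n + 2) ^ (m + 1) * term_bound w (l (n + 2)))" by simp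
    also have "\<dots> \<le> B n"
      using coeff_term_bound[OF m, of "n + 2"] C unfolding B_def K_def l_def w_def[symmetric] w(2)[symmetric] mult.assoc
      by (intro mult_left_mono) auto
    finally show ?thesis .
  qed
  have summ_int: "summable (\<lambda>n. LINT t|lborel. cmod (g n t))"
    by (rule summable_iff_shift[of _ 2, THEN iffD1], rule summable_comparison_test[OF _ sums_summable[OF B_sums]])
       (use int_B in auto)
  have summ_g: "summable (\<lambda>n. cmod (g n t))" for t
  proof (cases "t \<ge> 1")
    case True
    have "summable (\<lambda>n. cmod (a n) * exp (- (2 * pi * real n) * t) * cmod (of_real t - u) ^ w)"
      by (intro summable_mult2 summ True)
    thus ?thesis using True by (simp add: g_def norm_mult norm_power l_def mult.assoc)
  qed (simp add: g_def)
  have sum_g: "(\<Sum>n. g n t) = indicator {1..} t *\<^sub>R (\<phi> t * (of_real t - u) ^ w)" for t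
  proof (cases "t \<ge> 1")
    case True
    have "(\<lambda>n. a n * of_real (exp (- (2 * pi * real n) * t)) * (of_real t - u) ^ w) sums (\<phi> t * (of_real t - u) ^ w)"
      by (intro sums_mult2 sums True)
    thus ?thesis using True by (intro sums_unique[symmetric]) (simp add: g_def l_def mult.assoc)
  qed (simp add: g_def)
  have "(\<lambda>n. LINT t|lborel. g n t) sums (LINT t|lborel. (\<Sum>n. g n t))"
    using gJ summ_g summ_int by (intro sums_integral) (auto simp: has_bochner_integral_iff)
  hence S: "(\<lambda>n. a n * J n) sums (LINT t|lborel. indicator {1..} t *\<^sub>R (\<phi> t * (of_real t - u) ^ w))"
    using gJ by (simp add: sum_g has_bochner_integral_iff)
  let ?W = "LINT t|lborel. indicator {1..} t *\<^sub>R (\<phi> t * (of_real t - u) ^ w)"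
  have aJ: "cmod (a (n + 2) * J (n + 2)) \<le> B n" for n
  proof -
    have "a (n + 2) * J (n + 2) = (LINT t|lborel. g (n + 2) t)"
      using gJ[of "n + 2"] by (simp add: has_bochner_integral_iff)
    also have "cmod \<dots> \<le> (LINT t|lborel. cmod (g (n + 2) t))" by (rule integral_norm_bound)
    also note int_B
    finally show ?thesis .
  qed
  have "(\<lambda>n. a (n + 2) * J (n + 2)) sums (?W - (\<Sum>n<2. a n * J n))"
    using S by (rule sums_split_initial_segment)
  hence S2: "(\<lambda>n. a (n + 2) * J (n + 2)) sums (?W - a 1 * J 1)"
    by (simp add: a0 numeral_2_eq_2)
  have "cmod (?W - a 1 * J 1) \<le> C * (K * (3 / 4))"
    using norm_suminf_le[of "\<lambda>n. a (n + 2) * J (n + 2)" B] aJ S2 B_sums by (simp add: sums_iff)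
  moreover have "cmod (a 1 * J 1) \<ge> C * (K * (9 / 10))"
  proof -
    have "cmod (a 1 * J 1) = C * (K * cmod (\<Sum>i\<le>w. (of_real (2 * pi) * (1 - u)) ^ i / fact i))"
      unfolding a1 J_def l_def K_def using C by (simp add: norm_mult norm_divide norm_power del: of_real_mult)
    thus ?thesis using C K truncated_exp_lower_bound[OF w(1) u] by (simp add: mult_left_mono)
  qed
  moreover have "C * (K * (3 / 4)) < C * (K * (9 / 10))" using C K by simp
  ultimately show ?thesis unfolding w_def[symmetric] by auto
qed

section \<open>Eichler integrals and period polynomials\<close>

lemma cusp_form_axis_set_integrable_power:
  assumes f: "f \<in> cusp_forms k" and c: "c > 0"
  shows "set_integrable lborel {c..} (\<lambda>s. f (\<i> * of_real s) * of_real s ^ j)"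
proof -
  obtain a where a: "has_q_expansion f a" "a 0 = 0" using cusp_form_q_expansion[OF f] .
  obtain K where K: "K \<ge> 0" "\<And>z. Im z \<ge> c \<Longrightarrow> cmod (f z) \<le> K * exp (- (2 * pi * Im z))"
    using cusp_form_decay[OF a c] by auto
  have "(\<lambda>s. f (\<i> * complex_of_real s)) \<in> borel_measurable borel"
    by (rule measurable_compose[OF _ measurable_cusp_form[OF f]])
       (intro borel_measurable_continuous_onI continuous_intros)
  hence [measurable]: "(\<lambda>s. f (\<i> * complex_of_real s) * of_real s ^ j) \<in> borel_measurable borel"
    by (intro borel_measurable_times) (auto intro!: borel_measurable_continuous_onI continuous_intros)
  have "integrable lborel (\<lambda>t. indicator {0..} t * (t ^ j * exp (- (2 * pi) * t)) :: real)"
    using has_bochner_integral_power_exp[of "2 * pi" j] by (simp add: has_bochner_integral_iff)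
  hence "integrable lborel (\<lambda>t. K * (indicator {0..} t * (t ^ j * exp (- (2 * pi) * t))) :: real)"
    by (rule integrable_mult_right)
  thus ?thesis unfolding set_integrable_def
  proof (rule Bochner_Integration.integrable_bound)
    show "AE s in lborel. norm (indicator {c..} s *\<^sub>R (f (\<i> * of_real s) * of_real s ^ j))
      \<le> norm (K * (indicator {0..} s * (s ^ j * exp (- (2 * pi) * s))))"
    proof (intro AE_I2)
      fix s :: real
      show "norm (indicator {c..} s *\<^sub>R (f (\<i> * of_real s) * of_real s ^ j))
      \<le> norm (K * (indicator {0..} s * (s ^ j * exp (- (2 * pi) * s))))"
      proof (cases "s \<ge> c")
        case True
        have "cmod (f (\<i> * of_real s)) * s ^ j \<le> K * exp (- (2 * pi * s)) * s ^ j"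
          using K(2)[of "\<i> * of_real s"] True c by (intro mult_right_mono) auto
        thus ?thesis using True c K(1) by (simp add: norm_mult norm_power abs_mult mult_ac)
      qed simp
    qed
  qed simp
qed

lemma affine_power_expansion:
  fixes s u v :: complex
  shows "(s * v - u) ^ w = (\<Sum>j\<le>w. of_nat (w choose j) * (- u) ^ j * v ^ (w - j) * s ^ (w - j))"
proof -
  have "(s * v - u) ^ w = (- u + s * v) ^ w" by simp
  also have "\<dots> = (\<Sum>j\<le>w. of_nat (w choose j) * (- u) ^ j * (s * v) ^ (w - j))"
    by (rule binomial_ring)
  finally show ?thesis by (simp add: power_mult_distrib mult_ac)
qed

text \<open>The two parameters cover \<open>W\<close> (with \<open>v = 1\<close>) and its reflection
  (with \<open>v\<close> minus the argument and \<open>u = -1\<close>).\<close>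

lemma
  assumes f: "f \<in> cusp_forms k" and c: "c > 0"
  shows cusp_form_axis_set_integrable:
      "set_integrable lborel {c..} (\<lambda>s. f (\<i> * of_real s) * (of_real s * v - u) ^ w)"
    and cusp_form_axis_integral:
      "(LINT s:{c..}|lborel. f (\<i> * of_real s) * (of_real s * v - u) ^ w) =
       (\<Sum>j\<le>w. of_nat (w choose j) * (- u) ^ j * v ^ (w - j) * (LINT s:{c..}|lborel. f (\<i> * of_real s) * of_real s ^ (w - j)))"
proof -
  have eq: "(\<lambda>s. f (\<i> * of_real s) * (of_real s * v - u) ^ w) =
     (\<lambda>s. \<Sum>j\<le>w. (of_nat (w choose j) * (- u) ^ j * v ^ (w - j)) * (f (\<i> * of_real s) * of_real s ^ (w - j)))"
    unfolding affine_power_expansion sum_distrib_left by (simp add: mult_ac)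
  let ?h = "\<lambda>j s. f (\<i> * of_real s) * of_real s ^ (w - j)"
  let ?C = "\<lambda>j. of_nat (w choose j) * (- u) ^ j * v ^ (w - j)"
  have "has_bochner_integral lborel (\<lambda>s. indicator {c..} s *\<^sub>R ?h j s) (LINT s:{c..}|lborel. ?h j s)" for j
    using cusp_form_axis_set_integrable_power[OF f c, of "w - j"]
    unfolding set_lebesgue_integral_def set_integrable_def by (rule has_bochner_integral_integrable)
  hence "has_bochner_integral lborel (\<lambda>s. \<Sum>j\<le>w. ?C j * (indicator {c..} s *\<^sub>R ?h j s)) (\<Sum>j\<le>w. ?C j * (LINT s:{c..}|lborel. ?h j s))"
    by (intro has_bochner_integral_sum has_bochner_integral_mult_right) auto
  also have "(\<lambda>s. \<Sum>j\<le>w. ?C j * (indicator {c..} s *\<^sub>R ?h j s)) = (\<lambda>s. indicator {c..} s *\<^sub>R (\<Sum>j\<le>w. ?C j * ?h j s))"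
    by (simp add: scaleR_sum_right)
  finally have B: "has_bochner_integral lborel (\<lambda>s. indicator {c..} s *\<^sub>R (\<Sum>j\<le>w. ?C j * ?h j s)) (\<Sum>j\<le>w. ?C j * (LINT s:{c..}|lborel. ?h j s))" .
  show "set_integrable lborel {c..} (\<lambda>s. f (\<i> * of_real s) * (of_real s * v - u) ^ w)"
    unfolding eq set_integrable_def using B by (simp only: has_bochner_integral_iff)
  show "(LINT s:{c..}|lborel. f (\<i> * of_real s) * (of_real s * v - u) ^ w) = (\<Sum>j\<le>w. ?C j * (LINT s:{c..}|lborel. ?h j s))"
    unfolding eq set_lebesgue_integral_def[of lborel "{c..}" "\<lambda>s. \<Sum>j\<le>w. ?C j * ?h j s"] using B by (simp only: has_bochner_integral_iff)
qed

lemma eichler_integral_axis: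
  assumes f: "f \<in> cusp_forms k" and y: "y > 0"
  shows "eichler_integral k f (\<i> * of_real y) =
    \<i> ^ (k - 2 + 1) * (LINT s:{y..}|lborel. f (\<i> * of_real s) * (of_real s * 1 - of_real y) ^ (k - 2))"
proof -
  let ?h = "\<lambda>s. f (\<i> * of_real s) * (of_real s * 1 - of_real y) ^ (k - 2)"
  let ?A = "LINT s:{y..}|lborel. ?h s"
  have "has_bochner_integral lborel (\<lambda>s. indicator {y..} s *\<^sub>R ?h s) ?A"
    using cusp_form_axis_set_integrable[OF f y, of 1 "of_real y" "k - 2"]
    unfolding set_lebesgue_integral_def set_integrable_def by (rule has_bochner_integral_integrable)
  hence "has_bochner_integral lborel (\<lambda>t. indicator {y..} (y + 1 * t) *\<^sub>R ?h (y + 1 * t)) (?A /\<^sub>R \<bar>1\<bar>)"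
    by (subst (asm) lborel_has_bochner_integral_real_affine_iff[of 1 _ _ y]) simp_all
  also have "(\<lambda>t. indicator {y..} (y + 1 * t) *\<^sub>R ?h (y + 1 * t)) =
     (\<lambda>t. indicator {0..} t *\<^sub>R (f (\<i> * of_real y + \<i> * of_real t) * of_real t ^ (k - 2)))"
    by (auto simp: fun_eq_iff distrib_left split: split_indicator)
  finally have "has_bochner_integral lborel (\<lambda>t. indicator {0..} t *\<^sub>R (f (\<i> * of_real y + \<i> * of_real t) * of_real t ^ (k - 2))) ?A"
    by simp
  hence "has_bochner_integral lborel (\<lambda>t. \<i> ^ (k - 2 + 1) * (indicator {0..} t *\<^sub>R (f (\<i> * of_real y + \<i> * of_real t) * of_real t ^ (k - 2)))) (\<i> ^ (k - 2 + 1) * ?A)"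
    by (intro has_bochner_integral_mult_right)
  also have "(\<lambda>t. \<i> ^ (k - 2 + 1) * (indicator {0..} t *\<^sub>R (f (\<i> * of_real y + \<i> * of_real t) * of_real t ^ (k - 2)))) =
     (\<lambda>t. indicator {0..} t *\<^sub>R (f (\<i> * of_real y + \<i> * of_real t) * ((\<i> * of_real y + \<i> * of_real t) - \<i> * of_real y) ^ (k - 2) * \<i>))"
    by (auto simp: fun_eq_iff power_mult_distrib split: split_indicator)
  finally have B: "has_bochner_integral lborel (\<lambda>t. indicator {0..} t *\<^sub>R (f (\<i> * of_real y + \<i> * of_real t) * ((\<i> * of_real y + \<i> * of_real t) - \<i> * of_real y) ^ (k - 2) * \<i>)) (\<i> ^ (k - 2 + 1) * ?A)" .
  hence "set_integrable lborel {0..} (\<lambda>t. f (\<i> * of_real y + \<i> * of_real t) * ((\<i> * of_real y + \<i> * of_real t) - \<i> * of_real y) ^ (k - 2) * \<i>)"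
    unfolding set_integrable_def by (simp only: has_bochner_integral_iff)
  from set_borel_integral_eq_integral(2)[OF this] B
  show ?thesis unfolding eichler_integral_def Let_def set_lebesgue_integral_def
    by (simp only: has_bochner_integral_iff)
qed

text \<open>Termwise Gamma integrals turn the Eichler integral into a power series in
  \<open>q\<close>, from which its holomorphy follows. The term \<open>n = 0\<close>, with its
  division by zero, vanishes.\<close>

lemma eichler_integral_series:
  assumes a: "has_q_expansion f a" "a 0 = 0" and z: "Im z > 0"
  shows "(\<lambda>n. \<i> ^ (k - 2 + 1) * a n * of_real (fact (k - 2) / (2 * pi * real n) ^ (k - 2 + 1)) * exp (2 * of_real pi * \<i> * z) ^ n)
    sums eichler_integral k f z"
proof -
  let ?q = "exp (2 * of_real pi * \<i> * z)"
  define w where "w = k - 2"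
  define b where "b = (\<lambda>n. \<i> ^ (w + 1) * a n * ?q ^ n)"
  define I where "I = (\<lambda>n. fact w / (2 * pi * real n) ^ (w + 1) :: real)"
  define G where "G = (\<lambda>n t. indicator {0..} t * (t ^ w * exp (- (2 * pi * real n) * t)) :: real)"
  have GI: "has_bochner_integral lborel (G n) (I n)" if "n > 0" for n
    unfolding G_def I_def using that by (intro has_bochner_integral_power_exp) simp
  have b0: "b 0 = 0" using a by (simp add: b_def)
  have bG: "has_bochner_integral lborel (\<lambda>t. b n * of_real (G n t)) (b n * of_real (I n))" for n
  proof (cases "n = 0")
    case False
    thus ?thesis by (intro has_bochner_integral_mult_right has_bochner_integral_of_real GI) auto
  qed (simp add: b0 has_bochner_integral_iff)
  have q1: "cmod ?q < 1" unfolding cmod_exp_2pi_i using z by simp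
  have term_sums: "(\<lambda>n. b n * of_real (G n t)) sums (indicator {0..} t *\<^sub>R (f (z + \<i> * of_real t) * ((z + \<i> * of_real t) - z) ^ w * \<i>))" for t
  proof (cases "t \<ge> 0")
    case True
    have "(\<lambda>n. a n * exp (2 * of_real pi * \<i> * (z + \<i> * of_real t)) ^ n) sums f (z + \<i> * of_real t)"
      using a(1)[unfolded has_q_expansion_def, THEN bspec, of "z + \<i> * of_real t"] z True by simp
    hence "(\<lambda>n. \<i> ^ (w + 1) * of_real t ^ w * (a n * exp (2 * of_real pi * \<i> * (z + \<i> * of_real t)) ^ n)) sums (\<i> ^ (w + 1) * of_real t ^ w * f (z + \<i> * of_real t))"
      by (rule sums_mult)
    moreover have "exp (2 * of_real pi * \<i> * (z + \<i> * of_real t)) ^ n = ?q ^ n * of_real (exp (- (2 * pi * real n) * t))" for n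
    proof -
      have "exp (2 * of_real pi * \<i> * (z + \<i> * of_real t)) = ?q * of_real (exp (- (2 * pi * t)))"
        unfolding distrib_left exp_add exp_2pi_i_imaginary ..
      moreover have "exp (- (2 * pi * t)) ^ n = exp (- (2 * pi * real n) * t)"
        by (simp add: exp_of_nat_mult[symmetric] mult_ac)
      ultimately show ?thesis by (simp only: power_mult_distrib of_real_power[symmetric])
    qed
    ultimately show ?thesis using True by (simp add: b_def G_def power_mult_distrib mult_ac)
  qed (simp add: G_def)
  have norm_eq: "norm (b n * of_real (G n t)) = cmod (b n) * G n t" for n t
    by (auto simp: norm_mult norm_power G_def abs_mult split: split_indicator)
  have cb: "cmod (b n) = cmod (a n) * cmod ?q ^ n" for n
    by (simp only: b_def norm_mult norm_power norm_ii power_one mult_1)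
  have summ: "summable (\<lambda>n. norm (b n * of_real (G n t)))" for t
  proof (cases "t \<ge> 0")
    case True
    have "summable (\<lambda>n. cmod (a n) * cmod ?q ^ n)"
      using q1 by (intro q_expansion_abs_summable[OF a(1)]) auto
    hence "summable (\<lambda>n. t ^ w * (cmod (a n) * cmod ?q ^ n))" by (rule summable_mult)
    thus ?thesis
    proof (rule summable_comparison_test'[of _ 0])
      fix n :: nat
      have "G n t \<le> t ^ w" using True by (simp add: G_def mult_left_le)
      hence "cmod (b n) * G n t \<le> cmod (b n) * t ^ w" by (intro mult_left_mono) auto
      thus "norm (norm (b n * of_real (G n t))) \<le> t ^ w * (cmod (a n) * cmod ?q ^ n)"
        unfolding norm_eq cb by (simp add: mult_ac abs_mult G_def split: split_indicator_asm)
    qed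
  qed (simp add: G_def)
  have int_norm: "(LINT t|lborel. norm (b n * of_real (G n t))) = cmod (b n) * I n" for n
  proof (cases "n = 0")
    case False
    thus ?thesis unfolding norm_eq using GI[of n] by (simp add: has_bochner_integral_iff)
  qed (simp add: b0)
  have summ_int: "summable (\<lambda>n. LINT t|lborel. norm (b n * of_real (G n t)))"
  proof -
    have "summable (\<lambda>n. cmod (a n) * cmod ?q ^ n)"
      using q1 by (intro q_expansion_abs_summable[OF a(1)]) auto
    hence "summable (\<lambda>n. fact w * (cmod (a n) * cmod ?q ^ n))" by (rule summable_mult)
    thus ?thesis
    proof (rule summable_comparison_test'[of _ 0])
      fix n :: nat
      have "cmod (b n) * I n \<le> cmod (b n) * fact w"
      proof (cases "n = 0")
        case False
        have "1 * 1 \<le> (2 * pi) * real n" using False pi_ge_two by (intro mult_mono) auto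
        hence "(2 * pi * real n) ^ (w + 1) \<ge> 1" by (intro one_le_power) simp
        hence "I n \<le> fact w / 1" unfolding I_def by (intro divide_left_mono) auto
        thus ?thesis by (intro mult_left_mono) auto
      qed (simp add: b0)
      moreover have "cmod (b n) * I n \<ge> 0" by (simp add: I_def)
      ultimately show "norm (LINT t|lborel. norm (b n * of_real (G n t))) \<le> fact w * (cmod (a n) * cmod ?q ^ n)"
        unfolding int_norm unfolding cb by (simp add: mult_ac)
    qed
  qed
  have lim: "(\<Sum>n. b n * of_real (G n t)) = indicator {0..} t *\<^sub>R (f (z + \<i> * of_real t) * ((z + \<i> * of_real t) - z) ^ w * \<i>)" for t
    using term_sums by (rule sums_unique[symmetric])
  have int: "integrable lborel (\<lambda>n. b m * of_real (G m n))" for m using bG[of m] by (simp add: has_bochner_integral_iff)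
  have "(\<lambda>n. LINT t|lborel. b n * of_real (G n t)) sums (LINT t|lborel. (\<Sum>n. b n * of_real (G n t)))"
    using int summ summ_int by (intro sums_integral) auto
  moreover have "(LINT t|lborel. b n * of_real (G n t)) = b n * of_real (I n)" for n
    using bG[of n] by (simp only: has_bochner_integral_iff)
  ultimately have S: "(\<lambda>n. b n * of_real (I n)) sums (LINT t|lborel. indicator {0..} t *\<^sub>R (f (z + \<i> * of_real t) * ((z + \<i> * of_real t) - z) ^ w * \<i>))"
    by (simp only: lim)
  have "integrable lborel (\<lambda>t. \<Sum>n. b n * of_real (G n t))"
    using int summ summ_int by (intro integrable_suminf) auto
  hence "set_integrable lborel {0..} (\<lambda>t. f (z + \<i> * of_real t) * ((z + \<i> * of_real t) - z) ^ w * \<i>)"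
    unfolding set_integrable_def by (simp only: lim)
  from set_borel_integral_eq_integral(2)[OF this]
  have "eichler_integral k f z = (LINT t|lborel. indicator {0..} t *\<^sub>R (f (z + \<i> * of_real t) * ((z + \<i> * of_real t) - z) ^ w * \<i>))"
    unfolding eichler_integral_def Let_def set_lebesgue_integral_def w_def by simp
  with S show ?thesis unfolding b_def I_def w_def by (simp add: mult_ac)
qed

lemma holomorphic_eichler_integral:
  assumes f: "f \<in> cusp_forms k"
  shows "eichler_integral k f holomorphic_on upper_half_plane"
proof -
  obtain a where a: "has_q_expansion f a" "a 0 = 0" using cusp_form_q_expansion[OF f] .
  define b where "b = (\<lambda>n. \<i> ^ (k - 2 + 1) * a n * of_real (fact (k - 2) / (2 * pi * real n) ^ (k - 2 + 1)))"
  define B where "B = (\<lambda>x. \<Sum>n. b n * x ^ n)"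
  have sums: "(\<lambda>n. b n * exp (2 * of_real pi * \<i> * z) ^ n) sums eichler_integral k f z" if "Im z > 0" for z
    using eichler_integral_series[OF a that] by (simp add: b_def)
  have summ: "summable (\<lambda>n. b n * x ^ n)" if x: "cmod x < 1" for x
  proof -
    define r where "r = (cmod x + 1) / 2"
    have r: "0 < r" "r < 1" "cmod x < r" using x by (auto simp: r_def add_nonneg_pos)
    define z where "z = \<i> * complex_of_real (- ln r / (2 * pi))"
    have "Im z > 0" using r by (simp add: z_def divide_neg_pos)
    moreover have "exp (2 * of_real pi * \<i> * z) = of_real r"
      unfolding z_def exp_2pi_i_imaginary using r by simp
    ultimately have "summable (\<lambda>n. b n * complex_of_real r ^ n)" using sums[of z] by (auto simp: sums_iff)
    thus ?thesis by (rule powser_inside) (use r in auto)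
  qed
  have "B holomorphic_on ball 0 1"
    by (rule power_series_holomorphic[of _ _ b]) (auto simp: B_def intro!: summable_sums summ)
  hence "B \<circ> (\<lambda>z. exp (2 * of_real pi * \<i> * z)) holomorphic_on upper_half_plane"
    by (intro holomorphic_on_compose_gen[of _ _ _ "ball 0 1"] holomorphic_intros) auto
  thus ?thesis
  proof (rule holomorphic_transform)
    fix z assume "z \<in> upper_half_plane"
    hence "(\<lambda>n. b n * exp (2 * of_real pi * \<i> * z) ^ n) sums eichler_integral k f z" by (intro sums) simp
    thus "(B \<circ> (\<lambda>z. exp (2 * of_real pi * \<i> * z))) z = eichler_integral k f z"
      by (simp add: B_def sums_iff)
  qed
qed

section \<open>Self-inversive polynomials and the shape of the period polynomial\<close>

lemma self_inversive_roots_unimodular: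
  fixes p :: "complex poly"
  assumes deg: "degree p \<le> w" and w: "w > 0"
    and nz: "\<And>x. cmod x \<le> 1 \<Longrightarrow> poly p x \<noteq> 0" and \<epsilon>: "cmod \<epsilon> = 1"
    and root: "poly p u + \<epsilon> * (\<Sum>i\<le>w. cnj (coeff p i) * u ^ (w - i)) = 0"
  shows "cmod u = 1"
proof -
  define S where "S = (\<lambda>u. \<Sum>i\<le>w. cnj (coeff p i) * u ^ (w - i))"
  have less: "cmod (S u) < cmod (poly p u)" if "cmod u < 1" for u
    unfolding S_def using deg w nz that by (rule reflected_poly_less)
  have eq: "cmod (poly p u) = cmod (S u)"
  proof -
    have "poly p u = - (\<epsilon> * S u)" using root by (simp add: S_def eq_neg_iff_add_eq_0)
    thus ?thesis using \<epsilon> by (simp add: norm_mult)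
  qed
  have "\<not> cmod u < 1" using less[of u] eq by auto
  moreover have "\<not> cmod u > 1"
  proof
    assume u: "cmod u > 1"
    hence u0: "u \<noteq> 0" by auto
    \<comment> \<open>Inversion in the unit circle exchanges \<open>p\<close> and its reflection
      \<open>S\<close>, up to conjugation and the factor \<open>u ^ w\<close>; the outside case
      becomes the inside case at \<open>v\<close>.\<close>
    define v where "v = 1 / cnj u"
    have v: "cmod v < 1" using u by (simp add: v_def norm_divide divide_less_eq)
    have poly: "poly p x = (\<Sum>i\<le>w. coeff p i * x ^ i)" for x
      unfolding poly_altdef using deg by (intro sum.mono_neutral_left) (auto simp: coeff_eq_0)
    have 1: "S u = u ^ w * cnj (poly p v)"
      unfolding S_def poly cnj_sum sum_distrib_left using u0
      by (intro sum.cong) (auto simp: v_def power_diff power_divide)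
    have 2: "poly p u = u ^ w * cnj (S v)"
      unfolding S_def poly cnj_sum sum_distrib_left
    proof (intro sum.cong refl)
      fix i assume "i \<in> {..w}"
      hence "u ^ w = u ^ i * u ^ (w - i)" by (simp add: power_add[symmetric])
      thus "coeff p i * u ^ i = u ^ w * cnj (cnj (coeff p i) * v ^ (w - i))"
        using u0 by (simp add: v_def power_divide)
    qed
    have "cmod (poly p u) < cmod (S u)"
      unfolding 1 2 norm_mult complex_mod_cnj using less[OF v] u0 by (intro mult_strict_left_mono) (auto simp: norm_power)
    thus False using eq by simp
  qed
  ultimately show ?thesis by simp
qed

lemma cusp_form_inversion_axis:
  assumes f: "f \<in> cusp_forms (2 * m)" and t: "t > 0"
  shows "f (\<i> * of_real (1 / t)) = (-1) ^ m * of_real t ^ (2 * m) * f (\<i> * of_real t)"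
proof -
  have "f (mob (0, -1, 1, 0) (\<i> * of_real t)) = aut (0, -1, 1, 0) (\<i> * of_real t) ^ (2 * m) * f (\<i> * of_real t)"
    using t by (intro cusp_form_mob[OF f]) (auto simp: SL2Z_def)
  moreover have "mob (0, -1, 1, 0) (\<i> * of_real t) = \<i> * of_real (1 / t)"
    using t by (simp add: field_simps)
  moreover have "aut (0, -1, 1, 0) (\<i> * of_real t) ^ (2 * m) = (-1) ^ m * of_real t ^ (2 * m)"
    by (simp add: power_mult power_mult_distrib) (rule power_minus)
  ultimately show ?thesis by simp
qed

text \<open>The two Eichler integrals start at \<open>y\<close> and at \<open>1 / y\<close>. By
  modularity, \<open>s = 1 / t\<close> turns the piece of the second from \<open>1 / y\<close> to 1
  into the piece from 1 to \<open>y\<close> missing in the first, so that both integrals end up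
  starting at 1.\<close>

lemma eichler_integral_axis_period:
  assumes f: "f \<in> cusp_forms (2 * m)" and m: "m \<ge> 1" and y: "y > 1"
  shows "eichler_integral (2 * m) f (\<i> * of_real y) -
      (\<i> * of_real y) ^ (2 * m - 2) * eichler_integral (2 * m) f (- 1 / (\<i> * of_real y)) =
    \<i> ^ (2 * m - 2 + 1) *
      ((LINT s:{1..}|lborel. f (\<i> * of_real s) * (of_real s * 1 - of_real y) ^ (2 * m - 2)) +
       (-1) ^ m * (LINT s:{1..}|lborel. f (\<i> * of_real s) * (of_real s * (- of_real y) - (-1)) ^ (2 * m - 2)))"
proof -
  define w where "w = 2 * m - 2"
  have w: "even w" "w + 2 = 2 * m" using m by (auto simp: w_def)
  define h where "h = (\<lambda>s. f (\<i> * of_real s) * (of_real s * 1 - of_real y) ^ w)"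
  define g where "g = (\<lambda>s. f (\<i> * of_real s) * (of_real s * 1 - of_real (1 / y)) ^ w)"
  have y0: "y > 0" "1 / y > 0" "1 / y < 1" using y by auto
  have int: "set_integrable lborel {c..} h" "set_integrable lborel {c..} g" if "c > 0" for c
    unfolding h_def g_def by (rule cusp_form_axis_set_integrable[OF f that])+
  note conv = set_borel_integral_eq_integral
  have cont: "continuous_on {c..d} (\<lambda>s. f (\<i> * of_real s))" if "c > 0" for c d
  proof -
    have "continuous_on upper_half_plane f"
      using f by (auto simp: cusp_forms_def intro: holomorphic_on_imp_continuous_on)
    thus ?thesis
      by (rule continuous_on_compose2) (use that in \<open>auto intro!: continuous_intros\<close>)
  qed
  have cont_h: "continuous_on {c..d} h" "continuous_on {c..d} g" if "c > 0" for c d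
    unfolding h_def g_def by (intro continuous_intros cont that)+
  have h_split: "integral {1..} h = integral {1..y} h + integral {y..} h"
  proof -
    have "{1..} = {1..y} \<union> {y..}" "{1..y} \<inter> {y..} = {y}" using y by auto
    thus ?thesis
      using integral_Un[of h "{1..y}" "{y..}"] cont_h[of 1 y] conv(1)[OF int(1)[OF y0(1)]]
      by (simp add: integrable_continuous_interval)
  qed
  have g_split: "integral {1/y..} g = integral {1/y..1} g + integral {1..} g"
  proof -
    have "{c..} = {c..1} \<union> {1..}" "{c..1} \<inter> {1..} = {1}" if "c < 1" for c :: real using that by auto
    from this[OF y0(3)] have "{1/y..} = {1/y..1} \<union> {1..}" "{1/y..1} \<inter> {1..} = {1}" .
    thus ?thesis
      using integral_Un[of g "{1/y..1}" "{1..}"] cont_h[of "1/y" 1] y0 conv(1)[OF int(2)[OF zero_less_one]]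
      by (simp add: integrable_continuous_interval)
  qed
  have "((\<lambda>t. (- 1 / t\<^sup>2) *\<^sub>R g (1 / t)) has_integral (integral {1 / 1..1 / y} g - integral {1 / y..1 / 1} g)) {1..y}"
  proof (rule has_integral_substitution_general[of "{}" 1 y "\<lambda>t. 1 / t" "1 / y" 1 g "\<lambda>t. - 1 / t\<^sup>2"])
    show "(\<lambda>t. 1 / t) ` {1..y} \<subseteq> {1 / y..1}" using y by (auto simp: field_simps)
    show "continuous_on {1 / y..1} g" by (rule cont_h(2)[OF y0(2)])
    show "continuous_on {1..y} ((/) 1)" by (intro continuous_intros) auto
    fix t assume "t \<in> {1..y} - {}"
    thus "((/) 1 has_real_derivative - 1 / t\<^sup>2) (at t within {1..y})"
      by (auto intro!: derivative_eq_intros simp: power2_eq_square)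
  qed (use y in auto)
  \<comment> \<open>Since \<open>1 / t\<close> reverses orientation, the substitution rule yields a
    difference of two integrals, and this one runs over an empty interval.\<close>
  moreover have "integral {1 / 1..1 / y} g = 0"
  proof -
    have "{1 / 1..1 / y} = {}" using y0 by auto
    thus ?thesis by (simp only: integral_empty)
  qed
  ultimately have "((\<lambda>t. (- 1 / t\<^sup>2) *\<^sub>R g (1 / t)) has_integral (- integral {1/y..1} g)) {1..y}"
    by simp
  hence "integral {1..y} (\<lambda>t. (- 1 / t\<^sup>2) *\<^sub>R g (1 / t)) = - integral {1/y..1} g"
    by (rule integral_unique)
  hence "of_real y ^ w * integral {1/y..1} g = - (of_real y ^ w * integral {1..y} (\<lambda>t. (- 1 / t\<^sup>2) *\<^sub>R g (1 / t)))"
    by (simp only: mult_minus_right minus_minus)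
  also have "\<dots> = integral {1..y} (\<lambda>t. - (of_real y ^ w * ((- 1 / t\<^sup>2) *\<^sub>R g (1 / t))))"
    by (simp only: integral_neg integral_mult_right)
  also have "\<dots> = integral {1..y} (\<lambda>t. (-1) ^ m * h t)"
  proof (rule integral_cong)
    fix t assume "t \<in> {1..y}"
    hence t: "t > 0" by auto
    have "complex_of_real y ^ w * of_real t ^ w * (of_real (1 / t) - of_real (1 / y)) ^ w = (of_real y - of_real t) ^ w"
      unfolding power_mult_distrib[symmetric] using t y0 by (intro arg_cong[of _ _ "\<lambda>x. x ^ w"]) (simp add: field_simps)
    also have "\<dots> = (- (of_real y - of_real t)) ^ w" using w(1) by (rule power_minus_even[symmetric])
    also have "\<dots> = (of_real t - of_real y) ^ w" by simp
    finally have 1: "complex_of_real y ^ w * of_real t ^ w * (of_real (1 / t) - of_real (1 / y)) ^ w = (of_real t - of_real y) ^ w" .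
    have "- (of_real y ^ w * ((- 1 / t\<^sup>2) *\<^sub>R g (1 / t))) =
       of_real y ^ w * (of_real t ^ (2 * m) / (of_real t)\<^sup>2) * (of_real (1 / t) - of_real (1 / y)) ^ w * ((-1) ^ m * f (\<i> * of_real t))"
      unfolding g_def cusp_form_inversion_axis[OF f t] by (simp add: scaleR_conv_of_real mult_ac)
    also have "complex_of_real t ^ (2 * m) / (of_real t)\<^sup>2 = of_real t ^ w"
      using t unfolding w(2)[symmetric] by (simp add: power_add power2_eq_square)
    finally show "- (of_real y ^ w * ((- 1 / t\<^sup>2) *\<^sub>R g (1 / t))) = (-1) ^ m * h t"
      unfolding 1 by (simp add: h_def mult_ac)
  qed
  also have "\<dots> = (-1) ^ m * integral {1..y} h" by simp
  finally have sub: "of_real y ^ w * integral {1/y..1} g = (-1) ^ m * integral {1..y} h" .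
  have g_scale: "of_real y ^ w * integral {1..} g = (LINT s:{1..}|lborel. f (\<i> * of_real s) * (of_real s * (- of_real y) - (-1)) ^ w)"
  proof -
    have "of_real y ^ w * integral {1..} g = of_real y ^ w * (LINT s:{1..}|lborel. g s)"
      using conv(2)[OF int(2)[OF zero_less_one]] by simp
    also have "\<dots> = (LINT s:{1..}|lborel. of_real y ^ w * g s)" by (simp add: set_integral_mult_right)
    also have "(\<lambda>s. of_real y ^ w * g s) = (\<lambda>s. f (\<i> * of_real s) * (of_real s * (- of_real y) - (-1)) ^ w)"
    proof
      fix s :: real
      have "complex_of_real y ^ w * (of_real s * 1 - of_real (1 / y)) ^ w = (- (of_real s * (- of_real y) - (-1))) ^ w"
        unfolding power_mult_distrib[symmetric] using y0 by (intro arg_cong[of _ _ "\<lambda>x. x ^ w"]) (simp add: field_simps)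
      also have "\<dots> = (of_real s * (- of_real y) - (-1)) ^ w" using w(1) by (rule power_minus_even)
      finally show "of_real y ^ w * g s = f (\<i> * of_real s) * (of_real s * (- of_real y) - (-1)) ^ w"
        unfolding g_def by (metis mult.left_commute)
    qed
    finally show ?thesis .
  qed
  have E1: "eichler_integral (2 * m) f (\<i> * of_real y) = \<i> ^ (w + 1) * integral {y..} h"
    unfolding eichler_integral_axis[OF f y0(1)] w_def[symmetric]
    using conv(2)[OF int(1)[OF y0(1)]] by (simp add: h_def)
  have "- 1 / (\<i> * complex_of_real y) = \<i> * of_real (1 / y)" using y0 by (simp add: field_simps)
  hence E2: "eichler_integral (2 * m) f (- 1 / (\<i> * of_real y)) = \<i> ^ (w + 1) * integral {1/y..} g"
    using eichler_integral_axis[OF f y0(2)] conv(2)[OF int(2)[OF y0(2)]] by (simp add: g_def w_def)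
  \<comment> \<open>This sign turns the difference in the definition of the period polynomial into a
    sum with \<open>(-1) ^ m\<close>.\<close>
  have iw: "\<i> ^ w = - ((-1) ^ m)"
  proof -
    have "\<i> ^ (w + 2) = (-1) ^ m" unfolding w(2) by (simp add: power_mult)
    thus ?thesis by (simp add: power_add) (metis minus_minus)
  qed
  have "eichler_integral (2 * m) f (\<i> * of_real y) - (\<i> * of_real y) ^ w * eichler_integral (2 * m) f (- 1 / (\<i> * of_real y)) =
    \<i> ^ (w + 1) * (integral {y..} h + (-1) ^ m * (of_real y ^ w * integral {1/y..} g))"
    unfolding E1 E2 power_mult_distrib iw by (simp add: algebra_simps)
  also have "of_real y ^ w * integral {1/y..} g = (-1) ^ m * integral {1..y} h + of_real y ^ w * integral {1..} g"
    unfolding g_split distrib_left sub ..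
  also have "integral {y..} h + (-1) ^ m * ((-1) ^ m * integral {1..y} h + of_real y ^ w * integral {1..} g) =
    integral {1..} h + (-1) ^ m * (of_real y ^ w * integral {1..} g)"
    unfolding h_split by (simp add: distrib_left mult.assoc[symmetric] power_add[symmetric])
  also have "integral {1..} h = (LINT s:{1..}|lborel. h s)"
    using conv(2)[OF int(1)[OF zero_less_one]] by simp
  finally show ?thesis unfolding g_scale w_def[symmetric] h_def .
qed

text \<open>The polynomial \<open>W\<close>, with the binomial expansion integrated term by term.\<close>

definition half_period_poly :: "nat \<Rightarrow> (complex \<Rightarrow> complex) \<Rightarrow> complex poly" where
  "half_period_poly w f = (\<Sum>j\<le>w. monom (of_nat (w choose j) * (-1) ^ j *
     (LINT s:{1..}|lborel. f (\<i> * of_real s) * of_real s ^ (w - j))) j)"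

lemma coeff_half_period_poly:
  "j \<le> w \<Longrightarrow> coeff (half_period_poly w f) j = of_nat (w choose j) * (-1) ^ j *
     (LINT s:{1..}|lborel. f (\<i> * of_real s) * of_real s ^ (w - j))"
  by (simp add: half_period_poly_def coeff_sum)

lemma degree_half_period_poly: "degree (half_period_poly w f) \<le> w"
  unfolding half_period_poly_def by (intro degree_sum_le) (auto intro: order.trans[OF degree_monom_le])

lemma poly_half_period_poly:
  assumes "f \<in> cusp_forms k"
  shows "poly (half_period_poly w f) u = (LINT s:{1..}|lborel. f (\<i> * of_real s) * (of_real s * 1 - u) ^ w)"
  unfolding cusp_form_axis_integral[OF assms zero_less_one] half_period_poly_def poly_sum poly_monom
  by (intro sum.cong refl) (simp add: power_minus[of u] mult_ac)

text \<open>\<open>f\<close> is real on the axis, so the moments are real and conjugation leaves the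
  coefficients unchanged; evenness of \<open>w\<close> distributes the signs.\<close>

lemma reflected_half_period_poly:
  assumes f: "f \<in> cusp_forms k" and w: "even w"
    and real: "\<And>s. s \<ge> 1 \<Longrightarrow> cnj (f (\<i> * of_real s)) = f (\<i> * of_real s)"
  shows "(\<Sum>j\<le>w. cnj (coeff (half_period_poly w f) j) * u ^ (w - j)) =
    (LINT s:{1..}|lborel. f (\<i> * of_real s) * (of_real s * (- u) - (-1)) ^ w)"
proof -
  have M: "cnj (LINT s:{1..}|lborel. f (\<i> * of_real s) * of_real s ^ j) = (LINT s:{1..}|lborel. f (\<i> * of_real s) * of_real s ^ j)" for j
  proof -
    have "cnj (LINT s:{1..}|lborel. f (\<i> * of_real s) * of_real s ^ j) =
      (LINT s|lborel. cnj (indicator {1..} s *\<^sub>R (f (\<i> * of_real s) * of_real s ^ j)))"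
      unfolding set_lebesgue_integral_def by (rule Bochner_Integration.integral_cnj[symmetric])
    also have "\<dots> = (LINT s:{1..}|lborel. f (\<i> * of_real s) * of_real s ^ j)"
      unfolding set_lebesgue_integral_def
      by (intro Bochner_Integration.integral_cong refl) (auto simp: real split: split_indicator)
    finally show ?thesis .
  qed
  show ?thesis
    unfolding cusp_form_axis_integral[OF f zero_less_one]
  proof (intro sum.cong refl)
    fix j assume "j \<in> {..w}"
    hence j: "j \<le> w" by simp
    have "even (w - j) \<longleftrightarrow> even j" using w j by simp
    hence "(- u) ^ (w - j) = (-1) ^ j * u ^ (w - j)"
      by (cases "even j") (auto simp: power_minus_odd)
    thus "cnj (coeff (half_period_poly w f) j) * u ^ (w - j) =
       of_nat (w choose j) * (- (-1)) ^ j * (- u) ^ (w - j) * (LINT s:{1..}|lborel. f (\<i> * of_real s) * of_real s ^ (w - j))"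
      unfolding coeff_half_period_poly[OF j] by (simp add: M)
  qed
qed

text \<open>The identity is computed only on the ray \<open>i y\<close>, \<open>y > 1\<close>, and
  extends to the upper half plane by analytic continuation. Since a polynomial is determined by its
  values there, the description in \<open>period_polynomial\<close> picks out exactly this
  one.\<close>

lemma poly_period_polynomial:
  assumes f: "f \<in> cusp_forms (2 * m)" and m: "m \<ge> 1"
    and real: "\<And>s. s \<ge> 1 \<Longrightarrow> cnj (f (\<i> * of_real s)) = f (\<i> * of_real s)"
  defines "p \<equiv> half_period_poly (2 * m - 2) f"
  shows "poly (period_polynomial (2 * m) f) z = \<i> ^ (2 * m - 2 + 1) *
    (poly p (- \<i> * z) + (-1) ^ m * (\<Sum>j\<le>2 * m - 2. cnj (coeff p j) * (- \<i> * z) ^ (2 * m - 2 - j)))"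
proof -
  define w where "w = 2 * m - 2"
  define S where "S = (\<Sum>j\<le>w. monom (cnj (coeff p j)) (w - j))"
  \<comment> \<open>\<open>W\<close> is evaluated at \<open>u\<close> where \<open>z = i u\<close>,
    hence the composition with \<open>[:0, - \<i>:]\<close>.\<close>
  define P where "P = smult (\<i> ^ (w + 1)) (pcompose (p + smult ((-1) ^ m) S) [:0, - \<i>:])"
  have poly_P: "poly P z = \<i> ^ (w + 1) * (poly p (- \<i> * z) + (-1) ^ m * (\<Sum>j\<le>w. cnj (coeff p j) * (- \<i> * z) ^ (w - j)))" for z
    by (simp add: P_def S_def poly_pcompose poly_sum poly_monom mult.commute)
  define E where "E = eichler_integral (2 * m) f"
  define D where "D = (\<lambda>z. E z - z ^ w * E (- 1 / z) - poly P z)"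
  have hol: "E holomorphic_on upper_half_plane" unfolding E_def by (rule holomorphic_eichler_integral[OF f])
  have "(\<lambda>z. - 1 / z) holomorphic_on upper_half_plane" by (intro holomorphic_intros) auto
  moreover have "(\<lambda>z. - 1 / z) ` upper_half_plane \<subseteq> upper_half_plane"
  proof
    fix x assume "x \<in> (\<lambda>z. - 1 / z) ` upper_half_plane"
    then obtain z where z: "Im z > 0" "x = - 1 / z" by auto
    hence "z \<noteq> 0" by auto
    hence "cmod z > 0" by simp
    moreover have "Im x = Im z / (cmod z)\<^sup>2" by (simp add: z(2) Im_divide cmod_power2)
    ultimately show "x \<in> upper_half_plane" using z(1) by simp
  qed
  ultimately have "(E \<circ> (\<lambda>z. - 1 / z)) holomorphic_on upper_half_plane"
    by (intro holomorphic_on_compose_gen[OF _ hol])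
  hence "(\<lambda>z. E (- 1 / z)) holomorphic_on upper_half_plane" by (simp only: o_def)
  hence hol_D: "D holomorphic_on upper_half_plane"
    unfolding D_def by (intro holomorphic_intros hol)
  have D_axis: "D (\<i> * of_real y) = 0" if y: "y > 1" for y
  proof -
    have y': "- \<i> * (\<i> * complex_of_real y) = of_real y" by simp
    have 1: "poly p (of_real y) = (LINT s:{1..}|lborel. f (\<i> * of_real s) * (of_real s * 1 - of_real y) ^ w)"
      unfolding p_def w_def by (rule poly_half_period_poly[OF f])
    have "even w" by (simp add: w_def)
    hence 2: "(\<Sum>j\<le>w. cnj (coeff p j) * of_real y ^ (w - j)) =
       (LINT s:{1..}|lborel. f (\<i> * of_real s) * (of_real s * (- of_real y) - (-1)) ^ w)"
      unfolding p_def w_def[symmetric] by (rule reflected_half_period_poly[OF f _ real])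
    have "poly P (\<i> * of_real y) = E (\<i> * of_real y) - (\<i> * of_real y) ^ w * E (- 1 / (\<i> * of_real y))"
      unfolding poly_P y' 1 2 unfolding E_def w_def by (rule eichler_integral_axis_period[OF f m y, symmetric])
    thus ?thesis unfolding D_def by simp
  qed
  have D0: "D z = 0" if z: "z \<in> upper_half_plane" for z
  proof (rule analytic_continuation[OF hol_D])
    show "open upper_half_plane" "connected upper_half_plane"
      unfolding upper_half_plane_def
      by (auto intro!: open_Collect_less continuous_intros convex_connected convex_halfspace_Im_gt)
    show "(\<lambda>y. \<i> * complex_of_real y) ` {1<..} \<subseteq> upper_half_plane" by auto
    show "2 * \<i> islimpt (\<lambda>y. \<i> * complex_of_real y) ` {1<..}"
      unfolding islimpt_approachable
    proof (intro allI impI)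
      fix e :: real assume e: "e > 0"
      have "dist (\<i> * complex_of_real (2 + e / 2)) (2 * \<i>) = e / 2"
        using e by (simp add: dist_norm algebra_simps norm_mult)
      thus "\<exists>x'\<in>(\<lambda>y. \<i> * complex_of_real y) ` {1<..}. x' \<noteq> 2 * \<i> \<and> dist x' (2 * \<i>) < e"
        using e by (intro bexI[of _ "\<i> * complex_of_real (2 + e / 2)"]) (auto simp: complex_eq_iff)
    qed
  qed (use z D_axis in auto)
  have PE: "poly P z = E z - z ^ (2 * m - 2) * E (- 1 / z)" if "z \<in> upper_half_plane" for z
    using D0[OF that] by (simp add: D_def w_def)
  have "period_polynomial (2 * m) f = P"
    unfolding period_polynomial_def
  proof (rule the_equality)
    show "\<forall>z\<in>upper_half_plane. poly P z = eichler_integral (2 * m) f z - z ^ (2 * m - 2) * eichler_integral (2 * m) f (- 1 / z)"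
      using PE by (simp add: E_def)
    fix q assume "\<forall>z\<in>upper_half_plane. poly q z = eichler_integral (2 * m) f z - z ^ (2 * m - 2) * eichler_integral (2 * m) f (- 1 / z)"
    thus "q = P" using PE by (intro poly_eq_on_upper_half_plane) (simp add: E_def)
  qed
  thus ?thesis using poly_P by (simp add: w_def)
qed

text \<open>Isolates what the argument uses of the form: real coefficients, and growth measured by
  the first coefficient. Both pass from eigenforms to non-negative combinations.\<close>

lemma satisfies_RH_of_coeff_bound:
  assumes f: "f \<in> cusp_forms (2 * m)" and m: "m \<ge> 60" and a: "has_q_expansion f a"
    and a0: "a 0 = 0" and C: "C > 0" and a1: "a 1 = of_real C"
    and real: "\<And>n. a n \<in> \<real>" and bound: "\<And>n. cmod (a n) \<le> C * real n ^ (m + 1)"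
  shows "satisfies_RH (period_polynomial (2 * m) f)"
proof -
  define p where "p = half_period_poly (2 * m - 2) f"
  have axis: "(\<lambda>n. a n * of_real (exp (- (2 * pi * real n) * t))) sums f (\<i> * of_real t)" if t: "t \<ge> 1" for t
  proof -
    have "(\<lambda>n. a n * exp (2 * of_real pi * \<i> * (\<i> * of_real t)) ^ n) sums f (\<i> * of_real t)"
      using a t by (simp add: has_q_expansion_def)
    moreover have "exp (2 * of_real pi * \<i> * (\<i> * of_real t)) ^ n = of_real (exp (- (2 * pi * real n) * t))" for n
      unfolding exp_2pi_i_imaginary of_real_power[symmetric] by (simp add: exp_of_nat_mult[symmetric] mult_ac)
    ultimately show ?thesis by simp
  qed
  have real_axis: "cnj (f (\<i> * of_real s)) = f (\<i> * of_real s)" if "s \<ge> 1" for s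
  proof -
    have "(\<lambda>n. cnj (a n * of_real (exp (- (2 * pi * real n) * s)))) sums cnj (f (\<i> * of_real s))"
      using axis[OF that] by (subst sums_cnj)
    moreover have "cnj (a n) = a n" for n using real[of n] by (simp add: Reals_cnj_iff)
    ultimately have "(\<lambda>n. a n * of_real (exp (- (2 * pi * real n) * s))) sums cnj (f (\<i> * of_real s))" by simp
    thus ?thesis using axis[OF that] by (rule sums_unique2)
  qed
  have nz: "poly p u \<noteq> 0" if u: "cmod u \<le> 1" for u
  proof -
    have "(LINT t|lborel. indicator {1..} t *\<^sub>R (f (\<i> * of_real t) * (of_real t - u) ^ (2 * m - 2))) \<noteq> 0"
    proof (rule half_period_integral_nonzero[OF m C a0 a1 bound _ _ u])
      fix t :: real assume t: "t \<ge> 1"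
      show "(\<lambda>n. a n * of_real (exp (- (2 * pi * real n) * t))) sums f (\<i> * of_real t)" by (rule axis[OF t])
      have "summable (\<lambda>n. cmod (a n) * exp (- (2 * pi * t)) ^ n)"
        using t by (intro q_expansion_abs_summable[OF a]) auto
      moreover have "exp (- (2 * pi * t)) ^ n = exp (- (2 * pi * real n) * t)" for n
        by (simp add: exp_of_nat_mult[symmetric] mult_ac)
      ultimately show "summable (\<lambda>n. cmod (a n) * exp (- (2 * pi * real n) * t))" by simp
    qed
    thus ?thesis unfolding p_def poly_half_period_poly[OF f] set_lebesgue_integral_def by simp
  qed
  show ?thesis unfolding satisfies_RH_def
  proof (intro allI impI)
    fix z assume "poly (period_polynomial (2 * m) f) z = 0"
    hence root: "poly p (- \<i> * z) + (-1) ^ m * (\<Sum>j\<le>2 * m - 2. cnj (coeff p j) * (- \<i> * z) ^ (2 * m - 2 - j)) = 0"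
      unfolding p_def using m poly_period_polynomial[OF f _ real_axis, of z] by simp
    have "degree p \<le> 2 * m - 2" unfolding p_def by (rule degree_half_period_poly)
    hence "cmod (- \<i> * z) = 1"
      by (rule self_inversive_roots_unimodular[OF _ _ nz _ root]) (use m in \<open>simp_all add: norm_power\<close>)
    thus "cmod z = 1" by (simp add: norm_mult)
  qed
qed

section \<open>From eigenforms to non-negative combinations\<close>

theorem theorem1p4:
  fixes k r :: nat and f :: "nat \<Rightarrow> complex \<Rightarrow> complex" and c :: "nat \<Rightarrow> real"
    and F :: "complex \<Rightarrow> complex"
  assumes "k \<ge> 120" and "even k"
    and "r = fun_dim (cusp_forms k)"
    and "normalized_eigenbasis k r f"
    and "\<And>i. i \<in> {1..r} \<Longrightarrow> c i \<ge> 0"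
    and "\<exists>i\<in>{1..r}. c i \<noteq> 0"
    and "F = (\<lambda>z. \<Sum>i=1..r. of_real (c i) * f i z)"
  shows "satisfies_RH (period_polynomial k F)"
proof -
  obtain m where k: "k = 2 * m" using assms(2) by auto
  have m: "m \<ge> 60" using assms(1) k by simp
  have f: "normalized_hecke_eigenform k (f i)" if "i \<in> {1..r}" for i
    using assms(4) that by (auto simp: normalized_eigenbasis_def)
  hence f_cusp: "f i \<in> cusp_forms (2 * m)" and f0: "f i \<noteq> 0" if "i \<in> {1..r}" for i
    using that by (auto simp: normalized_hecke_eigenform_def hecke_eigenform_def k)
  have "\<forall>i\<in>{1..r}. \<exists>a. has_q_expansion (f i) a \<and> a 0 = 0 \<and> a 1 = 1"
    using f by (auto simp: normalized_hecke_eigenform_def)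
  then obtain a where "\<forall>i\<in>{1..r}. has_q_expansion (f i) (a i) \<and> a i 0 = 0 \<and> a i 1 = 1"
    by (metis (no_types))
  hence a: "has_q_expansion (f i) (a i)" "a i 0 = 0" "a i 1 = 1" if "i \<in> {1..r}" for i
    using that by auto
  have coeff: "a i n \<in> \<real> \<and> cmod (a i n) \<le> real n ^ (m + 1)" if i: "i \<in> {1..r}" for i n
  proof (cases "n = 0")
    case False
    have "\<exists>\<mu>. \<forall>z. hecke_op (2 * m) n (f i) z = \<mu> * f i z"
      using f[OF i] False by (simp add: normalized_hecke_eigenform_def hecke_eigenform_def k)
    then obtain \<mu> where \<mu>: "\<And>z. hecke_op (2 * m) n (f i) z = \<mu> * f i z" by blast
    \<comment> \<open>The normalization \<open>a i 1 = 1\<close> makes the coefficient equal to the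
      eigenvalue.\<close>
    have "a i n = \<mu>"
      using hecke_eigenvalue_eq_coeff[OF a(1,2)[OF i] _ _ \<mu>] a(3)[OF i] False m by simp
    moreover have "\<mu> \<in> \<real>"
      using hecke_eigenvalue_real[OF f_cusp[OF i] f0[OF i] _ \<mu>] False by simp
    moreover have "cmod \<mu> \<le> real n ^ (m + 1)"
      using hecke_eigenvalue_bound[OF f_cusp[OF i] _ f0[OF i] _ \<mu>] False m by simp
    ultimately show ?thesis by simp
  qed (simp add: a(2)[OF i])
  define A where "A = (\<lambda>n. \<Sum>i=1..r. of_real (c i) * a i n)"
  define C where "C = (\<Sum>i=1..r. c i)"
  have F_cusp: "F \<in> cusp_forms (2 * m)"
  proof -
    have "(\<Sum>i=1..r. (\<lambda>z. of_real (c i) * f i z)) \<in> cusp_forms (2 * m)"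
      by (intro fun_vs.subspace_sum[OF subspace_cusp_forms] fun_vs.subspace_scale[OF subspace_cusp_forms] f_cusp)
    moreover have "(\<Sum>i\<in>I. (\<lambda>z. of_real (c i) * f i z)) = (\<lambda>z. \<Sum>i\<in>I. of_real (c i) * f i z)" for I
      by (induction I rule: infinite_finite_induct) (auto simp: fun_eq_iff)
    ultimately show ?thesis by (simp add: assms(7))
  qed
  have exp: "has_q_expansion F A"
    unfolding has_q_expansion_def
  proof
    fix z assume z: "z \<in> upper_half_plane"
    have "(\<lambda>n. \<Sum>i=1..r. of_real (c i) * (a i n * exp (2 * of_real pi * \<i> * z) ^ n)) sums (\<Sum>i=1..r. of_real (c i) * f i z)"
      using a(1) z by (intro sums_sum sums_mult) (auto simp: has_q_expansion_def)
    thus "(\<lambda>n. A n * exp (2 * of_real pi * \<i> * z) ^ n) sums F z"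
      by (simp add: A_def assms(7) sum_distrib_right mult.assoc)
  qed
  have C: "C > 0"
  proof -
    obtain i where "i \<in> {1..r}" "c i \<noteq> 0" using assms(6) by blast
    thus ?thesis unfolding C_def using assms(5)[of i] by (intro sum_pos2[of _ i] assms(5)) auto
  qed
  \<comment> \<open>Non-negativity enters: \<open>|c i| = c i\<close>, so the individual bounds add
    up to exactly \<open>C\<close>, which is the first coefficient \<open>A 1\<close>.\<close>
  have bound: "cmod (A n) \<le> C * real n ^ (m + 1)" for n
  proof -
    have "cmod (A n) \<le> (\<Sum>i=1..r. c i * real n ^ (m + 1))"
      unfolding A_def using assms(5) coeff
      by (intro sum_norm_le) (auto simp: norm_mult intro!: mult_left_mono)
    thus ?thesis by (simp add: C_def sum_distrib_right)
  qed
  have "A 0 = 0" "A 1 = of_real C" using a by (simp_all add: A_def C_def)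
  moreover have "A n \<in> \<real>" for n
    unfolding A_def using coeff by (intro sum_in_Reals Reals_mult) auto
  ultimately show ?thesis
    unfolding k using C bound by (intro satisfies_RH_of_coeff_bound[OF F_cusp m exp]) auto
qed

end
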